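(* Let $F\in\mathbb{C}[X,Y]^2$ satisfy $\det J_F(X,Y)\in\mathbb{C}^{\times}$, and let $R_0(F)$ be a geometric basis of $F$. If for all $R\in R_0(F)$ we have $\{S_R(X,Y)=0\}\cap\mathrm{sing}(R)=\emptyset$, then $F(\mathbb{C}^2)=\mathbb{C}^2$.
   Context: $F=(P,Q)$ and $J_F$ is its Jacobian matrix; $F$ is a Keller mapping if $\det J_F\in\mathbb{C}^{\times}$ (a nonzero constant). A point $(a,b)\in\mathbb{C}^2$ is an asymptotic value of $F$ if it is a limiting value of $F$ along a smooth curve in $\mathbb{C}^2$ tending to infinity; $A(F)$ is the set of all asymptotic values of $F$ (the asymptotic variety). If the Keller mapping $F$ is not an automorphism of $\mathbb{C}^2$, $A(F)$ is a plane algebraic curve; if $F$ is an automorphism, $A(F)=\emptyset$ and $R_0(F)=\emptyset$. A geometric basis $R_0(F)$ of a Keller mapping $F$ that is not an automorphism is a finite non-empty set of rational non-polynomial mappings $R\in\mathbb{C}(X,Y)^2$ of the form $R(X,Y)=L\circ(X^{-\alpha},X^{\beta}Y+X^{-\alpha}\Phi(X))$, where $L$ is a fixed invertible linear mapping of $\mathbb{C}^2$ (depending only on $F$), and (depending on $R$) $\alpha\in\mathbb{Z}^{+}$, $\beta\in\mathbb{Z}^{+}\cup\{0\}$, $\Phi\in\mathbb{C}[X]$, $\deg\Phi<\alpha+\beta$, and the gcd of the powers of $X$ that effectively appear in $X^{\alpha+\beta}Y+\Phi(X)$ equals $1$, such that, with $\mathrm{sing}(R)=\{X=0\}$: (i)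 the cardinality of $R_0(F)$ equals the number of irreducible components of $A(F)$; (ii) for every $R\in R_0(F)$, $\{G_R(a,b)\mid(a,b)\in\mathrm{sing}(R)\}$ is an irreducible component of $A(F)$ (the $R$-component); (iii) $A(F)=\bigcup_{R\in R_0(F)}\{G_R(a,b)\mid (a,b)\in\mathrm{sing}(R)\}$; (iv) for every $R\in R_0(F)$, $F\circ R$ (defined off $\mathrm{sing}(R)$) has a polynomial extension $G_R\in\mathbb{C}[X,Y]^2$ (the $R$-dual of $F$). For $R\in R_0(F)$, $H_R\in\mathbb{C}[X,Y]$ is an irreducible polynomial such that $H_R=0$ is the $R$-component of $A(F)$. The polynomial $S_R\in\mathbb{C}[X,Y]$ is defined by $(H_R\circ G_R)(X,Y)=X^{\gamma(R)}S_R(X,Y)$ with $\gamma(R)\in\mathbb{Z}^{+}$ and $S_R(0,Y)\not\equiv 0$ (all powers of $X$ are absorbed in $X^{\gamma(R)}$). The curve $\{S_R(X,Y)=0\}$ is the $R$-phantom curve. *)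

theory Defs
  imports
    "HOL-Analysis.Analysis"
    "HOL-Computational_Algebra.Polynomial_Factorial"
begin

(* C[X,Y] is represented as C[X][Y]: the outer variable is Y, the coefficients are in C[X]. *)
type_synonym bipoly = "complex poly poly"
type_synonym polymap = "bipoly \<times> bipoly"
type_synonym ratmap = "bipoly fract \<times> bipoly fract"

definition varX :: bipoly where "varX = [:[:0, 1:]:]"
definition varY :: bipoly where "varY = [:0, 1:]"

(* Substitution of (x, y) for (X, Y) in P, where x, y live in a commutative ring into which
   the constants are mapped by h. *)
definition subst2 :: "(complex \<Rightarrow> 'a::comm_ring_1) \<Rightarrow> bipoly \<Rightarrow> 'a \<times> 'a \<Rightarrow> 'a" where
  "subst2 h P z = poly (map_poly (\<lambda>c. poly (map_poly h c) (fst z)) P) (snd z)"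

definition eval_poly :: "bipoly \<Rightarrow> complex \<times> complex \<Rightarrow> complex" where
  "eval_poly = subst2 (\<lambda>c. c)"

definition eval_map :: "polymap \<Rightarrow> complex \<times> complex \<Rightarrow> complex \<times> complex" where
  "eval_map F z = (eval_poly (fst F) z, eval_poly (snd F) z)"

definition comp_poly :: "bipoly \<Rightarrow> polymap \<Rightarrow> bipoly" where
  "comp_poly = subst2 (\<lambda>c. [:[:c:]:])"

definition const_fract :: "complex \<Rightarrow> bipoly fract" where
  "const_fract c = to_fract [:[:c:]:]"

definition comp_rat :: "polymap \<Rightarrow> ratmap \<Rightarrow> ratmap" where
  "comp_rat F R = (subst2 const_fract (fst F) R, subst2 const_fract (snd F) R)"

definition rat_of_polymap :: "polymap \<Rightarrow> ratmap" where
  "rat_of_polymap G = (to_fract (fst G), to_fract (snd G))"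

definition zero_set :: "bipoly \<Rightarrow> (complex \<times> complex) set" where
  "zero_set P = {z. eval_poly P z = 0}"

definition partialX :: "bipoly \<Rightarrow> bipoly" where "partialX P = map_poly pderiv P"
definition partialY :: "bipoly \<Rightarrow> bipoly" where "partialY P = pderiv P"

definition jacobian_matrix :: "polymap \<Rightarrow> bipoly^2^2" where
  "jacobian_matrix F =
     vector [vector [partialX (fst F), partialY (fst F)],
             vector [partialX (snd F), partialY (snd F)]]"

definition keller :: "polymap \<Rightarrow> bool" where
  "keller F \<longleftrightarrow> (\<exists>c. c \<noteq> 0 \<and> det (jacobian_matrix F) = [:[:c:]:])"

definition is_automorphism :: "polymap \<Rightarrow> bool" where
  "is_automorphism F \<longleftrightarrow>
     (\<exists>G. \<forall>z. eval_map F (eval_map G z) = z \<and> eval_map G (eval_map F z) = z)"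

(* Smooth means C-infinity on [0, \<infinity>); D n is the n-th derivative of the curve. *)
definition smooth_curve :: "(real \<Rightarrow> complex \<times> complex) \<Rightarrow> bool" where
  "smooth_curve \<gamma> \<longleftrightarrow>
     (\<exists>D. D 0 = \<gamma> \<and>
       (\<forall>n. \<forall>t\<ge>0. (D n has_vector_derivative D (Suc n) t) (at t within {0..})))"

definition asymptotic_variety :: "polymap \<Rightarrow> (complex \<times> complex) set" where
  "asymptotic_variety F =
     {w. \<exists>\<gamma>. smooth_curve \<gamma> \<and> filterlim \<gamma> at_infinity at_top \<and>
            ((\<lambda>t. eval_map F (\<gamma> t)) \<longlongrightarrow> w) at_top}"

definition algebraic_set :: "(complex \<times> complex) set \<Rightarrow> bool" where
  "algebraic_set Z \<longleftrightarrow> (\<exists>I. Z = (\<Inter>P\<in>I. zero_set P))"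

definition irreducible_algebraic_set :: "(complex \<times> complex) set \<Rightarrow> bool" where
  "irreducible_algebraic_set Z \<longleftrightarrow> algebraic_set Z \<and> Z \<noteq> {} \<and>
     (\<forall>Z1 Z2. algebraic_set Z1 \<and> algebraic_set Z2 \<and> Z = Z1 \<union> Z2 \<longrightarrow> Z = Z1 \<or> Z = Z2)"

definition irreducible_components ::
    "(complex \<times> complex) set \<Rightarrow> (complex \<times> complex) set set" where
  "irreducible_components A =
     {Z. irreducible_algebraic_set Z \<and> Z \<subseteq> A \<and>
         (\<forall>Z'. irreducible_algebraic_set Z' \<and> Z \<subseteq> Z' \<and> Z' \<subseteq> A \<longrightarrow> Z' = Z)}"

(* L o (X^(-a), X^b Y + X^(-a) Phi(X)) as an element of C(X,Y)^2 *)
definition basis_map :: "complex^2^2 \<Rightarrow> nat \<Rightarrow> nat \<Rightarrow> complex poly \<Rightarrow> ratmap" where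
  "basis_map L \<alpha> \<beta> \<Phi> =
     (let U = inverse (to_fract varX ^ \<alpha>);
          V = to_fract varX ^ \<beta> * to_fract varY + inverse (to_fract varX ^ \<alpha>) * to_fract [:\<Phi>:]
      in (const_fract (L $ 1 $ 1) * U + const_fract (L $ 1 $ 2) * V,
          const_fract (L $ 2 $ 1) * U + const_fract (L $ 2 $ 2) * V))"

definition X_exponents :: "bipoly \<Rightarrow> nat set" where
  "X_exponents P = {i. \<exists>j. coeff (coeff P j) i \<noteq> 0}"

definition basis_form :: "complex^2^2 \<Rightarrow> ratmap \<Rightarrow> bool" where
  "basis_form L R \<longleftrightarrow>
     (\<exists>\<alpha> \<beta> \<Phi>. \<alpha> > 0 \<and> degree \<Phi> < \<alpha> + \<beta> \<and>
        Gcd (X_exponents (varX ^ (\<alpha> + \<beta>) * varY + [:\<Phi>:])) = 1 \<and>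
        R = basis_map L \<alpha> \<beta> \<Phi>)"

(* All maps R of the above form have the same singular locus {X = 0}. *)
definition sing :: "ratmap \<Rightarrow> (complex \<times> complex) set" where
  "sing R = {z. fst z = 0}"

definition is_dual :: "polymap \<Rightarrow> ratmap \<Rightarrow> polymap \<Rightarrow> bool" where
  "is_dual F R G \<longleftrightarrow> comp_rat F R = rat_of_polymap G"

(* G_R; meaningful only when F o R is polynomial, in which case G_R is unique *)
definition dual :: "polymap \<Rightarrow> ratmap \<Rightarrow> polymap" where
  "dual F R = (THE G. is_dual F R G)"

definition R_component :: "polymap \<Rightarrow> ratmap \<Rightarrow> (complex \<times> complex) set" where
  "R_component F R = eval_map (dual F R) ` sing R"

definition geometric_basis :: "polymap \<Rightarrow> ratmap set \<Rightarrow> bool" where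
  "geometric_basis F R0 \<longleftrightarrow>
     (if is_automorphism F then R0 = {}
      else finite R0 \<and> R0 \<noteq> {} \<and>
        (\<exists>L. invertible L \<and> (\<forall>R\<in>R0. basis_form L R)) \<and>
        (\<forall>R\<in>R0. R \<notin> range rat_of_polymap) \<and>
        card R0 = card (irreducible_components (asymptotic_variety F)) \<and>
        (\<forall>R\<in>R0. R_component F R \<in> irreducible_components (asymptotic_variety F)) \<and>
        asymptotic_variety F = (\<Union>R\<in>R0. R_component F R) \<and>
        (\<forall>R\<in>R0. \<exists>G. is_dual F R G))"

(* H_R, determined up to a nonzero constant factor *)
definition component_poly :: "polymap \<Rightarrow> ratmap \<Rightarrow> bipoly \<Rightarrow> bool" where
  "component_poly F R H \<longleftrightarrow> irreducible H \<and> zero_set H = R_component F R"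

(* S_R, determined by H = H_R *)
definition phantom_poly :: "polymap \<Rightarrow> ratmap \<Rightarrow> bipoly \<Rightarrow> bipoly \<Rightarrow> bool" where
  "phantom_poly F R H S \<longleftrightarrow>
     (\<exists>\<gamma>>0. comp_poly H (dual F R) = varX ^ \<gamma> * S) \<and> (\<exists>y. eval_poly S (0, y) \<noteq> 0)"

end

theory Submission
  imports Defs "Jordan_Normal_Form.Char_Poly" "HOL-Computational_Algebra.Formal_Laurent_Series"
    "HOL-Computational_Algebra.Field_as_Ring"
begin

text \<open>
  An automorphism is onto.  For a Keller mapping F that is not an automorphism the geometric basis
  is not empty, and the phantom curve of every R in it meets {X = 0} (\<open>phantom_meets_sing\<close>); so the
  assumption on the phantom curves leaves the automorphisms only.

  Suppose that S_R has no zero on X = 0, so that S_R(0,Y) is a nonzero constant.  Let G = (G1, G2) be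
  the R-dual and \<phi> = G1(0,Y), \<psi> = G2(0,Y); then (\<phi>, \<psi>) parametrises the R-component.  By the chain
  rule the Jacobian determinant of G is k X^e with a nonzero constant k (\<open>jac_dual\<close>).
  Differentiate H(G) = X^\<gamma> S and compare the lowest powers of X: it follows that e = \<gamma> - 1 and that
  (\<phi>, \<psi>) is an integral curve of the Hamiltonian vector field of a constant multiple of H
  (\<open>boundary_is_integral_curve\<close>).  Hence C[\<phi>, \<psi>] is closed under d/dY, and a subring of C[Y] with this
  property that contains C and a nonconstant polynomial is C[Y]: the R-component is an embedded line.
  By the theorem of Abhyankar and Moh (\<open>embedded_line_degrees\<close>) one of deg \<phi>, deg \<psi> divides the other
  when both are positive.  A shear (u, v) \<mapsto> (u, v - l u^k) of the target, or the same with u and v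
  exchanged, then lowers deg \<phi> + deg \<psi>; it preserves the Jacobian determinant of G up to sign and
  the form of H(G).  After finitely many shears one coordinate of G is constant on X = 0, and the Newton
  polygons of the two coordinates show that it depends on X only (\<open>monomial_jac_imp_vertical\<close>).  In the
  original coordinates: P(G) = p(X) for some polynomial P and some nonconstant p.  But
  P(G) = P(F(R)), and R(x,y) tends to 0 when x tends to infinity and y is chosen such that the second
  entry of R before the linear map L vanishes.  So p would be bounded at infinity, which is absurd
  (\<open>dual_vertical_impossible\<close>).

  The theorem of Abhyankar and Moh is proved with Puiseux series and approximate roots.  Let
  n = deg \<phi>, and choose a parameter T at infinity with \<phi> = T^n.  Then \<psi> is a Laurent series in 1/T with
  the n conjugates \<psi>_j obtained from T \<mapsto> \<zeta>^j T, where \<zeta> is a primitive n-th root of unity.  Let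
  D(j) = deg (\<psi>_0 - \<psi>_j).  The curve has an equation that is monic of degree n in v, and the
  v-derivative of this equation has degree \<Sum>D(j) along the curve (\<open>degree_curve_pderiv\<close>); by the
  Hamiltonian equations it divides d\<phi>/dY, so \<Sum>D(j) \<le> n - 1.  If n does not divide deg \<psi>, then
  D(1) = deg \<psi>.  An approximate root of the equation is a polynomial in u and v, and therefore its
  degree along the curve is not negative; on the other hand this degree is bounded by a partial sum of
  the D(j) (\<open>level_nonneg\<close>).  Taken together for all levels of the ultrametric D, these inequalities
  give \<Sum>D(j) \<ge> D(1) = deg \<psi> (\<open>spread_ge\<close>), and so n > deg \<psi>.
\<close>

section \<open>Substitution into bivariate polynomials\<close>

lemma comm_ring_hom_subst2:
  assumes "comm_ring_hom h"
  shows "comm_ring_hom (\<lambda>P. subst2 h P z)"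
proof -
  interpret h: comm_ring_hom h by fact
  interpret hp: map_poly_comm_ring_hom h ..
  have 1: "comm_ring_hom (\<lambda>c. poly (map_poly h c) (fst z))"
    by unfold_locales (auto simp: hom_distribs)
  interpret e: comm_ring_hom "\<lambda>c. poly (map_poly h c) (fst z)" by (fact 1)
  interpret ep: map_poly_comm_ring_hom "\<lambda>c. poly (map_poly h c) (fst z)" ..
  show ?thesis
    unfolding subst2_def by unfold_locales (auto simp: ep.hom_add ep.hom_mult)
qed

lemma comm_ring_hom_0: assumes "comm_ring_hom f" shows "f 0 = 0"
proof -
  interpret comm_ring_hom f by fact
  show ?thesis by simp
qed

lemma comm_ring_hom_1: assumes "comm_ring_hom f" shows "f 1 = 1"
proof -
  interpret comm_ring_hom f by fact
  show ?thesis by simp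
qed

lemma subst2_const: "h 0 = 0 \<Longrightarrow> subst2 h [:[:c:]:] z = h c"
  by (cases "c = 0") (simp_all add: subst2_def map_poly_pCons)

lemma subst2_varX: "h 0 = 0 \<Longrightarrow> h 1 = 1 \<Longrightarrow> subst2 h varX z = fst z"
  by (simp add: subst2_def map_poly_pCons varX_def)

lemma subst2_varY: "h 0 = 0 \<Longrightarrow> h 1 = 1 \<Longrightarrow> subst2 h varY z = snd z"
  by (simp add: subst2_def map_poly_pCons varY_def)

text \<open>
  Constants and the two variables generate the ring; most identities about substitution below are
  checked on these generators only.
\<close>

lemma bipoly_induct [case_names const varX varY add mult]:
  fixes P :: "bipoly \<Rightarrow> bool"
  assumes "\<And>c. P [:[:c:]:]" "P varX" "P varY"
    and add: "\<And>p q. P p \<Longrightarrow> P q \<Longrightarrow> P (p + q)"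
    and mult: "\<And>p q. P p \<Longrightarrow> P q \<Longrightarrow> P (p * q)"
  shows "P p"
proof -
  have inner: "P [:q:]" for q
  proof (induction q)
    case 0 show ?case using assms(1)[of 0] by simp
  next
    case (pCons a q)
    have "[:pCons a q:] = [:[:a:]:] + varX * [:q:]" by (simp add: varX_def)
    then show ?case using pCons assms by metis
  qed
  show ?thesis
  proof (induction p)
    case 0 show ?case using assms(1)[of 0] by simp
  next
    case (pCons a p)
    have "pCons a p = [:a:] + varY * p" by (simp add: varY_def)
    then show ?case using pCons assms inner by metis
  qed
qed

lemma subst2_unique:
  assumes "comm_ring_hom f" "comm_ring_hom g"
    and "\<And>c. f [:[:c:]:] = g [:[:c:]:]" "f varX = g varX" "f varY = g varY"
  shows "f p = g p"
proof -
  interpret f: comm_ring_hom f by fact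
  interpret g: comm_ring_hom g by fact
  show ?thesis
    by (induction p rule: bipoly_induct) (auto simp: assms f.hom_add g.hom_add f.hom_mult g.hom_mult)
qed

lemma comm_ring_hom_const_poly: "comm_ring_hom (\<lambda>c::complex. [:[:c:]:])"
  by unfold_locales (auto simp: one_pCons)

lemma comm_ring_hom_comp: "comm_ring_hom f \<Longrightarrow> comm_ring_hom g \<Longrightarrow> comm_ring_hom (\<lambda>x. f (g x))"
proof -
  assume "comm_ring_hom f" "comm_ring_hom g"
  then interpret f: comm_ring_hom f + g: comm_ring_hom g by auto
  show ?thesis by unfold_locales (auto simp: f.hom_add f.hom_mult g.hom_add g.hom_mult)
qed

lemma hom_subst2:
  assumes "comm_ring_hom f" "comm_ring_hom h"
  shows "f (subst2 h P (a, b)) = subst2 (\<lambda>c. f (h c)) P (f a, f b)"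
proof (rule subst2_unique[of "\<lambda>P. f (subst2 h P (a, b))" "\<lambda>P. subst2 (\<lambda>c. f (h c)) P (f a, f b)" P])
  interpret f: comm_ring_hom f by fact
  interpret h: comm_ring_hom h by fact
  show "comm_ring_hom (\<lambda>P. f (subst2 h P (a, b)))"
    by (rule comm_ring_hom_comp[OF assms(1) comm_ring_hom_subst2[OF assms(2)]])
  show "comm_ring_hom (\<lambda>P. subst2 (\<lambda>c. f (h c)) P (f a, f b))"
    by (rule comm_ring_hom_subst2[OF comm_ring_hom_comp[OF assms]])
  show "f (subst2 h [:[:c:]:] (a, b)) = subst2 (\<lambda>c. f (h c)) [:[:c:]:] (f a, f b)" for c
    by (simp add: subst2_const)
qed (simp_all add: subst2_varX subst2_varY comm_ring_hom_1[OF assms(1)] comm_ring_hom_1[OF assms(2)]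
       comm_ring_hom_0[OF assms(1)] comm_ring_hom_0[OF assms(2)])

lemma subst2_comp_poly:
  assumes "comm_ring_hom h"
  shows "subst2 h (comp_poly P (A, B)) z = subst2 h P (subst2 h A z, subst2 h B z)"
proof -
  interpret h: comm_ring_hom h by fact
  show ?thesis
    unfolding comp_poly_def
    using hom_subst2[OF comm_ring_hom_subst2[OF assms, of z] comm_ring_hom_const_poly, of P A B]
    by (simp add: subst2_const)
qed

locale derivation =
  fixes \<delta> :: "'a::comm_ring_1 \<Rightarrow> 'a"
  assumes add: "\<delta> (a + b) = \<delta> a + \<delta> b"
    and mult: "\<delta> (a * b) = \<delta> a * b + a * \<delta> b"
begin

lemma zero: "\<delta> 0 = 0"
  using add[of 0 0] by simp

lemma one: "\<delta> 1 = 0"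
  using mult[of 1 1] by simp

lemma minus: "\<delta> (a - b) = \<delta> a - \<delta> b"
  using add[of "a - b" b] by simp

lemma power: "\<delta> (a ^ k) = of_nat k * a ^ (k - 1) * \<delta> a"
proof (induction k)
  case (Suc k)
  show ?case
  proof (cases k)
    case (Suc l)
    then show ?thesis using Suc.IH by (simp add: mult algebra_simps)
  qed (simp add: one)
qed (simp add: one)

end

lemma derivation_pderiv: "derivation (pderiv :: 'a::idom poly \<Rightarrow> _)"
  by unfold_locales (auto simp: pderiv_add pderiv_mult algebra_simps)

lemma derivation_partialY: "derivation partialY"
  using derivation_pderiv unfolding partialY_def .

lemma coeff_partialX: "coeff (partialX P) j = pderiv (coeff P j)"
  by (simp add: partialX_def coeff_map_poly)

lemma derivation_partialX: "derivation partialX"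
proof
  fix a b :: bipoly
  show "partialX (a + b) = partialX a + partialX b"
    by (simp add: poly_eq_iff[of "partialX _"] coeff_partialX pderiv_add)
  have s: "pderiv (sum f A) = (\<Sum>x\<in>A. pderiv (f x))" for f :: "nat \<Rightarrow> complex poly" and A
    by (induction A rule: infinite_finite_induct) (auto simp: pderiv_add)
  show "partialX (a * b) = partialX a * b + a * partialX b"
  proof (rule poly_eqI)
    fix j
    have "coeff (partialX (a * b)) j = (\<Sum>i\<le>j. pderiv (coeff a i) * coeff b (j - i) + coeff a i * pderiv (coeff b (j - i)))"
      by (simp add: coeff_partialX coeff_mult s pderiv_mult algebra_simps)
    then show "coeff (partialX (a * b)) j = coeff (partialX a * b + a * partialX b) j"
      by (simp add: coeff_partialX coeff_mult sum.distrib)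
  qed
qed

interpretation partialX: derivation partialX by (rule derivation_partialX)
interpretation partialY: derivation partialY by (rule derivation_partialY)

lemma partial_const [simp]: "partialX [:[:c:]:] = 0" "partialY [:[:c:]:] = 0"
  by (rule poly_eqI; cases "c = 0"; simp add: coeff_partialX coeff_pCons pderiv_pCons split: nat.split)
    (simp add: partialY_def)

lemma partial_var [simp]: "partialX varX = 1" "partialX varY = 0" "partialY varX = 0" "partialY varY = 1"
  by (simp_all add: partialX_def partialY_def varX_def varY_def map_poly_pCons pderiv_pCons one_pCons)

text \<open>
  One rule serves for d/dY on C[Y] and for both partial derivatives on C[X,Y].
\<close>

lemma chain_rule:
  assumes "comm_ring_hom h" "derivation \<delta>" and const: "\<And>c. \<delta> (h c) = 0"
  shows "\<delta> (subst2 h P (a, b)) = subst2 h (partialX P) (a, b) * \<delta> a + subst2 h (partialY P) (a, b) * \<delta> b"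
proof -
  interpret h: comm_ring_hom h by fact
  interpret s: comm_ring_hom "\<lambda>P. subst2 h P (a, b)" by (rule comm_ring_hom_subst2) fact
  interpret d: derivation \<delta> by fact
  show ?thesis
    by (induction P rule: bipoly_induct)
      (simp_all add: subst2_const subst2_varX subst2_varY const d.add d.mult partialX.add partialX.mult
        partialY.add partialY.mult s.hom_add s.hom_mult algebra_simps)
qed

section \<open>Approximate roots of polynomials\<close>

text \<open>
  A degree bound that includes the zero polynomial and makes sense for k = 0, where it says that p
  vanishes; with \<^const>\<open>degree\<close> each of these cases would be an exception.
\<close>

definition deg_less :: "'a::zero poly \<Rightarrow> nat \<Rightarrow> bool" where
  "deg_less p k \<longleftrightarrow> (\<forall>i\<ge>k. coeff p i = 0)"

lemma deg_less_0 [simp]: "deg_less 0 k"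
  by (simp add: deg_less_def)

lemma deg_less_mono: "deg_less p k \<Longrightarrow> k \<le> l \<Longrightarrow> deg_less p l"
  by (auto simp: deg_less_def)

lemma deg_less_iff: "deg_less p k \<longleftrightarrow> p = 0 \<or> degree p < k"
proof
  assume *: "deg_less p k"
  have "p = 0" if "k \<le> degree p"
    using * that by (metis deg_less_def leading_coeff_0_iff)
  then show "p = 0 \<or> degree p < k" by force
qed (auto simp: deg_less_def coeff_eq_0)

lemma deg_less_add: "deg_less p k \<Longrightarrow> deg_less q k \<Longrightarrow> deg_less (p + q) k"
  and deg_less_diff: "deg_less p' k \<Longrightarrow> deg_less q' k \<Longrightarrow> deg_less (p' - q') k"
  for p q :: "'a::comm_monoid_add poly" and p' q' :: "'b::ab_group_add poly"
  by (auto simp: deg_less_def)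

lemma deg_less_smult: "deg_less p k \<Longrightarrow> deg_less (Polynomial.smult c p) k"
  by (auto simp: deg_less_def)

lemma deg_less_sum: "(\<And>i. i \<in> A \<Longrightarrow> deg_less (f i) k) \<Longrightarrow> deg_less (sum f A) k"
  for f :: "'b \<Rightarrow> 'a::comm_monoid_add poly"
  by (induction A rule: infinite_finite_induct) (auto intro: deg_less_add)

lemma deg_less_mult:
  fixes p q :: "'a::comm_semiring_0 poly"
  assumes "deg_less p a" "deg_less q (Suc b)"
  shows "deg_less (p * q) (a + b)"
proof (cases "p = 0 \<or> q = 0")
  case False
  then have "degree p < a" "degree q \<le> b" using assms by (auto simp: deg_less_iff)
  then have "degree (p * q) < a + b" using degree_mult_le[of p q] by linarith
  then show ?thesis by (simp add: deg_less_iff)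
qed auto

lemma deg_less_power:
  fixes p :: "'a::comm_semiring_1 poly"
  assumes "deg_less p (Suc N)"
  shows "deg_less (p ^ k) (Suc (k * N))"
proof (induction k)
  case 0 show ?case by (simp add: deg_less_def)
next
  case (Suc k)
  then show ?case using deg_less_mult[OF Suc assms] by (simp add: ac_simps)
qed

definition monic_of :: "nat \<Rightarrow> 'a::comm_ring_1 poly \<Rightarrow> bool" where
  "monic_of N p \<longleftrightarrow> deg_less (p - monom 1 N) N"

lemma monic_of_iff: "monic_of N p \<longleftrightarrow> coeff p N = 1 \<and> degree p = N"
proof
  assume *: "monic_of N p"
  have 1: "coeff p N = 1" using * unfolding monic_of_def deg_less_def by auto
  have "coeff p i = 0" if "i > N" for i
  proof -
    have "coeff (p - monom 1 N) i = 0" using * that unfolding monic_of_def deg_less_def by auto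
    then show ?thesis using that by simp
  qed
  then have "degree p \<le> N" by (simp add: degree_le)
  with 1 show "coeff p N = 1 \<and> degree p = N"
    by (metis le_antisym le_degree zero_neq_one)
next
  assume *: "coeff p N = 1 \<and> degree p = N"
  then show "monic_of N p"
    unfolding monic_of_def deg_less_def
    by (auto simp: coeff_eq_0 le_less)
qed

lemma monic_of_deg_less: "monic_of N p \<Longrightarrow> deg_less p (Suc N)"
  unfolding monic_of_iff deg_less_def by (auto simp: coeff_eq_0)

lemma monic_of_mult:
  assumes "monic_of a p" "monic_of b q" shows "monic_of (a + b) (p * q)"
proof -
  have "coeff (p * q) (a + b) = 1"
    using assms coeff_mult_degree_sum[of p q] by (simp add: monic_of_iff)
  moreover have "degree (p * q) \<le> a + b"
    using assms degree_mult_le[of p q] by (simp add: monic_of_iff)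
  ultimately show ?thesis
    unfolding monic_of_iff by (metis le_antisym le_degree zero_neq_one)
qed

lemma monic_of_1: "monic_of 0 1"
  by (simp add: monic_of_iff)

lemma monic_of_power: "monic_of N p \<Longrightarrow> monic_of (k * N) (p ^ k)"
  by (induction k) (auto simp: monic_of_1 intro: monic_of_mult)

lemma monic_of_diff: "monic_of N p \<Longrightarrow> monic_of N q \<Longrightarrow> deg_less (p - q) N"
  using deg_less_diff[of "p - monom 1 N" N "q - monom 1 N"] by (simp add: monic_of_def)

lemma monic_of_add: "monic_of N p \<Longrightarrow> deg_less q N \<Longrightarrow> monic_of N (p + q)"
  using deg_less_add[of "p - monom 1 N" N q] by (simp add: monic_of_def algebra_simps)

lemma monic_prod_linear: "monic_of k (\<Prod>j<k. [:- c j, 1 :: 'a::comm_ring_1:])"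
proof (induction k)
  case (Suc k)
  have "monic_of 1 [:- c k, 1:]" by (simp add: monic_of_iff)
  from monic_of_mult[OF Suc this] show ?case by simp
qed (simp add: monic_of_1)

text \<open>
  The cofactor of the second order term is needed with its degree: this is what makes each
  correction step in the next lemma gain one coefficient.
\<close>

lemma power_add_second_order:
  fixes K a :: "'a::comm_ring_1 poly"
  assumes "deg_less K (Suc N)" "deg_less a (Suc N)"
  shows "\<exists>W. (K + a) ^ Suc (Suc d) = K ^ Suc (Suc d) + of_nat (Suc (Suc d)) * a * K ^ Suc d + a\<^sup>2 * W
             \<and> deg_less W (Suc (d * N))"
proof (induction d)
  case 0
  have "(K + a) ^ Suc (Suc 0) = K ^ Suc (Suc 0) + of_nat (Suc (Suc 0)) * a * K ^ Suc 0 + a\<^sup>2 * 1"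
    by (simp add: algebra_simps power2_eq_square)
  moreover have "deg_less (1 :: 'a poly) (Suc (0 * N))" by (simp add: deg_less_def)
  ultimately show ?case by blast
next
  case (Suc d)
  then obtain W where W: "(K + a) ^ Suc (Suc d) = K ^ Suc (Suc d) + of_nat (Suc (Suc d)) * a * K ^ Suc d + a\<^sup>2 * W"
    and dW: "deg_less W (Suc (d * N))" by blast
  let ?W = "Polynomial.smult (of_nat (Suc (Suc d))) (K ^ Suc d) + W * (K + a)"
  have "(K + a) ^ Suc (Suc (Suc d)) = (K + a) * (K + a) ^ Suc (Suc d)" by simp
  also have "\<dots> = (K + a) * (K ^ Suc (Suc d) + of_nat (Suc (Suc d)) * a * K ^ Suc d + a\<^sup>2 * W)"
    by (simp only: W)
  also have "\<dots> = K ^ Suc (Suc (Suc d)) + of_nat (Suc (Suc (Suc d))) * a * K ^ Suc (Suc d)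
     + a\<^sup>2 * (of_nat (Suc (Suc d)) * K ^ Suc d + W * (K + a))"
    by (simp add: algebra_simps power2_eq_square)
  also have "of_nat (Suc (Suc d)) * K ^ Suc d + W * (K + a) = ?W"
    by (simp only: of_nat_poly) simp
  finally have "(K + a) ^ Suc (Suc (Suc d)) = K ^ Suc (Suc (Suc d)) + of_nat (Suc (Suc (Suc d))) * a * K ^ Suc (Suc d)
     + a\<^sup>2 * ?W" .
  moreover have "deg_less ?W (Suc (Suc d * N))"
  proof (rule deg_less_add)
    show "deg_less (Polynomial.smult (of_nat (Suc (Suc d))) (K ^ Suc d)) (Suc (Suc d * N))"
      by (intro deg_less_smult deg_less_power assms)
    show "deg_less (W * (K + a)) (Suc (Suc d * N))"
      using deg_less_mult[OF dW deg_less_add[OF assms]] by (simp add: ac_simps)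
  qed
  ultimately show ?case by blast
qed

text \<open>
  Newton iteration for the d-th root: if K agrees with the root so far and A is the quotient of
  H - K^d by M^(d-1), then K + A/d agrees in at least one further coefficient.  Here the exponent is
  written Suc (Suc d), and q is its inverse.  Dividing by the powers of the fixed polynomial M, and not
  of K, makes it possible to carry a filtration B through the iteration: it suffices that B is
  compatible with the ring operations and with this one division.  The lemma is used twice, with a
  Gauss norm as B over Laurent series and with the trivial filtration over C[u].
\<close>

lemma approximate_root_exists:
  fixes H M :: "'a::comm_ring_1 poly" and B :: "int \<Rightarrow> 'a poly set"
  assumes N: "0 < N" and q: "q * of_nat (Suc (Suc d)) = 1"
    and M: "monic_of N M" "M \<in> B \<mu>"
    and H: "monic_of (Suc (Suc d) * N) H" "H \<in> B (int (Suc (Suc d)) * \<mu>)"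
    and B_diff: "\<And>P Q r. P \<in> B r \<Longrightarrow> Q \<in> B r \<Longrightarrow> P - Q \<in> B r"
    and B_add: "\<And>P Q r. P \<in> B r \<Longrightarrow> Q \<in> B r \<Longrightarrow> P + Q \<in> B r"
    and B_smult: "\<And>P r. P \<in> B r \<Longrightarrow> Polynomial.smult q P \<in> B r"
    and B_mult: "\<And>P Q r s. P \<in> B r \<Longrightarrow> Q \<in> B s \<Longrightarrow> P * Q \<in> B (r + s)"
    and B_div: "\<And>P. P \<in> B (int (Suc (Suc d)) * \<mu>) \<Longrightarrow>
        \<exists>A R. P = M ^ Suc d * A + R \<and> deg_less R (Suc d * N) \<and> A \<in> B \<mu>"
  shows "\<exists>K \<in> B \<mu>. monic_of N K \<and> deg_less (H - K ^ Suc (Suc d)) (Suc d * N)"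
proof -
  have B_power: "P ^ Suc k \<in> B (int (Suc k) * r)" if "P \<in> B r" for P r k
  proof (induction k)
    case (Suc k)
    then show ?case using B_mult[OF that Suc] by (simp add: algebra_simps)
  qed (use that in simp)
  define n where "n = Suc (Suc d) * N"
  have "\<exists>K \<in> B \<mu>. monic_of N K \<and> deg_less (H - K ^ Suc (Suc d)) (n - t)" if "t \<le> N" for t
    using that
  proof (induction t)
    case 0
    show ?case using M H monic_of_diff[OF H(1) monic_of_power[OF M(1), of "Suc (Suc d)"]]
      by (auto simp: n_def)
  next
    case (Suc t)
    then obtain K where K: "K \<in> B \<mu>" "monic_of N K" "deg_less (H - K ^ Suc (Suc d)) (n - t)"
      by auto
    define Q where "Q = H - K ^ Suc (Suc d)"
    have "Q \<in> B (int (Suc (Suc d)) * \<mu>)"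
      unfolding Q_def using B_diff[OF H(2) B_power[OF K(1)]] by simp
    then obtain A R where AR: "Q = M ^ Suc d * A + R" "deg_less R (Suc d * N)" "A \<in> B \<mu>"
      using B_div by blast
    have nt: "Suc d * N \<le> n - t" "n - t = Suc d * N + (N - t)" using Suc.prems by (auto simp: n_def)
    have Mp: "monic_of (Suc d * N) (M ^ Suc d)" by (rule monic_of_power[OF M(1)])
    have dA: "deg_less A (N - t)"
    proof (rule ccontr)
      assume "\<not> deg_less A (N - t)"
      then have A: "A \<noteq> 0" "degree A \<ge> N - t" by (auto simp: deg_less_iff)
      have "M ^ Suc d * A = Q - R" using AR(1) by simp
      moreover have "deg_less (Q - R) (n - t)"
        using K(3) deg_less_mono[OF AR(2) nt(1)] by (auto simp: Q_def intro: deg_less_diff)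
      ultimately have "coeff (M ^ Suc d * A) (Suc d * N + degree A) = 0"
        using A(2) nt(2) by (simp add: deg_less_def)
      moreover have "coeff (M ^ Suc d * A) (Suc d * N + degree A) = lead_coeff A"
        using coeff_mult_degree_sum[of "M ^ Suc d" A] Mp unfolding monic_of_iff by simp
      ultimately show False using A(1) by simp
    qed
    \<comment> \<open>The correction a = A/d: the linear term d a K^(d-1) of (K + a)^d then removes the part of Q above the
      remainder, up to terms of smaller degree.\<close>
    define a where "a = Polynomial.smult q A"
    have da: "deg_less a (N - t)" unfolding a_def by (intro deg_less_smult dA)
    have qa: "of_nat (Suc (Suc d)) * a = A"
      unfolding a_def of_nat_poly using q by (simp add: mult.commute)
    have dK: "deg_less K (Suc N)" by (rule monic_of_deg_less[OF K(2)])
    obtain W where W: "(K + a) ^ Suc (Suc d) = K ^ Suc (Suc d) + of_nat (Suc (Suc d)) * a * K ^ Suc d + a\<^sup>2 * W"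
      and dW: "deg_less W (Suc (d * N))"
      using power_add_second_order[OF dK deg_less_mono[OF da], of d] by (meson diff_le_self le_SucI)
    have "H - (K + a) ^ Suc (Suc d) = Q - A * K ^ Suc d - a\<^sup>2 * W"
      unfolding W qa Q_def by simp
    also have "\<dots> = R - A * (K ^ Suc d - M ^ Suc d) - a\<^sup>2 * W"
      unfolding AR(1) by (simp add: algebra_simps)
    finally have eq: "H - (K + a) ^ Suc (Suc d) = R - A * (K ^ Suc d - M ^ Suc d) - a\<^sup>2 * W" .
    have 1: "deg_less R (n - Suc t)"
      by (rule deg_less_mono[OF AR(2)]) (use Suc.prems in \<open>simp add: n_def\<close>)
    have "deg_less (K ^ Suc d - M ^ Suc d) (Suc (Suc d * N - 1))"
      using monic_of_diff[OF monic_of_power[OF K(2)] Mp] N by (simp del: power_Suc)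
    then have "deg_less (A * (K ^ Suc d - M ^ Suc d)) (N - t + (Suc d * N - 1))"
      by (rule deg_less_mult[OF dA])
    then have 2: "deg_less (A * (K ^ Suc d - M ^ Suc d)) (n - Suc t)"
      by (rule deg_less_mono) (use Suc.prems N in \<open>simp add: n_def\<close>)
    have "deg_less a (Suc (N - t - 1))" using da by (rule deg_less_mono) (use Suc.prems in simp)
    from deg_less_mult[OF deg_less_mult[OF da this] dW]
    have "deg_less (a\<^sup>2 * W) (N - t + (N - t - 1) + d * N)" by (simp add: power2_eq_square)
    then have 3: "deg_less (a\<^sup>2 * W) (n - Suc t)"
      by (rule deg_less_mono) (use Suc.prems N in \<open>simp add: n_def\<close>)
    have "deg_less (H - (K + a) ^ Suc (Suc d)) (n - Suc t)"
      unfolding eq by (intro deg_less_diff 1 2 3)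
    moreover have "monic_of N (K + a)"
      by (rule monic_of_add[OF K(2)]) (use da in \<open>auto elim: deg_less_mono\<close>)
    moreover have "K + a \<in> B \<mu>" unfolding a_def by (intro B_add K(1) B_smult AR(3))
    ultimately show ?case by blast
  qed
  from this[of N] show ?thesis by (simp add: n_def)
qed

text \<open>
  Because of uniqueness the root with coefficients in C[u] and the root with a small Gauss norm are the
  same polynomial.  If K and L differ, then the second factor of K^d - L^d = (K - L) \<Sum> L^(d-1-i) K^i
  has leading coefficient d, so the difference is too large.
\<close>

lemma approximate_root_unique:
  fixes H K L :: "'a::idom poly"
  assumes d: "of_nat (Suc d) \<noteq> (0::'a)"
    and K: "monic_of N K" "deg_less (H - K ^ Suc d) (d * N)"
    and L: "monic_of N L" "deg_less (H - L ^ Suc d) (d * N)"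
  shows "K = L"
proof (rule ccontr)
  assume "K \<noteq> L"
  define S where "S = (\<Sum>i<Suc d. L ^ (Suc d - Suc i) * K ^ i)"
  have "coeff (L ^ (Suc d - Suc i) * K ^ i) (d * N) = 1 \<and> degree (L ^ (Suc d - Suc i) * K ^ i) \<le> d * N"
    if "i < Suc d" for i
  proof -
    have "monic_of ((Suc d - Suc i) * N + i * N) (L ^ (Suc d - Suc i) * K ^ i)"
      by (intro monic_of_mult monic_of_power K L)
    moreover have "(Suc d - Suc i) * N + i * N = d * N" using that
      by (simp flip: add_mult_distrib)
    ultimately show ?thesis by (simp add: monic_of_iff)
  qed
  then have cS: "coeff S (d * N) = of_nat (Suc d)" and dS: "degree S \<le> d * N"
    unfolding S_def by (simp_all only: coeff_sum) (simp, intro degree_sum_le, auto)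
  have "S \<noteq> 0" using cS d by auto
  have "degree S = d * N" using cS dS d by (metis le_antisym le_degree)
  have "K ^ Suc d - L ^ Suc d = (K - L) * S"
    unfolding S_def by (rule power_diff_sumr2)
  moreover have "deg_less ((H - L ^ Suc d) - (H - K ^ Suc d)) (d * N)"
    by (intro deg_less_diff K L)
  ultimately have "deg_less ((K - L) * S) (d * N)" by simp
  moreover have "degree ((K - L) * S) \<ge> d * N"
    using \<open>K \<noteq> L\<close> \<open>S \<noteq> 0\<close> \<open>degree S = d * N\<close> by (simp add: degree_mult_eq)
  ultimately show False using \<open>K \<noteq> L\<close> \<open>S \<noteq> 0\<close> by (auto simp: deg_less_iff)
qed

section \<open>Gauss norms over Laurent series\<close>

text \<open>
  The series are series in X = 1/T, so the degree in T is the negative of the order in X.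
\<close>

definition deg_le :: "'a::zero fls \<Rightarrow> int \<Rightarrow> bool" where
  "deg_le f c \<longleftrightarrow> (\<forall>i < - c. fls_nth f i = 0)"

lemma deg_le_iff: "deg_le f c \<longleftrightarrow> f = 0 \<or> - fls_subdegree f \<le> c"
proof
  assume *: "deg_le f c"
  show "f = 0 \<or> - fls_subdegree f \<le> c"
  proof (rule ccontr)
    assume "\<not> ?thesis"
    then have "f \<noteq> 0" "fls_subdegree f < - c" by auto
    then show False using * nth_fls_subdegree_nonzero[of f] by (auto simp: deg_le_def)
  qed
qed (auto simp: deg_le_def)

lemma deg_le_0 [simp]: "deg_le 0 c"
  by (simp add: deg_le_def)

lemma deg_le_mono: "deg_le f c \<Longrightarrow> c \<le> c' \<Longrightarrow> deg_le f c'"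
  by (auto simp: deg_le_def)

lemma deg_le_add: "deg_le f c \<Longrightarrow> deg_le g c \<Longrightarrow> deg_le (f + g) c"
  for f g :: "'a::comm_monoid_add fls"
  by (auto simp: deg_le_def)

lemma deg_le_diff: "deg_le f c \<Longrightarrow> deg_le g c \<Longrightarrow> deg_le (f - g) c"
  for f g :: "'a::ab_group_add fls"
  by (auto simp: deg_le_def)

lemma deg_le_sum: "(\<And>i. i \<in> A \<Longrightarrow> deg_le (f i) c) \<Longrightarrow> deg_le (sum f A) c"
  for f :: "'b \<Rightarrow> 'a::comm_monoid_add fls"
  by (induction A rule: infinite_finite_induct) (auto intro: deg_le_add)

lemma deg_le_mult: "deg_le f c \<Longrightarrow> deg_le g c' \<Longrightarrow> deg_le (f * g) (c + c')"
  for f g :: "'a::field fls"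
  by (cases "f = 0 \<or> g = 0") (auto simp: deg_le_iff)

lemma deg_le_divide: "deg_le f c \<Longrightarrow> g \<noteq> 0 \<Longrightarrow> deg_le (f / g) (c + fls_subdegree g)"
  for f g :: "'a::field fls"
  by (cases "f = 0") (auto simp: deg_le_iff fls_divide_subdegree)

lemma deg_le_1 [simp]: "deg_le (1 :: 'a::zero_neq_one fls) 0"
  by (simp add: deg_le_iff)

text \<open>
  P is bounded by \<rho> in the Gauss norm of the disc of radius e around r: for v = r + w with deg w \<le> e,
  each term of P(v) in powers of w has degree at most \<rho>.
\<close>

definition bounded_on_disc :: "'a::field fls \<Rightarrow> int \<Rightarrow> int \<Rightarrow> 'a fls poly \<Rightarrow> bool" where
  "bounded_on_disc r e \<rho> P \<longleftrightarrow> (\<forall>k. deg_le (coeff (pcompose P [:r, 1:]) k) (\<rho> - e * int k))"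

lemma bounded_on_disc_add: "bounded_on_disc r e \<rho> P \<Longrightarrow> bounded_on_disc r e \<rho> Q \<Longrightarrow> bounded_on_disc r e \<rho> (P + Q)"
  by (auto simp: bounded_on_disc_def pcompose_add intro: deg_le_add)

lemma bounded_on_disc_diff: "bounded_on_disc r e \<rho> P \<Longrightarrow> bounded_on_disc r e \<rho> Q \<Longrightarrow> bounded_on_disc r e \<rho> (P - Q)"
  by (auto simp: bounded_on_disc_def pcompose_diff intro: deg_le_diff)

lemma bounded_on_disc_0 [simp]: "bounded_on_disc r e \<rho> 0"
  by (simp add: bounded_on_disc_def)

lemma bounded_on_disc_sum: "(\<And>i. i \<in> A \<Longrightarrow> bounded_on_disc r e \<rho> (f i)) \<Longrightarrow> bounded_on_disc r e \<rho> (sum f A)"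
  by (induction A rule: infinite_finite_induct) (auto intro: bounded_on_disc_add)

lemma bounded_on_disc_mono: "bounded_on_disc r e \<rho> P \<Longrightarrow> \<rho> \<le> \<rho>' \<Longrightarrow> bounded_on_disc r e \<rho>' P"
  unfolding bounded_on_disc_def by (meson deg_le_mono diff_right_mono)

lemma bounded_on_disc_mult:
  assumes "bounded_on_disc r e \<rho> P" "bounded_on_disc r e \<sigma> Q"
  shows "bounded_on_disc r e (\<rho> + \<sigma>) (P * Q)"
  unfolding bounded_on_disc_def pcompose_mult coeff_mult
proof (intro allI deg_le_sum)
  fix k i :: nat assume "i \<in> {..k}"
  then have e: "\<rho> + \<sigma> - e * int k = (\<rho> - e * int i) + (\<sigma> - e * int (k - i))"
    by (simp add: algebra_simps of_nat_diff)
  show "deg_le (coeff (pcompose P [:r, 1:]) i * coeff (pcompose Q [:r, 1:]) (k - i)) (\<rho> + \<sigma> - e * int k)"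
    unfolding e using assms by (intro deg_le_mult) (auto simp: bounded_on_disc_def)
qed

lemma bounded_on_disc_smult:
  assumes "deg_le c \<sigma>" "bounded_on_disc r e \<rho> P"
  shows "bounded_on_disc r e (\<sigma> + \<rho>) (Polynomial.smult c P)"
  using assms deg_le_mult[of c \<sigma>]
  by (auto simp: bounded_on_disc_def pcompose_smult add_diff_eq[symmetric])

lemma bounded_on_disc_linear:
  assumes "deg_le (r - s) c" "e \<le> c"
  shows "bounded_on_disc r e c [:- s, 1:]"
  using assms unfolding bounded_on_disc_def
  by (auto simp: pcompose_pCons coeff_pCons algebra_simps deg_le_iff split: nat.split)

lemma bounded_on_disc_1: "bounded_on_disc r e 0 1"
  by (auto simp: bounded_on_disc_def pcompose_1 coeff_1)

lemma bounded_on_disc_prod: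
  assumes "finite A" "\<And>i. i \<in> A \<Longrightarrow> bounded_on_disc r e (\<rho> i) (f i)"
  shows "bounded_on_disc r e (\<Sum>i\<in>A. \<rho> i) (\<Prod>i\<in>A. f i)"
  using assms by (induction A rule: finite_induct) (auto intro: bounded_on_disc_mult bounded_on_disc_1)

text \<open>
  The Gauss norm is multiplicative, and c is the norm of v - s on the disc around r.  For r = s the
  division by v - s shifts the coefficients; otherwise the quotient is found by solving for its
  coefficients from below, where e \<le> c prevents any growth.
\<close>

lemma bounded_on_disc_cancel_linear:
  assumes b: "bounded_on_disc r e \<rho> (A * [:- s, 1:])"
    and c: "if r = s then c = e else c = - fls_subdegree (r - s) \<and> e \<le> c"
  shows "bounded_on_disc r e (\<rho> - c) A"
proof -
  define P where "P = pcompose (A * [:- s, 1:]) [:r, 1:]"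
  define Q where "Q = pcompose A [:r, 1:]"
  have PQ: "P = Q * [:r - s, 1:]"
    unfolding P_def Q_def pcompose_mult by (simp add: pcompose_pCons)
  have bP: "deg_le (coeff P k) (\<rho> - e * int k)" for k
    using b by (simp add: bounded_on_disc_def P_def)
  have "deg_le (coeff Q k) (\<rho> - c - e * int k)" for k
  proof (cases "r = s")
    case True
    then have "coeff P (Suc k) = coeff Q k" by (simp add: PQ)
    then show ?thesis using bP[of "Suc k"] c True by (simp add: algebra_simps)
  next
    case False
    then have ec: "e \<le> c" "c = - fls_subdegree (r - s)" using c by auto
    have *: "deg_le (f / (r - s)) (\<sigma> - c)" if "deg_le f \<sigma>" for f \<sigma>
      using deg_le_divide[OF that, of "r - s"] False ec by simp
    show ?thesis
    proof (induction k)
      case 0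
      have "coeff P 0 = coeff Q 0 * (r - s)" by (simp add: PQ)
      then have "coeff Q 0 = coeff P 0 / (r - s)" using False by simp
      then show ?case using *[OF bP[of 0]] by simp
    next
      case (Suc k)
      have "coeff P (Suc k) = coeff Q (Suc k) * (r - s) + coeff Q k" by (simp add: PQ algebra_simps)
      then have "coeff Q (Suc k) = (coeff P (Suc k) - coeff Q k) / (r - s)" using False by simp
      moreover have "deg_le (coeff P (Suc k) - coeff Q k) (\<rho> - e * int (Suc k))"
        by (rule deg_le_diff[OF bP deg_le_mono[OF Suc]]) (use ec in \<open>simp add: algebra_simps\<close>)
      ultimately show ?case using *[of _ "\<rho> - e * int (Suc k)"] by (simp add: algebra_simps)
    qed
  qed
  then show ?thesis by (simp add: bounded_on_disc_def Q_def)
qed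

lemma bounded_on_disc_cancel_prod:
  assumes "finite J" "bounded_on_disc r e \<rho> (A * (\<Prod>j\<in>J. [:- s j, 1:]))"
    and "\<And>j. j \<in> J \<Longrightarrow> if r = s j then c j = e else c j = - fls_subdegree (r - s j) \<and> e \<le> c j"
  shows "bounded_on_disc r e (\<rho> - (\<Sum>j\<in>J. c j)) A"
  using assms
proof (induction J arbitrary: \<rho> rule: finite_induct)
  case (insert j J)
  have "bounded_on_disc r e (\<rho> - c j) (A * (\<Prod>j\<in>J. [:- s j, 1:]))"
  proof (rule bounded_on_disc_cancel_linear)
    show "bounded_on_disc r e \<rho> (A * (\<Prod>j\<in>J. [:- s j, 1:]) * [:- s j, 1:])"
      using insert.prems(1) unfolding prod.insert[OF insert.hyps] by (simp only: mult_ac)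
  qed (use insert.prems(2)[of j] in simp)
  then have "bounded_on_disc r e ((\<rho> - c j) - (\<Sum>j\<in>J. c j)) A"
    using insert.prems insert.IH by blast
  then show ?case using insert.hyps by (simp add: algebra_simps)
qed simp

lemma prod_linear_dvd:
  fixes p :: "'a::idom poly"
  assumes "finite A" "\<And>x. x \<in> A \<Longrightarrow> poly p (f x) = 0" "inj_on f A"
  shows "(\<Prod>x\<in>A. [:- f x, 1:]) dvd p"
  using assms
proof (induction A rule: finite_induct)
  case (insert a A)
  then obtain q where q: "p = (\<Prod>x\<in>A. [:- f x, 1:]) * q" by auto
  have "poly p (f a) = 0" using insert by simp
  then have "(\<Prod>x\<in>A. f a - f x) * poly q (f a) = 0" unfolding q by (simp add: poly_prod)
  moreover have "(\<Prod>x\<in>A. f a - f x) \<noteq> 0" using insert by (auto simp: prod_zero_iff)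
  ultimately have "[:- f a, 1:] dvd q" by (simp add: poly_eq_0_iff_dvd)
  then have "(\<Prod>x\<in>A. [:- f x, 1:]) * [:- f a, 1:] dvd p"
    unfolding q by (intro mult_dvd_mono dvd_refl)
  then show ?case unfolding prod.insert[OF insert.hyps] by (simp only: mult.commute)
qed simp

text \<open>
  Finitely many discs of the same radius e whose centres have distances \<delta> of at least e, such that the
  distances from one centre to all the others have a sum F that does not depend on the chosen centre.  This happens for the conjugates of
  a series and makes Lagrange interpolation at the centres contractive for the Gauss norms.
\<close>

locale equidistributed_discs =
  fixes r :: "nat \<Rightarrow> 'a::field_char_0 fls" and N :: nat and e :: int
    and \<delta> :: "nat \<Rightarrow> nat \<Rightarrow> int" and F :: int
  assumes N: "0 < N"
    and dist: "\<And>i j. i < N \<Longrightarrow> j < N \<Longrightarrow> i \<noteq> j \<Longrightarrow> r i \<noteq> r j \<and> \<delta> i j = - fls_subdegree (r i - r j) \<and> e \<le> \<delta> i j"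
    and diag: "\<And>i. \<delta> i i = e"
    and F: "\<And>i. i < N \<Longrightarrow> (\<Sum>j\<in>{..<N} - {i}. \<delta> i j) = F"
begin

lemma inj: "inj_on r {..<N}"
  using dist by (auto simp: inj_on_def)

lemma total: "i < N \<Longrightarrow> (\<Sum>j<N. \<delta> i j) = e + F"
  using F[of i] diag[of i] by (simp add: sum.remove[of _ i])

definition M where "M = (\<Prod>i<N. [:- r i, 1:])"
definition bounded where "bounded \<rho> = {P. \<forall>i<N. bounded_on_disc (r i) e \<rho> P}"

lemma monic_M: "monic_of N M"
  unfolding M_def by (rule monic_prod_linear)

lemma bounded_linear:
  assumes "i < N" "j < N"
  shows "bounded_on_disc (r i) e (\<delta> i j) [:- r j, 1:]"
proof (rule bounded_on_disc_linear)
  show "deg_le (r i - r j) (\<delta> i j)" "e \<le> \<delta> i j"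
    using assms dist[of i j] diag[of i] by (cases "i = j"; auto simp: deg_le_iff)+
qed

lemma M_bounded: "M \<in> bounded (e + F)"
  unfolding bounded_def M_def mem_Collect_eq
proof (intro allI impI)
  fix i assume i: "i < N"
  show "bounded_on_disc (r i) e (e + F) (\<Prod>i<N. [:- r i, 1:])"
    unfolding total[OF i, symmetric] by (rule bounded_on_disc_prod) (use i bounded_linear in auto)
qed

text \<open>
  The remainder is the Lagrange interpolation polynomial of P at the centres.  Its term at r_i, on the
  disc around r_c, has degree at most \<rho> - F + (e + F - \<delta> c i), which is at most \<rho> since e \<le> \<delta> c i.
  The quotient is then bounded because Gauss norms are multiplicative.
\<close>

lemma division_by_M:
  assumes P: "P \<in> bounded \<rho>"
  shows "\<exists>A R. P = M * A + R \<and> deg_less R N \<and> A \<in> bounded (\<rho> - (e + F))"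
proof -
  define L where "L i = (\<Prod>j\<in>{..<N} - {i}. [:- r j, 1:])" for i
  define w where "w i = poly P (r i) / (\<Prod>j\<in>{..<N} - {i}. r i - r j)" for i
  define R where "R = (\<Sum>i<N. Polynomial.smult (w i) (L i))"
  have nz: "(\<Prod>j\<in>{..<N} - {i}. r i - r j) \<noteq> 0" if "i < N" for i
    using dist[of i] that by (auto simp: prod_zero_iff)
  have PR: "poly (P - R) (r i) = 0" if i: "i < N" for i
  proof -
    have "poly (Polynomial.smult (w j) (L j)) (r i) = (if j = i then poly P (r i) else 0)" if "j < N" for j
      using nz[OF i] i that by (auto simp: L_def w_def poly_prod prod_zero_iff)
    then have "poly R (r i) = (\<Sum>j<N. if j = i then poly P (r i) else 0)"
      unfolding R_def poly_sum by (intro sum.cong) auto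
    then show ?thesis using i by simp
  qed
  then have "M dvd P - R"
    unfolding M_def by (intro prod_linear_dvd inj) auto
  then obtain A where A: "P - R = M * A" by auto
  have degR: "deg_less R N"
  proof -
    have "deg_less (L i) N" if "i < N" for i
    proof -
      have "degree (L i) \<le> (\<Sum>j\<in>{..<N} - {i}. degree [:- r j, 1:])"
        using degree_prod_sum_le[of "{..<N} - {i}" "\<lambda>j. [:- r j, 1:]"] unfolding L_def by simp
      also have "\<dots> = N - 1" using that by simp
      finally have "degree (L i) < N" using N by linarith
      then show ?thesis by (simp add: deg_less_iff)
    qed
    then show ?thesis unfolding R_def by (intro deg_less_sum deg_less_smult) simp
  qed
  have bR: "bounded_on_disc (r c) e \<rho> R" if c: "c < N" for c
    unfolding R_def
  proof (rule bounded_on_disc_sum)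
    fix i assume "i \<in> {..<N}"
    then have i: "i < N" by simp
    have "coeff (pcompose P [:r i, 1:]) 0 = poly P (r i)"
      by (simp add: poly_pcompose flip: poly_0_coeff_0)
    moreover have "bounded_on_disc (r i) e \<rho> P" using P i by (simp add: bounded_def)
    ultimately have "deg_le (poly P (r i)) \<rho>"
      unfolding bounded_on_disc_def by (metis diff_zero mult_zero_right of_nat_0)
    moreover have "fls_subdegree (\<Prod>j\<in>{..<N} - {i}. r i - r j) = - F"
    proof -
      have "fls_subdegree (\<Prod>j\<in>{..<N} - {i}. r i - r j) = (\<Sum>j\<in>{..<N} - {i}. fls_subdegree (r i - r j))"
        by (rule fls_subdegree_prod) (use dist[of i] i in auto)
      also have "\<dots> = (\<Sum>j\<in>{..<N} - {i}. - \<delta> i j)" using dist[of i] i by (intro sum.cong) auto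
      finally show ?thesis using F[OF i] by (simp add: sum_negf)
    qed
    ultimately have w: "deg_le (w i) (\<rho> - F)"
      unfolding w_def using deg_le_divide[OF _ nz[OF i]] by fastforce
    have "bounded_on_disc (r c) e (\<Sum>j\<in>{..<N} - {i}. \<delta> c j) (L i)"
      unfolding L_def by (rule bounded_on_disc_prod) (use c bounded_linear in auto)
    moreover have "(\<Sum>j\<in>{..<N} - {i}. \<delta> c j) = e + F - \<delta> c i"
      using total[OF c] i by (simp add: sum.remove[of _ i])
    ultimately have "bounded_on_disc (r c) e ((\<rho> - F) + (e + F - \<delta> c i)) (Polynomial.smult (w i) (L i))"
      by (intro bounded_on_disc_smult w) simp
    then show "bounded_on_disc (r c) e \<rho> (Polynomial.smult (w i) (L i))"
      by (rule bounded_on_disc_mono) (use dist[of c i] diag[of c] c i in \<open>cases "c = i"; auto\<close>)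
  qed
  have "A \<in> bounded (\<rho> - (e + F))"
    unfolding bounded_def mem_Collect_eq
  proof (intro allI impI)
    fix c assume c: "c < N"
    have "bounded_on_disc (r c) e \<rho> (P - R)"
      using P c bR by (auto simp: bounded_def intro: bounded_on_disc_diff)
    then have b: "bounded_on_disc (r c) e \<rho> (A * (\<Prod>i<N. [:- r i, 1:]))"
      unfolding A M_def by (simp add: mult.commute)
    show "bounded_on_disc (r c) e (\<rho> - (e + F)) A"
      unfolding total[OF c, symmetric]
    proof (rule bounded_on_disc_cancel_prod[OF _ b])
      fix j assume "j \<in> {..<N}"
      then show "if r c = r j then \<delta> c j = e else \<delta> c j = - fls_subdegree (r c - r j) \<and> e \<le> \<delta> c j"
        using dist[of c j] diag[of c] c by (cases "c = j") auto
    qed simp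
  qed
  moreover have "P = M * A + R" using A by (simp add: algebra_simps)
  ultimately show ?thesis using degR by blast
qed

lemma division_by_M_power:
  assumes "P \<in> bounded \<rho>"
  shows "\<exists>A R. P = M ^ k * A + R \<and> deg_less R (k * N) \<and> A \<in> bounded (\<rho> - int k * (e + F))"
proof (induction k)
  case 0 show ?case using assms by (intro exI[of _ P] exI[of _ 0]) simp
next
  case (Suc k)
  then obtain A R where A: "P = M ^ k * A + R" "deg_less R (k * N)" "A \<in> bounded (\<rho> - int k * (e + F))"
    by blast
  obtain A' R' where A': "A = M * A' + R'" "deg_less R' N" "A' \<in> bounded (\<rho> - int k * (e + F) - (e + F))"
    using division_by_M[OF A(3)] by blast
  have "P = M ^ Suc k * A' + (M ^ k * R' + R)" by (simp add: A A' algebra_simps)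
  moreover have "deg_less (M ^ k * R' + R) (Suc k * N)"
  proof (rule deg_less_add)
    have "deg_less (R' * M ^ k) (N + k * N)"
      by (rule deg_less_mult[OF A'(2) monic_of_deg_less[OF monic_of_power[OF monic_M]]])
    then show "deg_less (M ^ k * R') (Suc k * N)" by (simp add: mult.commute)
    show "deg_less R (Suc k * N)" by (rule deg_less_mono[OF A(2)]) simp
  qed
  moreover have "\<rho> - int k * (e + F) - (e + F) = \<rho> - int (Suc k) * (e + F)" by (simp add: algebra_simps)
  ultimately show ?case using A'(3) by metis
qed

lemma approximate_root_bounded:
  assumes H: "monic_of (Suc (Suc d) * N) H" "H \<in> bounded (int (Suc (Suc d)) * (e + F))"
  shows "\<exists>K \<in> bounded (e + F). monic_of N K \<and> deg_less (H - K ^ Suc (Suc d)) (Suc d * N)"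
proof (rule approximate_root_exists[where q = "fls_const (inverse (of_nat (Suc (Suc d))))"])
  show "fls_const (inverse (of_nat (Suc (Suc d)))) * of_nat (Suc (Suc d)) = (1 :: 'a fls)"
    by (simp add: fls_of_nat del: of_nat_Suc)
  show "\<exists>A R. P = M ^ Suc d * A + R \<and> deg_less R (Suc d * N) \<and> A \<in> bounded (e + F)"
    if "P \<in> bounded (int (Suc (Suc d)) * (e + F))" for P
    using division_by_M_power[OF that, of "Suc d"] by (simp add: algebra_simps)
  show "Polynomial.smult (fls_const (inverse (of_nat (Suc (Suc d))))) P \<in> bounded \<rho>" if "P \<in> bounded \<rho>" for P \<rho>
    using that bounded_on_disc_smult[of "fls_const (inverse (of_nat (Suc (Suc d)))) :: 'a fls" 0]
    by (auto simp: bounded_def deg_le_iff)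
  show "P * Q \<in> bounded (\<rho> + \<sigma>)" if "P \<in> bounded \<rho>" "Q \<in> bounded \<sigma>" for P Q \<rho> \<sigma>
    using that unfolding bounded_def by (blast intro: bounded_on_disc_mult)
  show "P + Q \<in> bounded \<rho>" "P - Q \<in> bounded \<rho>" if "P \<in> bounded \<rho>" "Q \<in> bounded \<rho>" for P Q \<rho>
    using that unfolding bounded_def by (blast intro: bounded_on_disc_add bounded_on_disc_diff)+
qed (rule N monic_M M_bounded H)+

end

section \<open>Ultrametrics on a cyclic group\<close>

text \<open>
  D(j) stands for the distance between 0 and j in a translation invariant ultrametric on Z/n.  Its
  values at the multiples of n have no meaning, because the distance there is the degree of the zero
  series.
\<close>

locale cyclic_ultrametric =
  fixes D :: "nat \<Rightarrow> int" and n :: nat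
  assumes n: "0 < n"
    and period: "D (j + n) = D j"
    and opposite: "\<not> n dvd i \<Longrightarrow> n dvd i + j \<Longrightarrow> D i = D j"
    and ultra: "\<not> n dvd i \<Longrightarrow> \<not> n dvd j \<Longrightarrow> \<not> n dvd i + j \<Longrightarrow> D (i + j) \<le> max (D i) (D j)"
begin

definition spread :: "nat \<Rightarrow> int" where "spread N = (\<Sum>i\<in>{0<..<N}. D i)"

text \<open>
  The multiples of N form a ball, and e is the largest distance that occurs inside it.
\<close>

definition level :: "nat \<Rightarrow> int \<Rightarrow> bool" where
  "level N e \<longleftrightarrow> 0 < N \<and> N < n \<and> N dvd n \<and> (\<exists>j. \<not> n dvd j \<and> N dvd j \<and> D j = e) \<and>
     (\<forall>j. \<not> n dvd j \<longrightarrow> N dvd j \<longrightarrow> D j \<le> e) \<and> (\<forall>j. \<not> N dvd j \<longrightarrow> e < D j)"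

lemma period_mult: "D (j + n * k) = D j"
proof (induction k)
  case (Suc k)
  have "D (j + n * Suc k) = D ((j + n * k) + n)" by (simp add: algebra_simps)
  then show ?case using Suc period by simp
qed simp

lemma period_mod: "D (j mod n) = D j"
  using period_mult[of "j mod n" "j div n"] by (simp add: mod_mult_div_eq)

lemma ultra_eq:
  assumes "\<not> n dvd i" "\<not> n dvd i + j" "n dvd j \<or> D j < D i"
  shows "D (i + j) = D i"
proof (cases "n dvd j")
  case True
  then show ?thesis using period_mult by (auto elim!: dvdE)
next
  case False
  then have lt: "D j < D i" using assms by simp
  have le: "D (i + j) \<le> D i" using ultra[OF assms(1) False assms(2)] lt by simp
  define j' where "j' = j * (n - 1)"
  have jj: "j + j' = n * j" using n by (cases n) (auto simp: j'_def)
  have njj: "n dvd j + j'" by (simp add: jj)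
  have "\<not> n dvd j'" using False njj by (metis dvd_add_left_iff)
  moreover have "D j' = D j" using opposite[OF False njj] by simp
  ultimately have j': "\<not> n dvd j'" "D j' = D j" by auto
  have e: "(i + j) + j' = i + n * j" using jj by simp
  then have "\<not> n dvd (i + j) + j'" using assms(1) by (metis dvd_add_left_iff dvd_triv_left)
  from ultra[OF assms(2) j'(1) this] have "D i \<le> max (D (i + j)) (D j)"
    unfolding e using period_mult j' by simp
  then show ?thesis using le lt by simp
qed

lemma level_const:
  assumes "level N e" "\<not> N dvd i"
  shows "D (i + N * l) = D i"
proof (rule ultra_eq)
  have N: "N dvd n" using assms by (simp add: level_def)
  show "\<not> n dvd i" using assms(2) N dvd_trans by blast
  show "\<not> n dvd i + N * l" using assms(2) N by (metis dvd_add_left_iff dvd_trans dvd_triv_left)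
  show "n dvd N * l \<or> D (N * l) < D i"
    using assms unfolding level_def by (metis dvd_triv_left order_le_less_trans)
qed

text \<open>
  The points at distance less than e from 0 form a subgroup, by the ultrametric inequality, and N' is its
  generator.
\<close>

lemma next_level:
  assumes lev: "level N e"
  obtains N' where "N dvd N'" "N < N'" "N' dvd n" "\<And>j. \<not> n dvd j \<Longrightarrow> N' dvd j \<Longrightarrow> D j < e"
    "\<And>j. \<not> N' dvd j \<Longrightarrow> e \<le> D j"
proof -
  define S where "S = {j. n dvd j \<or> D j < e}"
  have nS: "n \<in> S" by (simp add: S_def)
  have perS: "j + n * k \<in> S \<longleftrightarrow> j \<in> S" for j k
    by (simp add: S_def period_mult dvd_add_left_iff)
  have addS: "i + j \<in> S" if "i \<in> S" "j \<in> S" for i j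
  proof (cases "n dvd i \<or> n dvd j \<or> n dvd i + j")
    case True
    then show ?thesis
    proof (elim disjE)
      assume "n dvd i" then obtain k where "i = n * k" by blast
      then show ?thesis using that perS[of j k] by (simp add: add.commute)
    next
      assume "n dvd j" then obtain k where "j = n * k" by blast
      then show ?thesis using that perS[of i k] by simp
    qed (simp add: S_def)
  next
    case False
    then show ?thesis using ultra[of i j] that by (auto simp: S_def)
  qed
  have multS: "i * k \<in> S" if "i \<in> S" for i k
    by (induction k) (use that addS in \<open>auto simp: S_def\<close>)
  have diffS: "i \<in> S" if "i + j \<in> S" "j \<in> S" for i j
  proof -
    have "(i + j) + j * (n - 1) \<in> S" by (intro addS multS that)
    moreover have "(i + j) + j * (n - 1) = i + n * j"
      using n by (cases n) (auto simp: algebra_simps)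
    ultimately have "i + n * j \<in> S" by metis
    then show ?thesis using perS by blast
  qed
  define N' where "N' = (LEAST j. 0 < j \<and> j \<in> S)"
  have N': "0 < N'" "N' \<in> S" and least: "\<And>j. 0 < j \<Longrightarrow> j \<in> S \<Longrightarrow> N' \<le> j"
    unfolding N'_def using LeastI[of "\<lambda>j. 0 < j \<and> j \<in> S" n] n nS by (auto intro: Least_le)
  have S: "j \<in> S \<longleftrightarrow> N' dvd j" for j
  proof
    assume "j \<in> S"
    then have "j mod N' + N' * (j div N') \<in> S" by (simp add: mod_mult_div_eq)
    then have "j mod N' \<in> S" using diffS multS N' by blast
    then have "j mod N' = 0" using least[of "j mod N'"] N'(1) by (meson gr0I mod_less_divisor not_le)
    then show "N' dvd j" by blast
  qed (use multS N' in auto)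
  have SN: "N dvd j" if "j \<in> S" for j
    using that lev dvd_trans unfolding level_def S_def by force
  obtain j0 where j0: "\<not> n dvd j0" "N dvd j0" "D j0 = e" using lev by (auto simp: level_def)
  then have "j0 \<notin> S" by (simp add: S_def)
  then have "N \<noteq> N'" using j0 S by blast
  moreover have "N dvd N'" using SN N' by blast
  ultimately have "N < N'" using N'(1) by (meson dvd_imp_le le_neq_implies_less)
  moreover have "N' dvd n" using S nS by blast
  moreover have "D j < e" if "\<not> n dvd j" "N' dvd j" for j using that S[of j] by (simp add: S_def)
  moreover have "e \<le> D j" if "\<not> N' dvd j" for j using that S[of j] by (auto simp: S_def)
  ultimately show ?thesis using that \<open>N dvd N'\<close> by blast
qed

text \<open>
  Off the subgroup generated by N the distance is constant on cosets, so each of the q blocks of length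
  N contributes spread N; the multiples of N that are not multiples of N' contribute e each.
\<close>

lemma spread_next_level:
  assumes lev: "level N e" and N': "N' = q * N" "0 < q" "N' dvd n"
    and D: "\<And>j. \<not> N' dvd j \<Longrightarrow> e \<le> D j"
  shows "spread N' = int q * spread N + (int q - 1) * e"
proof -
  have N: "0 < N" "N dvd n" using lev by (auto simp: level_def)
  define g where "g i = (if i = 0 then 0 else D i)" for i
  have sp: "spread k = (\<Sum>i<k. g i)" for k
  proof -
    have "(\<Sum>i<k. g i) = (\<Sum>i\<in>{0<..<k}. g i)"
      by (rule sum.mono_neutral_right) (auto simp: g_def)
    then show ?thesis by (simp add: spread_def g_def)
  qed
  have block: "sum g {l * N..<l * N + N} = (if l = 0 then 0 else e) + spread N" if l: "l < q" for l
  proof -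
    have g0: "g (l * N) = (if l = 0 then 0 else e)"
    proof (cases "l = 0")
      case False
      have "l * N < N'" "0 < l * N" using l N False by (auto simp: N'(1))
      then have nd: "\<not> N' dvd l * N" by (meson nat_dvd_not_less)
      then have "\<not> n dvd l * N" using N'(3) dvd_trans by blast
      then have "D (l * N) \<le> e" using lev by (auto simp: level_def)
      then show ?thesis using D[OF nd] False N by (simp add: g_def)
    qed (simp add: g_def)
    have gi: "g (l * N + i) = D i" if i: "i \<in> {0<..<N}" for i
    proof -
      have "\<not> N dvd i" using i by (auto dest: nat_dvd_not_less)
      from level_const[OF lev this, of l] show ?thesis using i by (simp add: g_def algebra_simps)
    qed
    have "sum g {l * N..<l * N + N} = (\<Sum>i<N. g (l * N + i))"
      using sum.shift_bounds_nat_ivl[of g 0 "l * N" N] by (simp add: atLeast0LessThan add.commute)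
    also have "\<dots> = g (l * N) + (\<Sum>i\<in>{..<N} - {0}. g (l * N + i))"
      using N by (subst sum.remove[of _ 0]) auto
    also have "{..<N} - {0} = {0<..<N}" by auto
    also have "(\<Sum>i\<in>{0<..<N}. g (l * N + i)) = spread N"
      unfolding spread_def using gi by (intro sum.cong) auto
    finally show ?thesis using g0 by simp
  qed
  have "spread N' = (\<Sum>l<q. sum g {l * N..<l * N + N})"
    unfolding sp N'(1) by (rule sum.nat_group[symmetric])
  also have "\<dots> = (\<Sum>l<q. (if l = 0 then 0 else e) + spread N)"
    using block by (intro sum.cong) auto
  also have "\<dots> = (\<Sum>l<q. if l = 0 then 0 else e) + int q * spread N"
    by (simp add: sum.distrib)
  also have "(\<Sum>l<q. if l = 0 then 0 else e) = (\<Sum>l\<in>{..<q} - {0}. e)"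
    by (rule sum.mono_neutral_cong_right) auto
  also have "\<dots> = (int q - 1) * e" using N'(2) by (simp add: of_nat_diff)
  finally show ?thesis by (simp add: add.commute)
qed

lemma exists_level:
  assumes "0 < N" "N < n" "N dvd n"
    and "\<And>j k. \<not> n dvd j \<Longrightarrow> N dvd j \<Longrightarrow> \<not> N dvd k \<Longrightarrow> D j < D k"
  shows "\<exists>e. level N e"
proof -
  define J where "J = D ` {j. j < n \<and> \<not> n dvd j \<and> N dvd j}"
  have "finite J" by (simp add: J_def)
  moreover have "D N \<in> J" unfolding J_def using assms by (auto dest: nat_dvd_not_less)
  ultimately have M: "Max J \<in> J" "\<And>x. x \<in> J \<Longrightarrow> x \<le> Max J" by (auto intro: Max_in)
  obtain j0 where j0: "\<not> n dvd j0" "N dvd j0" "D j0 = Max J" using M(1) by (auto simp: J_def)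
  have "D j \<le> Max J" if "\<not> n dvd j" "N dvd j" for j
  proof -
    have "j mod n < n" using n by simp
    moreover have "\<not> n dvd j mod n" using that(1) by (meson dvd_mod_imp_dvd dvd_refl)
    moreover have "N dvd j mod n" using that(2) assms(3) by (rule dvd_mod)
    ultimately have "D (j mod n) \<in> J" unfolding J_def by blast
    then show ?thesis using M(2) period_mod by simp
  qed
  then show ?thesis unfolding level_def using assms j0 by metis
qed

text \<open>
  By the previous recursion spread N' - spread N = (q - 1) (e + spread N), so the assumption on the
  levels makes the spread grow from each level to the next.
\<close>

lemma spread_mono_level:
  assumes nonneg: "\<And>N e. level N e \<Longrightarrow> 0 \<le> e + spread N"
  shows "level N e \<Longrightarrow> spread N \<le> spread n"
proof (induction "n - N" arbitrary: N e rule: less_induct)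
  case less
  obtain N' where N': "N dvd N'" "N < N'" "N' dvd n" "\<And>j. \<not> n dvd j \<Longrightarrow> N' dvd j \<Longrightarrow> D j < e"
    "\<And>j. \<not> N' dvd j \<Longrightarrow> e \<le> D j" using next_level[OF less.prems] by metis
  from N'(1) obtain q where q: "N' = q * N" by (metis dvd_def mult.commute)
  have "0 < q" using N'(2) q by (cases q) auto
  have "spread N' = int q * spread N + (int q - 1) * e"
    by (rule spread_next_level[OF less.prems q \<open>0 < q\<close> N'(3)]) (rule N'(5))
  also have "\<dots> = spread N + (int q - 1) * (e + spread N)" by (simp add: algebra_simps)
  finally have *: "spread N \<le> spread N'" using nonneg[OF less.prems] \<open>0 < q\<close> by simp
  show ?case
  proof (cases "N' = n")
    case False
    have "N' < n" using False N'(3) n by (meson dvd_imp_le le_neq_implies_less)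
    moreover have "0 < N'" using N'(2) by simp
    ultimately obtain e' where "level N' e'"
      using exists_level[of N'] N'(3,4,5) by (meson order_less_le_trans)
    moreover have "n - N' < n - N" using \<open>N' < n\<close> \<open>N < N'\<close> by linarith
    ultimately show ?thesis using less.hyps * by fastforce
  qed (use * in simp)
qed

text \<open>
  The first level, N = 1, already raises the spread from 0 to (N' - 1) D(1) with N' > 1; later levels
  do not decrease it.
\<close>

lemma spread_ge:
  assumes nonneg: "\<And>N e. level N e \<Longrightarrow> 0 \<le> e + spread N"
    and n1: "1 < n" and top: "\<And>j. \<not> n dvd j \<Longrightarrow> D j \<le> D 1"
  shows "D 1 \<le> spread n"
proof -
  have nd: "\<not> n dvd 1" using n1 by simp
  have "\<exists>j. \<not> n dvd j \<and> 1 dvd j \<and> D j = D 1" using nd by (intro exI[of _ 1]) auto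
  then have lev: "level 1 (D 1)" unfolding level_def using n1 top by auto
  have "{0<..<Suc 0} = {}" by auto
  then have D1: "0 \<le> D 1" using nonneg[OF lev] by (simp add: spread_def)
  obtain N' where N': "1 dvd N'" "1 < N'" "N' dvd n" "\<And>j. \<not> n dvd j \<Longrightarrow> N' dvd j \<Longrightarrow> D j < D 1"
    "\<And>j. \<not> N' dvd j \<Longrightarrow> D 1 \<le> D j" using next_level[OF lev] by metis
  have "spread N' = int N' * spread 1 + (int N' - 1) * D 1"
    by (rule spread_next_level[OF lev]) (use N' in auto)
  moreover have "spread 1 = 0" using \<open>{0<..<Suc 0} = {}\<close> by (simp add: spread_def)
  moreover have "1 * D 1 \<le> (int N' - 1) * D 1" using D1 N'(2) by (intro mult_right_mono) auto
  ultimately have *: "D 1 \<le> spread N'" by simp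
  show ?thesis
  proof (cases "N' = n")
    case False
    have "N' < n" using False N'(3) n by (meson dvd_imp_le le_neq_implies_less)
    moreover have "0 < N'" using N'(2) by simp
    ultimately obtain e' where "level N' e'"
      using exists_level[of N'] N'(3,4,5) by (meson order_less_le_trans)
    from spread_mono_level[OF nonneg this] * show ?thesis by simp
  qed (use * in simp)
qed

end

section \<open>Plane polynomial curves at infinity\<close>

lemma poly_fls_const_compose:
  fixes Z :: "'a::field fps"
  assumes "fps_nth Z 0 = 0"
  shows "poly (map_poly fls_const q) (fps_to_fls Z) = fps_to_fls (fps_compose (fps_of_poly q) Z)"
proof (induction q)
  case (pCons a q)
  have "poly (map_poly fls_const (pCons a q)) (fps_to_fls Z) = fls_const a + fps_to_fls Z * poly (map_poly fls_const q) (fps_to_fls Z)"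
    by (cases "a = 0 \<and> q = 0") (auto simp: map_poly_pCons)
  also have "\<dots> = fps_to_fls (fps_const a + Z * fps_compose (fps_of_poly q) Z)"
    by (simp add: pCons.IH fls_times_fps_to_fls)
  also have "fps_const a + Z * fps_compose (fps_of_poly q) Z = fps_compose (fps_of_poly (pCons a q)) Z"
    using assms by (simp add: fps_of_poly_pCons fps_compose_add_distrib fps_compose_mult_distrib mult.commute)
  finally show ?case .
qed simp

text \<open>
  Y is the variable of C[Y] as a Laurent series in X = 1/T, where T is an n-th root of \<phi>(Y).  In terms
  of Z = 1/Y the equation reads Z^n = X^n \<rho>(Z) with \<rho>(0) \<noteq> 0; it is solved by taking an n-th root a of
  \<rho> and inverting the power series Z / a(Z).
\<close>

lemma exists_parameter_at_infinity:
  fixes \<phi> :: "complex poly"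
  assumes "0 < degree \<phi>"
  shows "\<exists>Y. fls_subdegree Y = -1 \<and> poly (map_poly fls_const \<phi>) Y = inverse fls_X ^ degree \<phi>"
proof -
  define n where "n = degree \<phi>"
  obtain k where k: "n = Suc k" using assms by (cases n) (auto simp: n_def)
  define \<rho> where "\<rho> = fps_of_poly (reflect_poly \<phi>)"
  have \<rho>0: "fps_nth \<rho> 0 \<noteq> 0" using assms by (auto simp: \<rho>_def)
  obtain w :: complex where w: "w ^ Suc k = fps_nth \<rho> 0"
    using exists_complex_root[of "Suc k" "fps_nth \<rho> 0"] by (metis nat.distinct(1))
  define a where "a = fps_radical (\<lambda>_ _. w) (Suc k) \<rho>"
  have a: "a ^ Suc k = \<rho>" unfolding a_def using power_radical[of \<rho> "\<lambda>_ _. w" k] w \<rho>0 by simp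
  have a0: "fps_nth a 0 = w" "w \<noteq> 0" using w \<rho>0 by (auto simp: a_def)
  define u where "u = fps_X * inverse a"
  define Z where "Z = fps_inv u"
  have u: "fps_nth u 0 = 0" "fps_nth u 1 \<noteq> 0" using a0 by (simp_all add: u_def)
  have Z0: "fps_nth Z 0 = 0" by (simp add: Z_def fps_inv_def)
  have "fps_compose u Z = fps_X" unfolding Z_def by (rule fps_inv_right) (use u in auto)
  moreover have "fps_compose u Z = Z * inverse (fps_compose a Z)"
    unfolding u_def using Z0 a0 by (simp add: fps_compose_mult_distrib fps_inverse_compose)
  ultimately have "Z * inverse (fps_compose a Z) = fps_X" by simp
  moreover have aZ: "fps_nth (fps_compose a Z) 0 = w" using a0 by simp
  ultimately have Z: "Z = fps_X * fps_compose a Z"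
    using a0(2) by (metis (no_types, lifting) inverse_mult_eq_1 mult.assoc mult.right_neutral)
  have "Z ^ n = fps_X ^ n * fps_compose (a ^ n) Z"
    by (subst Z) (simp add: power_mult_distrib fps_compose_power Z0)
  then have Zn: "Z ^ n = fps_X ^ n * fps_compose \<rho> Z" using a k by simp
  have "subdegree Z = 1"
  proof (rule subdegreeI)
    show "fps_nth Z 1 \<noteq> 0" by (subst Z) (use a0 aZ in simp)
  qed (use Z0 in auto)
  then have sZ: "fls_subdegree (fps_to_fls Z) = 1" by (simp add: fls_subdegree_fls_to_fps)
  then have nz: "fps_to_fls Z \<noteq> 0" by auto
  define Y where "Y = inverse (fps_to_fls Z)"
  define p where "p = map_poly fls_const \<phi>"
  have dp: "degree p = n" unfolding p_def n_def by (rule degree_map_poly) simp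
  have "reflect_poly p = map_poly fls_const (reflect_poly \<phi>)"
    by (rule poly_eqI) (simp add: coeff_reflect_poly dp, simp add: p_def coeff_map_poly coeff_reflect_poly n_def)
  then have "fps_to_fls (fps_compose \<rho> Z) = fps_to_fls Z ^ n * poly p Y"
    using poly_reflect_poly_nz[OF nz, of p] poly_fls_const_compose[OF Z0, of "reflect_poly \<phi>"]
    by (simp add: dp Y_def \<rho>_def)
  moreover have "fps_to_fls Z ^ n = fls_X ^ n * fps_to_fls (fps_compose \<rho> Z)"
    using arg_cong[OF Zn, of fps_to_fls] by (simp add: fls_times_fps_to_fls fps_to_fls_power)
  ultimately have "fps_to_fls Z ^ n * (fls_X ^ n * poly p Y) = fps_to_fls Z ^ n * 1" by simp
  then have "fls_X ^ n * poly p Y = 1" using nz by (simp only: mult_cancel_left) simp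
  then have "poly p Y = inverse fls_X ^ n"
    by (metis inverse_unique power_inverse)
  moreover have "fls_subdegree Y = -1" by (simp add: Y_def sZ)
  ultimately show ?thesis unfolding n_def p_def by blast
qed

lemma comm_ring_hom_fls_const: "comm_ring_hom (fls_const :: complex \<Rightarrow> complex fls)"
  by unfold_locales (simp_all add: fls_plus_const)

lemma comm_ring_hom_const_poly1: "comm_ring_hom (\<lambda>c::complex. [:c:])"
  by unfold_locales (simp_all add: one_pCons)

lemma comm_ring_hom_poly_fls: "comm_ring_hom (\<lambda>p. poly (map_poly fls_const p) (z :: complex fls))"
proof -
  interpret h: comm_ring_hom "fls_const :: complex \<Rightarrow> complex fls" by (rule comm_ring_hom_fls_const)
  interpret hp: map_poly_comm_ring_hom "fls_const :: complex \<Rightarrow> complex fls" ..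
  show ?thesis by unfold_locales (auto simp: hp.hom_add hp.hom_mult)
qed

text \<open>
  The substitution X \<mapsto> c X.
\<close>

definition rotate_fls :: "complex \<Rightarrow> complex fls \<Rightarrow> complex fls" where
  "rotate_fls c f = fls_compose_fps f (fps_const c * fps_X)"

lemma rotate_fls_nth: "c \<noteq> 0 \<Longrightarrow> fls_nth (rotate_fls c f) k = fls_nth f k * c powi k"
  unfolding rotate_fls_def by (rule fls_nth_fls_compose_fps_linear)

lemma comm_ring_hom_rotate_fls: "c \<noteq> 0 \<Longrightarrow> comm_ring_hom (rotate_fls c)"
  unfolding rotate_fls_def
  by unfold_locales (simp_all add: fls_compose_fps_add fls_compose_fps_mult)

lemma rotate_fls_const [simp]: "rotate_fls c (fls_const a) = fls_const a"
  by (simp add: rotate_fls_def)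

lemma rotate_fls_rotate_fls: "c \<noteq> 0 \<Longrightarrow> d \<noteq> 0 \<Longrightarrow> rotate_fls c (rotate_fls d f) = rotate_fls (c * d) f"
  by (rule fls_eqI) (simp add: rotate_fls_nth power_int_mult_distrib)

lemma rotate_fls_1: "rotate_fls 1 f = f"
  by (rule fls_eqI) (simp add: rotate_fls_nth)

lemma fls_subdegree_rotate_fls: "c \<noteq> 0 \<Longrightarrow> fls_subdegree (rotate_fls c f) = fls_subdegree f"
  unfolding rotate_fls_def by simp

text \<open>
  The curve (\<phi>, \<psi>) is an embedded line: f recovers the parameter from the point.  This makes the n
  conjugates of \<psi> distinct.
\<close>

locale curve_at_infinity =
  fixes \<phi> \<psi> :: "complex poly" and f :: bipoly and Y :: "complex fls"
  assumes deg_pos: "0 < degree \<phi>"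
    and Y: "fls_subdegree Y = -1" "poly (map_poly fls_const \<phi>) Y = inverse fls_X ^ degree \<phi>"
    and generates: "subst2 (\<lambda>c. [:c:]) f (\<phi>, \<psi>) = [:0, 1:]"
begin

text \<open>
  \<open>emb\<close> expands a polynomial in Y at infinity, \<open>over P\<close> is P with u replaced by T^n, and \<open>curve P\<close> is the
  restriction of P to the curve.
\<close>

definition n where "n = degree \<phi>"
definition \<zeta> :: complex where "\<zeta> = exp (2 * of_real pi * \<i> / of_nat n)"
definition U :: "complex fls" where "U = inverse fls_X ^ n"
definition emb where "emb p = poly (map_poly fls_const p) Y"
definition conjugate where "conjugate j = rotate_fls (\<zeta> ^ j) (emb \<psi>)"
definition over where "over P = map_poly (\<lambda>c. poly (map_poly fls_const c) U) P"
definition curve where "curve P = subst2 (\<lambda>c. [:c:]) P (\<phi>, \<psi>)"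
definition D where "D j = - fls_subdegree (conjugate 0 - conjugate j)"

lemma n_pos: "0 < n" using deg_pos by (simp add: n_def)

lemma \<zeta>_power_eq_1: "\<zeta> ^ j = 1 \<longleftrightarrow> n dvd j"
proof -
  have "\<zeta> ^ j = exp (2 * of_real pi * \<i> * of_nat j / of_nat n)"
    unfolding \<zeta>_def exp_of_nat_mult[symmetric] by (simp add: field_simps)
  then show ?thesis using complex_root_unity_eq_1[of n j] n_pos by simp
qed

lemma \<zeta>_nz: "\<zeta> ^ j \<noteq> 0" by (simp add: \<zeta>_def)

sublocale emb: comm_ring_hom emb
  unfolding emb_def by (rule comm_ring_hom_poly_fls)

lemma emb_const: "emb [:c:] = fls_const c"
  by (cases "c = 0") (simp_all add: emb_def map_poly_pCons)

lemma emb_X: "emb [:0, 1:] = Y"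
  by (simp add: emb_def map_poly_pCons)

lemma emb_\<phi>: "emb \<phi> = U"
  by (simp add: emb_def U_def Y n_def)

lemma subdegree_emb: "p \<noteq> 0 \<Longrightarrow> emb p \<noteq> 0 \<and> fls_subdegree (emb p) = - int (degree p)"
proof (induction p)
  case (pCons a p)
  have Ynz: "Y \<noteq> 0" using Y(1) by auto
  have e: "emb (pCons a p) = fls_const a + Y * emb p"
    using pCons.hyps by (simp add: emb_def map_poly_pCons)
  show ?case
  proof (cases "p = 0")
    case True
    then show ?thesis using pCons.prems by (simp add: emb_const)
  next
    case False
    then have *: "emb p \<noteq> 0" "fls_subdegree (emb p) = - int (degree p)" using pCons.IH by auto
    have s: "fls_subdegree (Y * emb p) = - int (degree p) - 1" using * Ynz Y(1) by simp
    have "fls_nth (emb (pCons a p)) (- int (degree p) - 1) = fls_nth (Y * emb p) (- int (degree p) - 1)"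
      unfolding e by simp
    also have "\<dots> \<noteq> 0" using nth_fls_subdegree_nonzero[of "Y * emb p"] * Ynz s by simp
    finally have nz: "fls_nth (emb (pCons a p)) (- int (degree p) - 1) \<noteq> 0" .
    then have "fls_subdegree (emb (pCons a p)) = - int (degree p) - 1"
      by (rule fls_subdegree_eqI) (auto simp: e s)
    then show ?thesis using nz False by auto
  qed
qed simp

lemma emb_eq_0_iff: "emb p = 0 \<longleftrightarrow> p = 0"
  using subdegree_emb by auto

sublocale curve: comm_ring_hom curve
  unfolding curve_def by (rule comm_ring_hom_subst2[OF comm_ring_hom_const_poly1])

lemma over_hom: "comm_ring_hom (\<lambda>c. poly (map_poly fls_const c) U)"
  by (rule comm_ring_hom_poly_fls)

sublocale coef: comm_ring_hom "\<lambda>c. poly (map_poly fls_const c) U"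
  by (rule over_hom)

sublocale coefi: idom_hom "\<lambda>c. poly (map_poly fls_const c) U" ..

sublocale coefp: map_poly_comm_ring_hom "\<lambda>c. poly (map_poly fls_const c) U" ..

sublocale over: comm_ring_hom over
  unfolding over_def ..

lemma poly_over: "poly (over P) w = subst2 fls_const P (U, w)"
  by (simp add: over_def subst2_def)

lemma emb_curve: "emb (curve P) = poly (over P) (emb \<psi>)"
proof -
  have "emb (curve P) = subst2 (\<lambda>c. emb [:c:]) P (emb \<phi>, emb \<psi>)"
    unfolding curve_def by (rule hom_subst2[OF emb.comm_ring_hom_axioms comm_ring_hom_const_poly1])
  then show ?thesis by (simp add: emb_const emb_\<phi> poly_over)
qed

lemma rotate_U: "rotate_fls (\<zeta> ^ j) U = U"
proof -
  interpret r: comm_ring_hom "rotate_fls (\<zeta> ^ j)" by (rule comm_ring_hom_rotate_fls[OF \<zeta>_nz])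
  have "(inverse fls_X :: complex fls) ^ n = fls_X_inv ^ n" by (simp add: fls_inverse_X)
  then have "fls_nth U k = (if k = - int n then 1 else 0)" for k
    unfolding U_def by (simp add: fls_X_inv_power_conv_shift_1)
  moreover have "(\<zeta> ^ j) powi (- int n) = 1"
    using \<zeta>_power_eq_1[of "j * n"] by (simp add: power_int_minus power_mult)
  ultimately show ?thesis
    by (intro fls_eqI) (auto simp: rotate_fls_nth[OF \<zeta>_nz])
qed

lemma rotate_conjugate: "rotate_fls (\<zeta> ^ i) (conjugate j) = conjugate (i + j)"
  by (simp only: conjugate_def rotate_fls_rotate_fls[OF \<zeta>_nz \<zeta>_nz] power_add)

lemma conjugate_0: "conjugate 0 = emb \<psi>"
  by (simp add: conjugate_def rotate_fls_1)

text \<open>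
  The rotations fix T^n, so they permute the points of the curve over a given u.
\<close>

lemma poly_over_conjugate: "poly (over P) (conjugate j) = rotate_fls (\<zeta> ^ j) (emb (curve P))"
proof -
  have "rotate_fls (\<zeta> ^ j) (subst2 fls_const P (U, emb \<psi>))
     = subst2 (\<lambda>c. rotate_fls (\<zeta> ^ j) (fls_const c)) P (rotate_fls (\<zeta> ^ j) U, rotate_fls (\<zeta> ^ j) (emb \<psi>))"
    by (rule hom_subst2[OF comm_ring_hom_rotate_fls[OF \<zeta>_nz] comm_ring_hom_fls_const])
  then show ?thesis by (simp add: emb_curve poly_over rotate_U conjugate_def)
qed

text \<open>
  A rotation that fixes \<psi> fixes all of C[\<phi>, \<psi>], in particular the series Y; its leading term X^(-1)
  detects the root of unity.
\<close>

lemma conjugate_eq_iff: "conjugate i = conjugate (i + j) \<longleftrightarrow> n dvd j"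
proof
  assume "n dvd j"
  then show "conjugate i = conjugate (i + j)"
    using \<zeta>_power_eq_1[of j] by (simp add: conjugate_def power_add)
next
  assume *: "conjugate i = conjugate (i + j)"
  have "poly (over f) (conjugate k) = rotate_fls (\<zeta> ^ k) Y" for k
    unfolding poly_over_conjugate curve_def generates emb_X ..
  then have "fls_nth (rotate_fls (\<zeta> ^ i) Y) (-1) = fls_nth (rotate_fls (\<zeta> ^ (i + j)) Y) (-1)"
    using * by metis
  then have "fls_nth Y (-1) * (\<zeta> ^ i) powi (-1) = fls_nth Y (-1) * (\<zeta> ^ (i + j)) powi (-1)"
    by (simp only: rotate_fls_nth[OF \<zeta>_nz])
  moreover have "Y \<noteq> 0" using Y(1) by auto
  then have "fls_nth Y (-1) \<noteq> 0" using nth_fls_subdegree_nonzero[of Y] Y(1) by simp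
  ultimately have "\<zeta> ^ j = 1" using \<zeta>_nz[of i] \<zeta>_nz[of j] by (auto simp: power_int_minus power_add)
  then show "n dvd j" by (simp add: \<zeta>_power_eq_1)
qed

lemma subdegree_conjugate_diff: "fls_subdegree (conjugate i - conjugate (i + j)) = - D j"
proof -
  interpret r: comm_ring_hom "rotate_fls (\<zeta> ^ i)" by (rule comm_ring_hom_rotate_fls[OF \<zeta>_nz])
  have "conjugate i - conjugate (i + j) = rotate_fls (\<zeta> ^ i) (conjugate 0 - conjugate j)"
    by (simp add: r.hom_minus rotate_conjugate)
  then show ?thesis by (simp only: D_def fls_subdegree_rotate_fls[OF \<zeta>_nz] minus_minus)
qed

lemma deg_le_conjugate_diff: "n dvd j \<or> D j \<le> e \<Longrightarrow> deg_le (conjugate i - conjugate (i + j)) e"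
  using subdegree_conjugate_diff[of i j] conjugate_eq_iff[of i j] by (auto simp: deg_le_iff)

sublocale cyclic_ultrametric D n
proof
  show "0 < n" by (rule n_pos)
  show per: "D (j + n) = D j" for j
    using conjugate_eq_iff[of j n] by (simp add: D_def)
  show "D i = D j" if "\<not> n dvd i" "n dvd i + j" for i j
  proof -
    have "conjugate (i + j) = conjugate 0" using conjugate_eq_iff[of 0 "i + j"] that by simp
    then have "- D j = fls_subdegree (conjugate i - conjugate 0)"
      using subdegree_conjugate_diff[of i j] by simp
    then show ?thesis by (simp add: D_def fls_subdegree_minus_sym)
  qed
  show "D (i + j) \<le> max (D i) (D j)" if "\<not> n dvd i" "\<not> n dvd j" "\<not> n dvd i + j" for i j
  proof -
    have "deg_le ((conjugate 0 - conjugate (0 + i)) + (conjugate i - conjugate (i + j))) (max (D i) (D j))"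
      by (intro deg_le_add deg_le_conjugate_diff) auto
    then have "deg_le (conjugate 0 - conjugate (i + j)) (max (D i) (D j))" by simp
    moreover have "conjugate 0 \<noteq> conjugate (i + j)" using conjugate_eq_iff[of 0 "i + j"] that by simp
    ultimately show ?thesis by (simp add: deg_le_iff D_def)
  qed
qed

lemma D_le: "\<not> n dvd j \<Longrightarrow> D j \<le> int (degree \<psi>)"
proof -
  assume j: "\<not> n dvd j"
  have c: "deg_le (conjugate k) (int (degree \<psi>))" for k
  proof (cases "emb \<psi> = 0")
    case True
    then show ?thesis
      unfolding conjugate_def using comm_ring_hom_0[OF comm_ring_hom_rotate_fls[OF \<zeta>_nz]] by simp
  next
    case False
    then have "fls_subdegree (conjugate k) = - int (degree \<psi>)"
      unfolding conjugate_def fls_subdegree_rotate_fls[OF \<zeta>_nz] using subdegree_emb emb_eq_0_iff by blast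
    then show ?thesis by (simp add: deg_le_iff)
  qed
  have "deg_le (conjugate 0 - conjugate j) (int (degree \<psi>))" by (intro deg_le_diff c)
  moreover have "conjugate 0 \<noteq> conjugate j" using conjugate_eq_iff[of 0 j] j by simp
  ultimately show ?thesis by (simp add: deg_le_iff D_def)
qed

text \<open>
  The leading term of \<psi> is multiplied by \<zeta>^(-deg \<psi>), which is not 1, so it survives in the
  difference of the first two conjugates.
\<close>

lemma D_1: 
  assumes "\<not> n dvd degree \<psi>"
  shows "D 1 = int (degree \<psi>)"
proof -
  have "\<psi> \<noteq> 0" using assms by auto
  then have s: "emb \<psi> \<noteq> 0" "fls_subdegree (emb \<psi>) = - int (degree \<psi>)" using subdegree_emb by auto
  let ?m = "- int (degree \<psi>)"
  have nd: "\<not> n dvd 1" using assms by (metis dvd_trans one_dvd)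
  have "fls_nth (conjugate 0 - conjugate 1) ?m = fls_nth (emb \<psi>) ?m * (1 - \<zeta> powi ?m)"
    unfolding conjugate_0 using rotate_fls_nth[OF \<zeta>_nz, of 1 "emb \<psi>" ?m]
    by (simp add: conjugate_def algebra_simps)
  moreover have "\<zeta> powi ?m \<noteq> 1"
    using \<zeta>_power_eq_1[of "degree \<psi>"] assms by (simp add: power_int_minus)
  moreover have "fls_nth (emb \<psi>) ?m \<noteq> 0" using s nth_fls_subdegree_nonzero[of "emb \<psi>"] by metis
  ultimately have "fls_nth (conjugate 0 - conjugate 1) ?m \<noteq> 0" by simp
  then have "fls_subdegree (conjugate 0 - conjugate 1) \<le> ?m" by (rule fls_subdegree_leI)
  then show ?thesis using D_le[OF nd] by (simp add: D_def)
qed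

lemma inj_conjugate: "inj_on conjugate {..<n}"
proof (rule linorder_inj_onI)
  fix i j assume ij: "i < j" "i \<in> {..<n}" "j \<in> {..<n}"
  then have "\<not> n dvd j - i" by (auto dest!: dvd_imp_le)
  then show "conjugate i \<noteq> conjugate j" using conjugate_eq_iff[of i "j - i"] ij by simp
qed auto

lemma coeff_over: "coeff (over P) k = poly (map_poly fls_const (coeff P k)) U"
  unfolding over_def by (rule coeff_map_poly) simp

lemma coef_eq_0_iff: "poly (map_poly fls_const c) U = 0 \<longleftrightarrow> c = 0"
proof -
  have "emb (curve [:c:]) = poly (map_poly fls_const c) U"
    unfolding emb_curve by (cases "c = 0") (simp_all add: over_def map_poly_pCons)
  moreover have "curve [:c:] = pcompose c \<phi>"
    by (cases "c = 0") (simp_all add: curve_def subst2_def map_poly_pCons pcompose_altdef)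
  ultimately show ?thesis
    using emb_eq_0_iff[of "pcompose c \<phi>"] pcompose_eq_0[of c \<phi>] deg_pos by auto
qed

lemma over_eq_0_iff: "over P = 0 \<longleftrightarrow> P = 0"
  by (simp add: poly_eq_iff coeff_over coef_eq_0_iff)

lemma deg_less_over: "deg_less P k \<Longrightarrow> deg_less (over P) k"
  by (simp add: deg_less_def coeff_over)

lemma monic_of_over: "monic_of k P \<Longrightarrow> monic_of k (over P)"
proof -
  assume *: "monic_of k P"
  then have 1: "coeff (over P) k = 1" by (simp add: monic_of_iff coeff_over)
  have "deg_less (over P) (Suc k)" by (rule deg_less_over[OF monic_of_deg_less[OF *]])
  then have "degree (over P) \<le> k" by (auto simp: deg_less_iff)
  with 1 show ?thesis by (metis le_antisym le_degree monic_of_iff zero_neq_one)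
qed

text \<open>
  There are n distinct conjugates.
\<close>

lemma vanishing_at_conjugates:
  assumes "deg_less P n" "\<And>j. j < n \<Longrightarrow> poly P (conjugate j) = 0"
  shows "P = 0"
proof (rule ccontr)
  assume nz: "P \<noteq> 0"
  have "(\<Prod>j<n. [:- conjugate j, 1:]) dvd P"
    by (rule prod_linear_dvd[OF _ _ inj_conjugate]) (use assms in auto)
  then have "degree (\<Prod>j<n. [:- conjugate j, 1:]) \<le> degree P" using nz by (rule dvd_imp_degree_le)
  moreover have "degree (\<Prod>j<n. [:- conjugate j, 1:]) = (\<Sum>j<n. degree [:- conjugate j, 1:])"
    by (rule degree_prod_eq_sum_degree) auto
  ultimately show False using assms(1) nz by (simp add: deg_less_iff)
qed

lemma curve_eq_0_imp: "curve P = 0 \<Longrightarrow> poly (over P) (conjugate j) = 0"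
  using comm_ring_hom_0[OF comm_ring_hom_rotate_fls[OF \<zeta>_nz]] by (simp add: poly_over_conjugate)

lemma curve_eq_0_low_degree: "curve P = 0 \<Longrightarrow> deg_less P n \<Longrightarrow> P = 0"
  using vanishing_at_conjugates[OF deg_less_over] curve_eq_0_imp over_eq_0_iff by blast

lemma over_eq_prod:
  assumes "monic_of n P" "curve P = 0"
  shows "over P = (\<Prod>j<n. [:- conjugate j, 1:])"
proof -
  have "poly (\<Prod>j<n. [:- conjugate j, 1:]) (conjugate j) = 0" if "j < n" for j
    using that by (auto simp: poly_prod prod_zero_iff)
  then have "over P - (\<Prod>j<n. [:- conjugate j, 1:]) = 0"
    using curve_eq_0_imp[OF assms(2)]
    by (intro vanishing_at_conjugates monic_of_diff monic_of_over assms monic_prod_linear) auto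
  then show ?thesis by simp
qed

lemma degree_curve_pderiv:
  assumes "monic_of n P" "curve P = 0"
  shows "int (degree (curve (pderiv P))) = spread n"
proof -
  have "over (pderiv P) = pderiv (over P)"
    unfolding over_def by (rule coefi.map_poly_pderiv)
  moreover have "over P = [:- conjugate 0, 1:] * (\<Prod>j\<in>{0<..<n}. [:- conjugate j, 1:])"
  proof -
    have "{..<n} = insert 0 {0<..<n}" using n_pos by auto
    then have "(\<Prod>j<n. [:- conjugate j, 1:]) = (\<Prod>j\<in>insert 0 {0<..<n}. [:- conjugate j, 1:])"
      by (rule arg_cong)
    then show ?thesis unfolding over_eq_prod[OF assms] by (subst (asm) prod.insert) auto
  qed
  ultimately have "poly (over (pderiv P)) (conjugate 0) = (\<Prod>j\<in>{0<..<n}. conjugate 0 - conjugate j)"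
    by (simp add: pderiv_mult pderiv_pCons poly_prod del: mult_pCons_left)
  then have e: "emb (curve (pderiv P)) = (\<Prod>j\<in>{0<..<n}. conjugate 0 - conjugate j)"
    unfolding emb_curve conjugate_0 by simp
  have nz: "conjugate 0 - conjugate j \<noteq> 0" if "j \<in> {0<..<n}" for j
    using conjugate_eq_iff[of 0 j] that by (auto dest: dvd_imp_le)
  have "emb (curve (pderiv P)) \<noteq> 0" unfolding e using nz by (auto simp: prod_zero_iff)
  then have "fls_subdegree (emb (curve (pderiv P))) = - int (degree (curve (pderiv P)))"
    using subdegree_emb emb_eq_0_iff by blast
  moreover have "fls_subdegree (emb (curve (pderiv P))) = (\<Sum>j\<in>{0<..<n}. fls_subdegree (conjugate 0 - conjugate j))"
    unfolding e by (rule fls_subdegree_prod) (use nz in auto)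
  ultimately show ?thesis by (simp add: spread_def D_def sum_negf)
qed

text \<open>
  The number e + spread N is the Gauss norm of M = \<Prod>(v - \<psi>_i), i < N, on the discs of radius e around
  \<psi>_0, ..., \<psi>_(N-1).  Every conjugate lies in one of these discs, q = n/N of them in each, so the
  equation of the curve has norm at most q times this number, and its approximate q-th root K has at most the norm of M.
  But K has coefficients in C[u] and degree N < n in v, so its restriction to the curve is a nonzero
  polynomial in Y, whose degree is not negative.  The degree at the centre \<psi>_0 is bounded by the Gauss
  norm.
\<close>

lemma level_nonneg:
  assumes P: "monic_of n P" "curve P = 0" and lev: "level N e"
  shows "0 \<le> e + spread N"
proof -
  have N: "0 < N" "N < n" "N dvd n" using lev by (auto simp: level_def)
  obtain q where q: "n = q * N" using N(3) by (metis dvd_def mult.commute)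
  have "1 < q" using N q by (cases "q = 0 \<or> q = 1") auto
  then have "q = Suc (Suc (q - 2))" by simp
  then obtain d where d: "q = Suc (Suc d)" by blast
  have Dbig: "e < D j" if "\<not> N dvd j" for j using lev that by (simp add: level_def)
  define \<delta> where "\<delta> i j = (if i = j then e else - fls_subdegree (conjugate i - conjugate j))" for i j
  have Dmod: "D (j mod N) = D j" if "\<not> N dvd j" for j
    using level_const[OF lev, of "j mod N" "j div N"] that by (simp add: dvd_mod_iff mod_mult_div_eq)
  \<comment> \<open>N + j - i stands for j - i modulo N; the summand N keeps the natural number subtraction exact.\<close>
  have dD: "\<delta> i j = D (N + j - i)" "\<not> N dvd N + j - i" if "i < N" "j < N" "i \<noteq> j" for i j
  proof -
    show nd: "\<not> N dvd N + j - i"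
    proof
      assume "N dvd N + j - i"
      then obtain k where k: "N + j - i = N * k" by blast
      have "0 < N + j - i" "N + j - i < N * 2" using that by linarith+
      then have "0 < k" "k < 2" unfolding k by simp_all
      then have "k = 1" by simp
      then show False using k that by simp
    qed
    show "\<delta> i j = D (N + j - i)"
    proof (cases "i < j")
      case True
      have "N + j - i = N + (j - i)" using True by simp
      then have "\<not> N dvd j - i" using nd by (metis dvd_add_right_iff dvd_refl)
      then have "D ((j - i) + N * 1) = D (j - i)" by (rule level_const[OF lev])
      moreover have "(j - i) + N * 1 = N + j - i" using True by simp
      ultimately show ?thesis using subdegree_conjugate_diff[of i "j - i"] True that
        by (simp add: \<delta>_def)
    next
      case False
      then have ji: "j < i" using that by simp
      have "D (n - (i - j)) = D (i - j)"
        by (rule opposite) (use ji that N in \<open>auto dest!: dvd_imp_le\<close>)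
      moreover have "n - (i - j) = (N + j - i) + N * (q - 1)"
        using ji that \<open>1 < q\<close> unfolding q by (cases q) (auto simp: mult.commute)
      ultimately have "D (N + j - i) = D (i - j)" using level_const[OF lev nd, of "q - 1"] by simp
      then show ?thesis using subdegree_conjugate_diff[of j "i - j"] ji
        by (simp add: \<delta>_def fls_subdegree_minus_sym)
    qed
  qed
  interpret discs: equidistributed_discs conjugate N e \<delta> "spread N"
  proof
    show "0 < N" by fact
    show "\<delta> i i = e" for i by (simp add: \<delta>_def)
    show "conjugate i \<noteq> conjugate j \<and> \<delta> i j = - fls_subdegree (conjugate i - conjugate j) \<and> e \<le> \<delta> i j"
      if "i < N" "j < N" "i \<noteq> j" for i j
    proof -
      have "conjugate i \<noteq> conjugate j" using inj_conjugate that N by (auto simp: inj_on_def)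
      moreover have "e \<le> \<delta> i j" using dD[OF that] Dbig by (simp add: less_imp_le)
      ultimately show ?thesis using that by (simp add: \<delta>_def)
    qed
    show "(\<Sum>j\<in>{..<N} - {i}. \<delta> i j) = spread N" if i: "i < N" for i
      unfolding spread_def
    proof (rule sum.reindex_bij_witness[where i = "\<lambda>k. (k + i) mod N" and j = "\<lambda>j. (N + j - i) mod N"])
      fix j assume "j \<in> {..<N} - {i}"
      then have j: "j < N" "j \<noteq> i" by auto
      have "((N + j - i) mod N + i) mod N = (N + j - i + i) mod N" by (simp add: mod_simps)
      then show "((N + j - i) mod N + i) mod N = j" using i j by simp
      show "(N + j - i) mod N \<in> {0<..<N}"
        using dD(2)[OF i j(1)] j N by (auto simp: dvd_eq_mod_eq_0)
      show "D ((N + j - i) mod N) = \<delta> i j" using Dmod dD[OF i j(1)] j by auto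
    next
      fix k assume "k \<in> {0<..<N}"
      then have k: "0 < k" "k < N" by auto
      have "(N + (k + i) mod N - i) mod N = k"
      proof (cases "k + i < N")
        case False
        then have "(k + i) mod N = k + i - N" using k i by (simp add: mod_if)
        then show ?thesis using False k i by simp
      qed (use k i in simp)
      then show "(N + (k + i) mod N - i) mod N = k" .
      show "(k + i) mod N \<in> {..<N} - {i}"
      proof (cases "k + i < N")
        case False
        then have "(k + i) mod N = k + i - N" using k i by (simp add: mod_if)
        then show ?thesis using False k i by auto
      qed (use k i in auto)
    qed
  qed
  have "over P \<in> discs.bounded (int q * (e + spread N))"
    unfolding discs.bounded_def mem_Collect_eq over_eq_prod[OF P]
  proof (intro allI impI)
    fix i assume i: "i < N"
    have "bounded_on_disc (conjugate i) e (\<delta> i (j mod N)) [:- conjugate j, 1:]" for j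
    proof (rule bounded_on_disc_linear)
      have jN: "j mod N < N" using N by simp
      show le: "e \<le> \<delta> i (j mod N)" using discs.dist[OF i jN] discs.diag by (cases "i = j mod N") auto
      have "deg_le (conjugate i - conjugate (j mod N)) (\<delta> i (j mod N))"
        using discs.dist[OF i jN] by (cases "i = j mod N") (auto simp: deg_le_iff)
      moreover have "deg_le (conjugate (j mod N) - conjugate (j mod N + N * (j div N))) (\<delta> i (j mod N))"
        using lev le by (intro deg_le_mono[OF _ le] deg_le_conjugate_diff) (auto simp: level_def)
      ultimately have "deg_le ((conjugate i - conjugate (j mod N)) + (conjugate (j mod N) - conjugate j)) (\<delta> i (j mod N))"
        by (intro deg_le_add) (simp_all add: mod_mult_div_eq)
      then show "deg_le (conjugate i - conjugate j) (\<delta> i (j mod N))" by simp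
    qed
    then have "bounded_on_disc (conjugate i) e (\<Sum>j<n. \<delta> i (j mod N)) (\<Prod>j<n. [:- conjugate j, 1:])"
      by (intro bounded_on_disc_prod) auto
    moreover have "(\<Sum>j<n. \<delta> i (j mod N)) = int q * (e + spread N)"
    proof -
      have "(\<Sum>j<n. \<delta> i (j mod N)) = (\<Sum>m<q. \<Sum>j\<in>{m * N..<m * N + N}. \<delta> i (j mod N))"
        unfolding q by (rule sum.nat_group[symmetric])
      also have "\<dots> = (\<Sum>m<q. \<Sum>j<N. \<delta> i j)"
      proof (rule sum.cong[OF refl])
        fix m
        have "(\<Sum>j\<in>{m * N..<m * N + N}. \<delta> i (j mod N)) = (\<Sum>j<N. \<delta> i ((m * N + j) mod N))"
          using sum.shift_bounds_nat_ivl[of "\<lambda>j. \<delta> i (j mod N)" 0 "m * N" N] by (simp add: atLeast0LessThan add.commute)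
        then show "(\<Sum>j\<in>{m * N..<m * N + N}. \<delta> i (j mod N)) = (\<Sum>j<N. \<delta> i j)" by simp
      qed
      finally show ?thesis using discs.total[OF i] by simp
    qed
    ultimately show "bounded_on_disc (conjugate i) e (int q * (e + spread N)) (\<Prod>j<n. [:- conjugate j, 1:])"
      by simp
  qed
  moreover have "monic_of (Suc (Suc d) * N) (over P)"
    using monic_of_over[OF P(1)] q d by simp
  ultimately obtain K where K: "K \<in> discs.bounded (e + spread N)" "monic_of N K"
    "deg_less (over P - K ^ Suc (Suc d)) (Suc d * N)"
    using discs.approximate_root_bounded[of d "over P"] d by auto
  have "\<exists>L \<in> UNIV. monic_of N L \<and> deg_less (P - L ^ Suc (Suc d)) (Suc d * N)"
  proof (rule approximate_root_exists[where B = "\<lambda>_. UNIV" and M = "monom 1 N" and \<mu> = 0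
        and q = "[:inverse (of_nat (Suc (Suc d))):]"])
    show "[:inverse (of_nat (Suc (Suc d))):] * of_nat (Suc (Suc d)) = (1 :: complex poly)"
      by (simp add: of_nat_poly one_pCons del: of_nat_Suc)
    show "monic_of N (monom 1 N)" by (simp add: monic_of_def)
    show "monic_of (Suc (Suc d) * N) P" using P(1) q d by simp
    show "\<exists>A R. Q = monom 1 N ^ Suc d * A + R \<and> deg_less R (Suc d * N) \<and> A \<in> UNIV" for Q :: bipoly
    proof (intro exI conjI)
      have m: "monom 1 N ^ Suc d = (monom 1 (Suc d * N) :: bipoly)"
        by (simp only: monom_power power_one mult.commute)
      show "Q = monom 1 N ^ Suc d * poly_shift (Suc d * N) Q + poly_cutoff (Suc d * N) Q"
        unfolding m by (rule poly_eqI) (auto simp: coeff_monom_mult coeff_poly_shift coeff_poly_cutoff)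
      show "deg_less (poly_cutoff (Suc d * N) Q) (Suc d * N)"
        by (simp add: deg_less_def coeff_poly_cutoff)
    qed simp
  qed (use N in auto)
  then obtain L where L: "monic_of N L" "deg_less (P - L ^ Suc (Suc d)) (Suc d * N)" by blast
  have "deg_less (over P - over L ^ Suc (Suc d)) (Suc d * N)"
    using deg_less_over[OF L(2)] by (simp only: over.hom_minus over.hom_power)
  then have "K = over L"
    by (intro approximate_root_unique[OF _ K(2,3) monic_of_over[OF L(1)]])
      (simp add: fls_of_nat del: of_nat_Suc)
  have "curve L \<noteq> 0"
  proof
    assume "curve L = 0"
    then have "L = 0" by (rule curve_eq_0_low_degree)
       (rule deg_less_mono[OF monic_of_deg_less[OF L(1)]], use N in simp)
    then show False using L(1) by (simp add: monic_of_iff)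
  qed
  have "coeff (pcompose K [:conjugate 0, 1:]) 0 = emb (curve L)"
    unfolding emb_curve \<open>K = over L\<close> conjugate_0 by (simp add: poly_pcompose flip: poly_0_coeff_0)
  moreover have "bounded_on_disc (conjugate 0) e (e + spread N) K"
    using K(1) N(1) by (simp add: discs.bounded_def)
  ultimately have "deg_le (emb (curve L)) (e + spread N)"
    unfolding bounded_on_disc_def by (metis diff_zero mult_zero_right of_nat_0)
  then show ?thesis using subdegree_emb[OF \<open>curve L \<noteq> 0\<close>] by (simp add: deg_le_iff)
qed

lemma degree_le_degree_derivative:
  assumes "monic_of n P" "curve P = 0" "\<not> n dvd degree \<psi>"
  shows "degree \<psi> \<le> degree (curve (pderiv P))"
proof -
  have "n \<noteq> 1" using assms(3) by auto
  then have "1 < n" using n_pos by linarith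
  then have "D 1 \<le> spread n"
    by (rule spread_ge[rotated]) (use level_nonneg[OF assms(1,2)] D_le D_1[OF assms(3)] in auto)
  then show ?thesis using D_1[OF assms(3)] degree_curve_pderiv[OF assms(1,2)] by simp
qed

end

section \<open>Embedded lines: the theorem of Abhyankar and Moh\<close>

lemma comm_ring_hom_curve: "comm_ring_hom (\<lambda>P. subst2 (\<lambda>c::complex. [:c:]) P z)"
  by (rule comm_ring_hom_subst2[OF comm_ring_hom_const_poly1])

text \<open>
  Repeated division by \<phi>: the powers of Y below deg \<phi> generate C[Y] over C[\<phi>].
\<close>

lemma base_expansion:
  fixes \<phi> \<pi> :: "complex poly"
  assumes "0 < degree \<phi>"
  shows "\<exists>a. \<pi> = (\<Sum>j<degree \<phi>. pcompose (a j) \<phi> * monom 1 j)"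
proof (induction "degree \<pi>" arbitrary: \<pi> rule: less_induct)
  case less
  have low: "\<rho> = (\<Sum>j<degree \<phi>. [:coeff \<rho> j:] * monom 1 j)" if "degree \<rho> < degree \<phi>" for \<rho> :: "complex poly"
  proof -
    have "coeff (\<Sum>j<degree \<phi>. [:coeff \<rho> j:] * monom 1 j) k = (\<Sum>j<degree \<phi>. if j = k then coeff \<rho> k else 0)" for k
      unfolding coeff_sum by (intro sum.cong) auto
    then show ?thesis using that by (auto simp: poly_eq_iff coeff_eq_0)
  qed
  show ?case
  proof (cases "degree \<pi> < degree \<phi>")
    case True
    then show ?thesis using low[OF True] by (intro exI[of _ "\<lambda>j. [:coeff \<pi> j:]"]) simp
  next
    case False
    define q r where "q = \<pi> div \<phi>" and "r = \<pi> mod \<phi>"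
    have \<phi>: "\<phi> \<noteq> 0" using assms by auto
    have \<pi>: "\<pi> = \<phi> * q + r" by (simp add: q_def r_def)
    have r: "degree r < degree \<phi>" using degree_mod_less[OF \<phi>, of \<pi>] assms by (auto simp: r_def)
    have "degree q < degree \<pi>"
    proof (cases "q = 0")
      case False
      then have "degree (\<phi> * q) = degree \<phi> + degree q" using \<phi> by (simp add: degree_mult_eq)
      then have "degree \<pi> = degree \<phi> + degree q"
        unfolding \<pi> using r by (subst degree_add_eq_left) auto
      then show ?thesis using assms by simp
    qed (use assms False in auto)
    from less[OF this] obtain a where a: "q = (\<Sum>j<degree \<phi>. pcompose (a j) \<phi> * monom 1 j)" by blast
    have "\<pi> = (\<Sum>j<degree \<phi>. pcompose ([:0, 1:] * a j + [:coeff r j:]) \<phi> * monom 1 j)"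
      unfolding \<pi> by (subst low[OF r], subst a)
        (simp add: sum_distrib_left sum.distrib pcompose_add pcompose_mult pcompose_pCons algebra_simps)
    then show ?thesis by (rule exI[of _ "\<lambda>j. [:0, 1:] * a j + [:coeff r j:]"])
  qed
qed

text \<open>
  The characteristic polynomial of the multiplication by \<psi> on the C[\<phi>]-module C[Y], written in the basis
  1, Y, ..., Y^(n-1).  The vector of these powers is an eigenvector for \<psi> over the fraction field.
\<close>

lemma exists_monic_relation:
  fixes \<phi> \<psi> :: "complex poly"
  assumes "0 < degree \<phi>"
  shows "\<exists>P. monic_of (degree \<phi>) P \<and> subst2 (\<lambda>c. [:c:]) P (\<phi>, \<psi>) = 0"
proof -
  define n where "n = degree \<phi>"
  have "\<exists>a. \<psi> * monom 1 i = (\<Sum>j<n. pcompose (a j) \<phi> * monom 1 j)" for i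
    unfolding n_def by (rule base_expansion[OF assms])
  then obtain a where a: "\<And>i. \<psi> * monom 1 i = (\<Sum>j<n. pcompose (a i j) \<phi> * monom 1 j)" by metis
  define A where "A = mat n n (\<lambda>(i, j). a i j)"
  have A: "A \<in> carrier_mat n n" by (simp add: A_def)
  define h where "h p = to_fract (pcompose p \<phi>)" for p :: "complex poly"
  interpret h: comm_ring_hom h
    unfolding h_def by unfold_locales (auto simp: pcompose_add pcompose_mult pcompose_1)
  define v where "v = vec n (\<lambda>i. to_fract (monom 1 i :: complex poly))"
  have hA: "map_mat h A \<in> carrier_mat n n" using A by simp
  have "map_mat h A *\<^sub>v v = to_fract \<psi> \<cdot>\<^sub>v v"
  proof (rule eq_vecI)
    fix i assume i: "i < dim_vec (to_fract \<psi> \<cdot>\<^sub>v v)"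
    then have i: "i < n" by (simp add: v_def)
    have s: "to_fract (sum f B) = (\<Sum>x\<in>B. to_fract (f x))" for f :: "nat \<Rightarrow> complex poly" and B
      by (induction B rule: infinite_finite_induct) auto
    have "vec_index (map_mat h A *\<^sub>v v) i = (\<Sum>j<n. h (a i j) * to_fract (monom 1 j))"
      using i by (simp add: scalar_prod_def A_def v_def atLeast0LessThan)
    also have "\<dots> = to_fract (\<psi> * monom 1 i)" unfolding a s by (simp add: h_def)
    finally show "vec_index (map_mat h A *\<^sub>v v) i = vec_index (to_fract \<psi> \<cdot>\<^sub>v v) i" using i by (simp add: v_def)
  qed (simp add: v_def A_def)
  moreover have "v \<noteq> 0\<^sub>v n"
  proof
    assume "v = 0\<^sub>v n"
    then have "vec_index v 0 = 0" using assms by (simp add: n_def)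
    then show False using assms by (simp add: v_def n_def)
  qed
  ultimately have "eigenvector (map_mat h A) v (to_fract \<psi>)"
    by (simp add: eigenvector_def v_def A_def)
  then have "eigenvalue (map_mat h A) (to_fract \<psi>)" by (auto simp: eigenvalue_def)
  then have "poly (char_poly (map_mat h A)) (to_fract \<psi>) = 0"
    using eigenvalue_root_char_poly[OF hA] by simp
  then have "poly (map_poly h (char_poly A)) (to_fract \<psi>) = 0"
    by (simp add: h.char_poly_hom[OF A])
  also have "poly (map_poly h P) (to_fract x) = to_fract (poly (map_poly (\<lambda>p. pcompose p \<phi>) P) x)" for P x
    by (induction P) (auto simp: h_def map_poly_pCons)
  finally have "poly (map_poly (\<lambda>p. pcompose p \<phi>) (char_poly A)) \<psi> = 0" by simp
  then have "subst2 (\<lambda>c. [:c:]) (char_poly A) (\<phi>, \<psi>) = 0"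
    by (simp add: subst2_def pcompose_altdef)
  moreover have "monic_of n (char_poly A)"
    using degree_monic_char_poly[OF A] by (simp add: monic_of_iff)
  ultimately show ?thesis unfolding n_def by blast
qed

text \<open>
  Along an integral curve of the Hamiltonian field of H, the derivative of P(\<phi>, \<psi>) is the restriction
  of the Poisson bracket of P and H.  So C[\<phi>, \<psi>] is closed under differentiation, and differentiating a
  nonconstant element often enough gives a polynomial of degree 1.
\<close>

lemma integral_curve_generates:
  fixes \<phi> \<psi> :: "complex poly" and H :: bipoly
  assumes dx: "pderiv \<phi> = subst2 (\<lambda>c. [:c:]) (partialY H) (\<phi>, \<psi>)"
    and dy: "pderiv \<psi> = - subst2 (\<lambda>c. [:c:]) (partialX H) (\<phi>, \<psi>)"
    and nonconst: "0 < degree \<phi>"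
  shows "\<exists>f. subst2 (\<lambda>c. [:c:]) f (\<phi>, \<psi>) = [:0, 1:]"
proof -
  interpret C: comm_ring_hom "\<lambda>P. subst2 (\<lambda>c. [:c:]) P (\<phi>, \<psi>)" by (rule comm_ring_hom_curve)
  have "\<exists>f. subst2 (\<lambda>c. [:c:]) f (\<phi>, \<psi>) = [:0, 1:]"
    if "degree (subst2 (\<lambda>c. [:c:]) P (\<phi>, \<psi>)) = Suc k" for P k
    using that
  proof (induction k arbitrary: P)
    case 0
    let ?p = "subst2 (\<lambda>c. [:c:]) P (\<phi>, \<psi>)"
    obtain a b where ab: "?p = [:a, b:]" "b \<noteq> 0"
    proof -
      have "degree ?p = 1" using 0 by simp
      then show ?thesis using that by (elim degree1_coeffs) blast
    qed
    have "subst2 (\<lambda>c. [:c:]) ([:[:inverse b:]:] * (P - [:[:a:]:])) (\<phi>, \<psi>) = [:0, 1:]"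
      using ab by (simp add: C.hom_mult C.hom_minus subst2_const del: mult_pCons_left)
    then show ?case by (rule exI)
  next
    case (Suc k)
    let ?p = "subst2 (\<lambda>c. [:c:]) P (\<phi>, \<psi>)"
    have "pderiv ?p = subst2 (\<lambda>c. [:c:]) (partialX P * partialY H - partialY P * partialX H) (\<phi>, \<psi>)"
      using chain_rule[OF comm_ring_hom_const_poly1 derivation_pderiv, of P \<phi> \<psi>]
      by (simp add: dx dy C.hom_mult C.hom_minus pderiv_pCons)
    moreover have "degree (pderiv ?p) = Suc k" using Suc.prems by (simp add: degree_pderiv)
    ultimately show ?case using Suc.IH by metis
  qed
  moreover have "subst2 (\<lambda>c. [:c:]) varX (\<phi>, \<psi>) = \<phi>" by (simp add: subst2_varX one_pCons)
  ultimately show ?thesis using nonconst by (metis gr0_implies_Suc)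
qed

text \<open>
  Let P be the monic equation of degree n in v.  It divides H, so the v-derivative of P divides that
  of H along the curve, that is, d\<phi>/dY.  Its degree is therefore less than n, whereas it is at least
  deg \<psi> when n does not divide deg \<psi>.
\<close>

theorem embedded_line_degrees:
  fixes \<phi> \<psi> :: "complex poly" and H :: bipoly
  assumes H: "subst2 (\<lambda>c. [:c:]) H (\<phi>, \<psi>) = 0"
    and dx: "pderiv \<phi> = subst2 (\<lambda>c. [:c:]) (partialY H) (\<phi>, \<psi>)"
    and dy: "pderiv \<psi> = - subst2 (\<lambda>c. [:c:]) (partialX H) (\<phi>, \<psi>)"
    and deg: "0 < degree \<phi>" "degree \<phi> \<le> degree \<psi>"
  shows "degree \<phi> dvd degree \<psi>"
proof (rule ccontr)
  assume nd: "\<not> degree \<phi> dvd degree \<psi>"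
  obtain f where f: "subst2 (\<lambda>c. [:c:]) f (\<phi>, \<psi>) = [:0, 1:]"
    using integral_curve_generates[OF dx dy deg(1)] by blast
  obtain Y where Y: "fls_subdegree Y = -1" "poly (map_poly fls_const \<phi>) Y = inverse fls_X ^ degree \<phi>"
    using exists_parameter_at_infinity[OF deg(1)] by blast
  interpret C: curve_at_infinity \<phi> \<psi> f Y
    by unfold_locales (use deg f Y in auto)
  obtain P where P: "monic_of C.n P" "C.curve P = 0"
    using exists_monic_relation[OF deg(1), of \<psi>] by (auto simp: C.n_def C.curve_def)
  define Q R where "Q = fst (pseudo_divmod H P)" and "R = snd (pseudo_divmod H P)"
  have P': "P \<noteq> 0" "coeff P (degree P) = 1" "degree P = C.n" using P(1) by (auto simp: monic_of_iff)
  have HQR: "H = P * Q + R" and R: "R = 0 \<or> degree R < degree P"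
    using pseudo_divmod[of P H Q R] P' by (simp_all add: Q_def R_def)
  have "C.curve R = 0" using H P(2) unfolding HQR
    by (simp flip: C.curve_def add: C.curve.hom_add C.curve.hom_mult)
  then have "R = 0" by (rule C.curve_eq_0_low_degree) (use R P' in \<open>simp add: deg_less_iff\<close>)
  then have "pderiv H = pderiv P * Q + P * pderiv Q" using HQR by (simp add: pderiv_mult)
  then have "pderiv \<phi> = C.curve (pderiv P) * C.curve Q"
    using dx P(2) by (simp add: partialY_def C.curve.hom_add C.curve.hom_mult flip: C.curve_def)
  moreover have "pderiv \<phi> \<noteq> 0" using deg(1) by (simp add: pderiv_eq_0_iff)
  ultimately have "degree (C.curve (pderiv P)) \<le> degree (pderiv \<phi>)"
    by (metis degree_mult_right_le mult_zero_right)
  also have "\<dots> < degree \<phi>" using deg(1) by (simp add: degree_pderiv)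
  finally have "degree (C.curve (pderiv P)) < degree \<phi>" .
  moreover have "degree \<psi> \<le> degree (C.curve (pderiv P))"
    by (rule C.degree_le_degree_derivative[OF P]) (use nd in \<open>simp add: C.n_def\<close>)
  ultimately show False using deg(2) by simp
qed

section \<open>Polynomial maps with monomial Jacobian determinant\<close>

definition xy_coeff :: "bipoly \<Rightarrow> nat \<Rightarrow> nat \<Rightarrow> complex" where
  "xy_coeff P i j = coeff (coeff P j) i"

definition at_zero :: "bipoly \<Rightarrow> complex poly" where
  "at_zero P = map_poly (\<lambda>c. poly c 0) P"

definition jac :: "bipoly \<Rightarrow> bipoly \<Rightarrow> bipoly" where
  "jac f g = partialX f * partialY g - partialY f * partialX g"

interpretation at_zero: comm_ring_hom at_zero
proof -
  interpret p0: comm_ring_hom "\<lambda>c :: complex poly. poly c 0" by unfold_locales auto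
  interpret map_poly_comm_ring_hom "\<lambda>c :: complex poly. poly c 0" ..
  show "comm_ring_hom at_zero" unfolding at_zero_def ..
qed

lemma coeff_at_zero: "coeff (at_zero P) j = xy_coeff P 0 j"
  by (simp add: at_zero_def xy_coeff_def coeff_map_poly poly_0_coeff_0)

lemma at_zero_const [simp]: "at_zero [:[:c:]:] = [:c:]"
  by (rule poly_eqI) (simp add: coeff_at_zero xy_coeff_def coeff_pCons split: nat.split)

lemma at_zero_varX [simp]: "at_zero varX = 0"
  by (rule poly_eqI) (simp add: coeff_at_zero xy_coeff_def coeff_pCons varX_def split: nat.split)

lemma at_zero_partialY: "at_zero (partialY P) = pderiv (at_zero P)"
  by (rule poly_eqI) (simp add: coeff_at_zero xy_coeff_def partialY_def coeff_pderiv of_nat_poly)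

lemma at_zero_comp_poly: "at_zero (comp_poly H (A, B)) = subst2 (\<lambda>c. [:c:]) H (at_zero A, at_zero B)"
  unfolding comp_poly_def
  by (subst hom_subst2[OF at_zero.comm_ring_hom_axioms comm_ring_hom_const_poly]) simp

lemma varX_power: "varX ^ k = [:monom 1 k:]"
  by (induction k) (simp_all add: varX_def one_pCons monom_0 monom_Suc)

lemma varX_nz [simp]: "varX \<noteq> 0" by (simp add: varX_def)

lemma xy_coeff_varX_power_mult: "xy_coeff (varX ^ k * P) i j = (if i < k then 0 else xy_coeff P (i - k) j)"
  by (simp add: xy_coeff_def varX_power coeff_monom_mult)

lemma xy_coeff_varX_mult: "xy_coeff (varX * P) i j = (if i = 0 then 0 else xy_coeff P (i - 1) j)"
  using xy_coeff_varX_power_mult[of 1 P i j] by simp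

lemma xy_coeff_varY_mult: "xy_coeff (varY * P) i j = (if j = 0 then 0 else xy_coeff P i (j - 1))"
  by (simp add: xy_coeff_def varY_def coeff_pCons split: nat.split)

lemma xy_coeff_mult: "xy_coeff (P * Q) a b = (\<Sum>j\<le>b. \<Sum>i\<le>a. xy_coeff P i j * xy_coeff Q (a - i) (b - j))"
  by (simp add: xy_coeff_def coeff_mult coeff_sum)

lemma xy_coeff_diff: "xy_coeff (P - Q) i j = xy_coeff P i j - xy_coeff Q i j"
  by (simp add: xy_coeff_def)

lemma xy_coeff_euler: "xy_coeff (varX * partialX P) i j = of_nat i * xy_coeff P i j"
  "xy_coeff (varY * partialY P) i j = of_nat j * xy_coeff P i j"
  unfolding xy_coeff_varX_mult xy_coeff_varY_mult
  by (auto simp: xy_coeff_def coeff_partialX coeff_pderiv partialY_def of_nat_poly)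

lemma bipoly_eqI: "(\<And>i j. xy_coeff P i j = xy_coeff Q i j) \<Longrightarrow> P = Q"
  by (simp add: xy_coeff_def poly_eq_iff)

lemma at_zero_eq_0: "at_zero P = 0 \<Longrightarrow> \<exists>Q. P = varX * Q"
proof
  assume *: "at_zero P = 0"
  show "P = varX * map_poly (poly_shift 1) P"
  proof (rule bipoly_eqI)
    fix i j
    have "xy_coeff P 0 j = 0" using * coeff_at_zero[of P j] by simp
    then show "xy_coeff P i j = xy_coeff (varX * map_poly (poly_shift 1) P) i j"
      by (cases i) (auto simp: xy_coeff_varX_mult, auto simp: xy_coeff_def coeff_map_poly coeff_poly_shift)
  qed
qed

lemma varX_factor:
  assumes "P \<noteq> 0"
  shows "\<exists>k Q. P = varX ^ k * Q \<and> at_zero Q \<noteq> 0"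
proof -
  obtain i j where "xy_coeff P i j \<noteq> 0" using assms bipoly_eqI[of P 0] by (auto simp: xy_coeff_def)
  then show ?thesis
  proof (induction i arbitrary: P)
    case 0
    then have "at_zero P \<noteq> 0" using coeff_at_zero[of P j] by auto
    then show ?case by (intro exI[of _ 0] exI[of _ P]) simp
  next
    case (Suc i)
    show ?case
    proof (cases "at_zero P = 0")
      case True
      then obtain Q where Q: "P = varX * Q" using at_zero_eq_0 by blast
      then have "xy_coeff Q i j \<noteq> 0" using Suc.prems by (simp add: xy_coeff_varX_mult)
      from Suc.IH[OF this] obtain k Q' where "Q = varX ^ k * Q'" "at_zero Q' \<noteq> 0" by blast
      then show ?thesis unfolding Q by (intro exI[of _ "Suc k"] exI[of _ Q']) simp
    qed (intro exI[of _ 0] exI[of _ P], simp)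
  qed
qed

text \<open>
  Both sides have a well defined order in X only if the cofactor does not vanish on X = 0; this order is
  a on the left.
\<close>

lemma varX_power_compare:
  assumes "varX ^ a * P = varX ^ b * Q" "at_zero P \<noteq> 0"
  shows "b \<le> a"
proof (rule ccontr)
  assume "\<not> b \<le> a"
  then have "b = a + Suc (b - a - 1)" by simp
  then have "varX ^ b = varX ^ a * varX ^ Suc (b - a - 1)" by (metis power_add)
  then have "varX ^ a * P = varX ^ a * (varX ^ Suc (b - a - 1) * Q)" using assms(1) by (simp add: ac_simps)
  then have "P = varX ^ Suc (b - a - 1) * Q" by (simp only: mult_cancel_left) auto
  then have "at_zero P = 0" by (simp add: at_zero.hom_mult)
  with assms(2) show False by simp
qed

text \<open>
  Write f = X^k f' with f'(0,Y) \<noteq> 0.  The lowest power of X in the Jacobian determinant shows that e = k - 1,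
  that f'(0,Y) is constant and that g(0,Y) has degree 1.  Suppose that f involves Y, or that g has
  degree more than 1 in Y.  Then give X the weight -1 and Y the smallest weight s > 0 for which f or g
  has a second monomial of top weight besides X^k or Y.  Among the monomials of top weight take
  those with the largest powers of Y, X^i1 Y^j1 in f and X^i2 Y^j2 in g.  They alone produce the monomial
  X^(i1+i2-1) Y^(j1+j2-1) of the Jacobian determinant, with the nonzero factor i1 j2 - j1 i2 =
  k j2 + s j1 > 0.  This contradicts the assumption that the determinant is a power of X.
\<close>

lemma monomial_jac_imp_vertical:
  assumes J: "jac f g = [:[:c:]:] * varX ^ e" and c: "c \<noteq> 0"
    and f0: "at_zero f = 0" and g0: "0 < degree (at_zero g)"
  shows "\<exists>p. f = [:p:] \<and> 0 < degree p"
proof -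
  have "f \<noteq> 0" using J c by (auto simp: jac_def partialX.zero partialY.zero)
  then obtain k f' where f: "f = varX ^ k * f'" and f': "at_zero f' \<noteq> 0" using varX_factor by blast
  have k: "0 < k" using f f0 f' by (cases k) auto
  define W where "W = of_nat k * f' * partialY g + varX * jac f' g"
  have kk: "varX ^ k = varX ^ (k - 1) * varX" using k by (metis power_minus_mult)
  have "jac f g = varX ^ (k - 1) * W"
    unfolding jac_def f W_def partialX.mult partialY.mult partialX.power partialY.power
    by (simp add: kk algebra_simps)
  then have JW: "varX ^ (k - 1) * W = varX ^ e * [:[:c:]:]" using J by (simp add: mult.commute)
  have ofn: "at_zero (of_nat k) = of_nat k" by (rule at_zero.hom_of_nat)
  have W0: "at_zero W = of_nat k * at_zero f' * pderiv (at_zero g)"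
    by (simp add: W_def at_zero.hom_add at_zero.hom_mult ofn at_zero_partialY)
  have g'0: "pderiv (at_zero g) \<noteq> 0" using g0 by (simp add: pderiv_eq_0_iff)
  have "at_zero W \<noteq> 0" unfolding W0 using k f' g'0 by simp
  with varX_power_compare[OF JW] varX_power_compare[OF JW[symmetric]] c
  have ek: "e = k - 1" by (simp add: le_antisym)
  have "W = [:[:c:]:]"
    using JW mult_left_cancel[of "varX ^ (k - 1)" W "[:[:c:]:]"] unfolding ek by simp
  then have "of_nat k * at_zero f' * pderiv (at_zero g) = [:c:]" using W0 by simp
  then have "degree (of_nat k * at_zero f' * pderiv (at_zero g)) = 0" by simp
  then have degs: "degree (at_zero f') = 0" "degree (at_zero g) = 1"
    using f' g'0 k g0 by (simp_all add: degree_mult_eq degree_pderiv of_nat_poly)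
  have cf_low: "xy_coeff f i j = 0" if "i < k" for i j using that by (simp add: f xy_coeff_varX_power_mult)
  have "coeff (at_zero f') j = 0" if "0 < j" for j using that degs by (simp add: coeff_eq_0)
  then have cf_k: "xy_coeff f k j = 0" if "0 < j" for j
    using that by (simp add: f xy_coeff_varX_power_mult coeff_at_zero)
  have "coeff (at_zero f') 0 \<noteq> 0" using f' degs by (metis leading_coeff_0_iff)
  then have cf_k0: "xy_coeff f k 0 \<noteq> 0" by (simp add: f xy_coeff_varX_power_mult coeff_at_zero)
  have cg: "xy_coeff g 0 j = 0" if "1 < j" for j using that degs by (simp add: coeff_eq_0 flip: coeff_at_zero)
  have cg1: "xy_coeff g 0 1 \<noteq> 0" using degs by (metis coeff_at_zero leading_coeff_0_iff degree_0 zero_neq_one)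
  have fin: "finite {(i, j). xy_coeff P i j \<noteq> 0}" for P
  proof -
    have "{(i, j). xy_coeff P i j \<noteq> 0} \<subseteq> (\<Union>j\<le>degree P. {..degree (coeff P j)} \<times> {j})"
      by (auto simp: xy_coeff_def intro!: le_degree)
    then show ?thesis by (rule finite_subset) auto
  qed
  \<comment> \<open>The weights s at which a monomial of f meets the weight of X^k, or a monomial of g that of Y.\<close>
  define T where "T = (\<lambda>(i, j). (real i - real k) / real j) ` {(i, j). xy_coeff f i j \<noteq> 0 \<and> 0 < j}
      \<union> (\<lambda>(i, j). real i / (real j - 1)) ` {(i, j). xy_coeff g i j \<noteq> 0 \<and> 1 < j}"
  have "T = {}"
  proof (rule ccontr)
    assume "T \<noteq> {}"
    have "finite T" unfolding T_def
      by (intro finite_UnI finite_imageI finite_subset[OF _ fin[of f]] finite_subset[OF _ fin[of g]]) auto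
    define s where "s = Min T"
    have sT: "s \<in> T" and s_le: "\<And>x. x \<in> T \<Longrightarrow> s \<le> x"
      using \<open>finite T\<close> \<open>T \<noteq> {}\<close> by (auto simp: s_def)
    have "0 < s"
    proof -
      have "0 < x" if "x \<in> T" for x
        using that unfolding T_def
      proof (elim UnE imageE, goal_cases)
        case (1 z)
        then obtain i j where ij: "z = (i, j)" "xy_coeff f i j \<noteq> 0" "0 < j" by auto
        then have "k < i" using cf_low cf_k by (metis linorder_neqE_nat)
        then show ?case using 1(1) ij by simp
      next
        case (2 z)
        then obtain i j where ij: "z = (i, j)" "xy_coeff g i j \<noteq> 0" "1 < j" by auto
        then have "0 < i" using cg by (metis gr0I)
        then show ?case using 2(1) ij by simp
      qed
      then show ?thesis using sT by blast
    qed
    have wf: "s * real j \<le> real i - real k" if nz: "xy_coeff f i j \<noteq> 0" for i j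
    proof (cases "j = 0")
      case True
      then show ?thesis using nz cf_low by (cases "i < k") auto
    next
      case False
      then have "(real i - real k) / real j \<in> T" using nz unfolding T_def by force
      from s_le[OF this] show ?thesis using False by (simp add: pos_le_divide_eq)
    qed
    have wg: "s * (real j - 1) \<le> real i" if nz: "xy_coeff g i j \<noteq> 0" for i j
    proof (cases "1 < j")
      case True
      then have "real i / (real j - 1) \<in> T" using nz unfolding T_def by force
      from s_le[OF this] show ?thesis using True by (simp add: pos_le_divide_eq)
    next
      case False
      then have "s * (real j - 1) \<le> 0" using \<open>0 < s\<close> by (simp add: mult_le_0_iff)
      then show ?thesis by (rule order_trans) simp
    qed
    define J1 where "J1 = {j. \<exists>i. xy_coeff f i j \<noteq> 0 \<and> s * real j = real i - real k}"
    define J2 where "J2 = {j. \<exists>i. xy_coeff g i j \<noteq> 0 \<and> s * (real j - 1) = real i}"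
    have "J1 \<subseteq> snd ` {(i, j). xy_coeff f i j \<noteq> 0}" "J2 \<subseteq> snd ` {(i, j). xy_coeff g i j \<noteq> 0}"
      by (force simp: J1_def J2_def)+
    then have finJ: "finite J1" "finite J2"
      using finite_subset[OF _ finite_imageI[OF fin]] by blast+
    have in1: "0 \<in> J1" using cf_k0 by (auto simp: J1_def intro!: exI[of _ k])
    have in2: "1 \<in> J2" using cg1 by (auto simp: J2_def intro!: exI[of _ 0])
    define j1 j2 where "j1 = Max J1" and "j2 = Max J2"
    have j1: "j1 \<in> J1" "\<And>j. j \<in> J1 \<Longrightarrow> j \<le> j1" using Max_in[OF finJ(1)] Max_ge[OF finJ(1)] in1 unfolding j1_def by blast+
    have j2: "j2 \<in> J2" "\<And>j. j \<in> J2 \<Longrightarrow> j \<le> j2" using Max_in[OF finJ(2)] Max_ge[OF finJ(2)] in2 unfolding j2_def by blast+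
    have big: "1 < j1 + j2"
    proof -
      from sT have "(\<exists>j\<in>J1. 0 < j) \<or> (\<exists>j\<in>J2. 1 < j)"
        unfolding T_def
      proof (elim UnE imageE, goal_cases)
        case (1 z)
        then obtain i j where ij: "z = (i, j)" "xy_coeff f i j \<noteq> 0" "0 < j" by auto
        then have "j \<in> J1" using 1(1) by (auto simp: J1_def intro!: exI[of _ i])
        then show ?case using ij by blast
      next
        case (2 z)
        then obtain i j where ij: "z = (i, j)" "xy_coeff g i j \<noteq> 0" "1 < j" by auto
        then have "j \<in> J2" using 2(1) by (auto simp: J2_def intro!: exI[of _ i])
        then show ?case using ij by blast
      qed
      then show ?thesis using j1(2) j2(2) in1 in2 by force
    qed
    obtain i1 where i1: "xy_coeff f i1 j1 \<noteq> 0" "s * real j1 = real i1 - real k" using j1(1) by (auto simp: J1_def)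
    obtain i2 where i2: "xy_coeff g i2 j2 \<noteq> 0" "s * (real j2 - 1) = real i2" using j2(1) by (auto simp: J2_def)
    define a b where "a = i1 + i2" and "b = j1 + j2"
    \<comment> \<open>Euler operators instead of partial derivatives keep the exponents aligned: E is X Y times the
      Jacobian determinant.\<close>
    define E where "E = varX * partialX f * (varY * partialY g) - varY * partialY f * (varX * partialX g)"
    have "E = varX * varY * jac f g" by (simp add: E_def jac_def algebra_simps)
    then have "E = varX ^ Suc e * (varY * [:[:c:]:])" using J by (simp add: algebra_simps)
    moreover have "xy_coeff [:[:c:]:] i (b - 1) = 0" for i
      using big by (simp add: b_def xy_coeff_def coeff_pCons split: nat.split)
    ultimately have E0: "xy_coeff E a b = 0"
      using big by (simp only: xy_coeff_varX_power_mult xy_coeff_varY_mult) (simp add: b_def)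
    define t where "t i j = (of_nat i * of_nat (b - j) - of_nat j * of_nat (a - i)) * (xy_coeff f i j * xy_coeff g (a - i) (b - j))" for i j
    have "xy_coeff E a b = (\<Sum>j\<le>b. \<Sum>i\<le>a. t i j)"
      unfolding E_def xy_coeff_diff xy_coeff_mult[of "varX * partialX f"] xy_coeff_mult[of "varY * partialY f"] xy_coeff_euler t_def
      by (simp add: sum_subtractf[symmetric] algebra_simps)
    also have "\<dots> = (\<Sum>j\<le>b. \<Sum>i\<le>a. if j = j1 then (if i = i1 then t i1 j1 else 0) else 0)"
    proof (intro sum.cong refl, goal_cases)
      case (1 j i)
      show ?case
      proof (cases "xy_coeff f i j \<noteq> 0 \<and> xy_coeff g (a - i) (b - j) \<noteq> 0")
        case True
        have A: "s * real j \<le> real i - real k" using wf True by blast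
        have B: "s * (real (b - j) - 1) \<le> real (a - i)" using wg True by blast
        have bj: "real (b - j) = real j1 + real j2 - real j" "real (a - i) = real i1 + real i2 - real i"
          using 1 by (auto simp: a_def b_def of_nat_diff)
        have eqs: "s * real j = real i - real k" "s * (real (b - j) - 1) = real (a - i)"
          using A B i1(2) i2(2) unfolding bj by (auto simp: algebra_simps)
        have "j \<in> J1" "b - j \<in> J2" using eqs True by (auto simp: J1_def J2_def)
        then have "j \<le> j1" "b - j \<le> j2" using j1(2) j2(2) by auto
        then have "j = j1" by (simp add: b_def)
        moreover have "i = i1" using eqs(1) i1(2) \<open>j = j1\<close> by simp
        ultimately show ?thesis by simp
      next
        case False
        then have "t i j = 0" by (auto simp: t_def)
        then show ?thesis by auto
      qed
    qed
    also have "\<dots> = (\<Sum>j\<le>b. if j = j1 then t i1 j1 else 0)"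
      by (intro sum.cong) (auto simp: a_def)
    also have "\<dots> = t i1 j1" by (simp add: b_def)
    finally have "t i1 j1 = 0" using E0 by simp
    then have "(of_nat i1 * of_nat j2 - of_nat j1 * of_nat i2 :: complex) = 0"
      using i1(1) i2(1) by (simp add: t_def a_def b_def)
    then have "(of_nat (i1 * j2) :: complex) = of_nat (j1 * i2)" by simp
    then have "i1 * j2 = j1 * i2" by (simp only: of_nat_eq_iff)
    then have "real i1 * real j2 = real j1 * real i2" by (metis of_nat_mult)
    then have "(s * real j1 + real k) * real j2 = real j1 * (s * (real j2 - 1))"
      using i1(2) i2(2) by simp
    then have "real k * real j2 + s * real j1 = 0" by (simp add: algebra_simps)
    moreover have "1 \<le> j2" using j2(2)[OF in2] .
    then have "0 < real k * real j2" using k by simp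
    moreover have "0 \<le> s * real j1" using \<open>0 < s\<close> by simp
    ultimately show False by linarith
  qed
  then have "xy_coeff f i j = 0" if "0 < j" for i j using that unfolding T_def by auto
  then have "f = [:coeff f 0:]"
    by (intro bipoly_eqI) (auto simp: xy_coeff_def coeff_pCons split: nat.split)
  moreover have "0 < degree (coeff f 0)"
    using cf_k0 k le_degree[of "coeff f 0" k] by (simp add: xy_coeff_def)
  ultimately show ?thesis by blast
qed

lemma comp_poly_hom: "comm_ring_hom (\<lambda>P. comp_poly P G)"
  unfolding comp_poly_def by (rule comm_ring_hom_subst2[OF comm_ring_hom_const_poly])

interpretation comp: comm_ring_hom "\<lambda>P. comp_poly P G" for G by (rule comp_poly_hom)

lemma comp_poly_simps [simp]:
  "comp_poly [:[:c:]:] G = [:[:c:]:]" "comp_poly varX G = fst G" "comp_poly varY G = snd G"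
  by (simp_all add: comp_poly_def subst2_const subst2_varX subst2_varY one_pCons)

lemma comp_poly_comp_poly:
  "comp_poly (comp_poly P (A, B)) G = comp_poly P (comp_poly A G, comp_poly B G)"
  using subst2_comp_poly[OF comm_ring_hom_const_poly, of P A B G] unfolding comp_poly_def .

lemma chain_rule_comp_poly:
  "partialX (comp_poly H (G1, G2)) = comp_poly (partialX H) (G1, G2) * partialX G1 + comp_poly (partialY H) (G1, G2) * partialX G2"
  "partialY (comp_poly H (G1, G2)) = comp_poly (partialX H) (G1, G2) * partialY G1 + comp_poly (partialY H) (G1, G2) * partialY G2"
  unfolding comp_poly_def
  by (rule chain_rule; simp add: comm_ring_hom_const_poly derivation_partialX derivation_partialY)+

text \<open>
  Cramer's rule for the two partial derivatives of H(G) = X^(g+1) S.  The X-derivative of the right hand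
  side loses one power of X and the Y-derivative none, so after division by X^g only the former
  contributes on X = 0.
\<close>

lemma hamiltonian_identities:
  assumes J: "jac G1 G2 = [:[:c:]:] * varX ^ e"
    and H: "comp_poly H (G1, G2) = varX ^ Suc g * S"
    and S: "at_zero S = [:s:]"
  obtains U V where
    "varX ^ e * ([:[:c:]:] * comp_poly (partialX H) (G1, G2)) = varX ^ g * U"
    "varX ^ e * ([:[:c:]:] * comp_poly (partialY H) (G1, G2)) = varX ^ g * V"
    "at_zero U = Polynomial.smult (of_nat (Suc g) * s) (pderiv (at_zero G2))"
    "at_zero V = - Polynomial.smult (of_nat (Suc g) * s) (pderiv (at_zero G1))"
proof -
  define Hu Hv where "Hu = comp_poly (partialX H) (G1, G2)" and "Hv = comp_poly (partialY H) (G1, G2)"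
  define A B where "A = of_nat (Suc g) * S + varX * partialX S" and "B = varX * partialY S"
  have dX: "partialX (varX ^ Suc g) = of_nat (Suc g) * varX ^ g"
    using partialX.power[of varX "Suc g"] by (simp del: power_Suc of_nat_Suc)
  have dY: "partialY (varX ^ Suc g) = 0"
    using partialY.power[of varX "Suc g"] by (simp del: power_Suc of_nat_Suc)
  have "partialX (varX ^ Suc g * S) = varX ^ g * A"
    unfolding partialX.mult dX A_def by (simp add: algebra_simps del: of_nat_Suc)
  then have eA: "Hu * partialX G1 + Hv * partialX G2 = varX ^ g * A"
    using chain_rule_comp_poly(1)[of H G1 G2] by (simp add: H Hu_def Hv_def)
  have "partialY (varX ^ Suc g * S) = varX ^ g * B"
    unfolding partialY.mult dY B_def by (simp add: algebra_simps)
  then have eB: "Hu * partialY G1 + Hv * partialY G2 = varX ^ g * B"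
    using chain_rule_comp_poly(2)[of H G1 G2] by (simp add: H Hu_def Hv_def)
  have "varX ^ e * ([:[:c:]:] * Hu) = Hu * jac G1 G2" using J by (simp add: ac_simps)
  also have "\<dots> = (Hu * partialX G1 + Hv * partialX G2) * partialY G2
      - (Hu * partialY G1 + Hv * partialY G2) * partialX G2"
    by (simp add: jac_def algebra_simps)
  finally have 1: "varX ^ e * ([:[:c:]:] * Hu) = varX ^ g * (A * partialY G2 - B * partialX G2)"
    unfolding eA eB by (simp add: algebra_simps)
  have "varX ^ e * ([:[:c:]:] * Hv) = Hv * jac G1 G2" using J by (simp add: ac_simps)
  also have "\<dots> = (Hu * partialY G1 + Hv * partialY G2) * partialX G1
      - (Hu * partialX G1 + Hv * partialX G2) * partialY G1"
    by (simp add: jac_def algebra_simps)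
  finally have 2: "varX ^ e * ([:[:c:]:] * Hv) = varX ^ g * (B * partialX G1 - A * partialY G1)"
    unfolding eA eB by (simp add: algebra_simps)
  have "at_zero A = of_nat (Suc g) * [:s:]"
    unfolding A_def at_zero.hom_add at_zero.hom_mult at_zero.hom_of_nat S by simp
  then have A0: "at_zero A = [:of_nat (Suc g) * s:]"
    unfolding of_nat_poly by simp
  have B0: "at_zero B = 0" by (simp add: B_def at_zero.hom_mult)
  show ?thesis
    by (rule that[OF 1[unfolded Hu_def] 2[unfolded Hv_def]])
      (simp_all add: at_zero.hom_minus at_zero.hom_mult A0 B0 at_zero_partialY del: of_nat_Suc)
qed

text \<open>
  When the exponent of the Jacobian determinant is g, the powers of X cancel in the previous identities,
  and at X = 0 they become the Hamiltonian equations of a constant multiple of H.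
\<close>

lemma boundary_is_integral_curve:
  assumes J: "jac G1 G2 = [:[:c:]:] * varX ^ g" and c: "c \<noteq> 0"
    and H: "comp_poly H (G1, G2) = varX ^ Suc g * S" and S: "at_zero S = [:s:]" "s \<noteq> 0"
  shows "\<exists>K. subst2 (\<lambda>c. [:c:]) K (at_zero G1, at_zero G2) = 0
    \<and> pderiv (at_zero G1) = subst2 (\<lambda>c. [:c:]) (partialY K) (at_zero G1, at_zero G2)
    \<and> pderiv (at_zero G2) = - subst2 (\<lambda>c. [:c:]) (partialX K) (at_zero G1, at_zero G2)"
proof -
  interpret C: comm_ring_hom "\<lambda>P. subst2 (\<lambda>c. [:c:]) P (at_zero G1, at_zero G2)" by (rule comm_ring_hom_curve)
  obtain U V where UV:
    "varX ^ g * ([:[:c:]:] * comp_poly (partialX H) (G1, G2)) = varX ^ g * U"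
    "varX ^ g * ([:[:c:]:] * comp_poly (partialY H) (G1, G2)) = varX ^ g * V"
    "at_zero U = Polynomial.smult (of_nat (Suc g) * s) (pderiv (at_zero G2))"
    "at_zero V = - Polynomial.smult (of_nat (Suc g) * s) (pderiv (at_zero G1))"
    using hamiltonian_identities[OF J H S(1)] by blast
  define k where "k = of_nat (Suc g) * s"
  have k: "k \<noteq> 0" using S by (simp add: k_def del: of_nat_Suc)
  have "U = [:[:c:]:] * comp_poly (partialX H) (G1, G2)" "V = [:[:c:]:] * comp_poly (partialY H) (G1, G2)"
    by (metis UV(1) mult_left_cancel power_not_zero varX_nz, metis UV(2) mult_left_cancel power_not_zero varX_nz)
  then have u: "Polynomial.smult c (subst2 (\<lambda>c. [:c:]) (partialX H) (at_zero G1, at_zero G2)) = Polynomial.smult k (pderiv (at_zero G2))"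
    and v: "Polynomial.smult c (subst2 (\<lambda>c. [:c:]) (partialY H) (at_zero G1, at_zero G2)) = - Polynomial.smult k (pderiv (at_zero G1))"
    using UV(3,4) by (simp_all add: at_zero.hom_mult at_zero_comp_poly k_def del: mult_pCons_left) simp_all
  define K where "K = [:[:- c / k:]:] * H"
  have CK: "subst2 (\<lambda>c. [:c:]) ([:[:- c / k:]:] * P) (at_zero G1, at_zero G2)
      = Polynomial.smult (- c / k) (subst2 (\<lambda>c. [:c:]) P (at_zero G1, at_zero G2))" for P
    by (simp add: C.hom_mult subst2_const del: mult_pCons_left) simp
  have pK: "partialX K = [:[:- c / k:]:] * partialX H" "partialY K = [:[:- c / k:]:] * partialY H"
    unfolding K_def partialX.mult partialY.mult by simp_all
  have "at_zero (varX ^ Suc g * S) = 0" by (simp add: at_zero.hom_mult)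
  then have "subst2 (\<lambda>c. [:c:]) H (at_zero G1, at_zero G2) = 0" using H at_zero_comp_poly by metis
  then have 0: "subst2 (\<lambda>c. [:c:]) K (at_zero G1, at_zero G2) = 0" unfolding K_def CK by simp
  have sm: "Polynomial.smult (- c / k) p = Polynomial.smult (- 1 / k) (Polynomial.smult c p)" for p by simp
  have 1: "subst2 (\<lambda>c. [:c:]) (partialY K) (at_zero G1, at_zero G2) = pderiv (at_zero G1)"
    unfolding pK CK sm v using k by simp
  have 2: "subst2 (\<lambda>c. [:c:]) (partialX K) (at_zero G1, at_zero G2) = - pderiv (at_zero G2)"
    unfolding pK CK sm u using k by simp
  show ?thesis using 0 1 2 by (intro exI[of _ K]) simp
qed

lemma jac_swap: "jac g f = - jac f g"
  by (simp add: jac_def)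

lemma jac_shear: "jac f (g - [:[:l:]:] * f ^ k) = jac f g"
  unfolding jac_def partialX.minus partialY.minus partialX.mult partialY.mult partialX.power partialY.power
  by (simp add: algebra_simps del: mult_pCons_left mult_pCons_right)

lemma jac_sub_const: "jac (f - [:[:l:]:]) g = jac f g"
  unfolding jac_def partialX.minus partialY.minus by simp

lemma vertical_component_if_const:
  assumes J: "jac G1 G2 = [:[:c:]:] * varX ^ e" "c \<noteq> 0"
    and "degree (at_zero G1) = 0" "0 < degree (at_zero G2)"
  shows "\<exists>P p. comp_poly P (G1, G2) = [:p:] \<and> 0 < degree p"
proof -
  obtain a where a: "at_zero G1 = [:a:]" using assms(3) by (metis degree_eq_zeroE)
  have "\<exists>p. G1 - [:[:a:]:] = [:p:] \<and> 0 < degree p"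
    by (rule monomial_jac_imp_vertical[OF _ J(2) _ assms(4)])
      (simp_all add: jac_sub_const J a at_zero.hom_minus)
  moreover have "comp_poly (varX - [:[:a:]:]) (G1, G2) = G1 - [:[:a:]:]"
    by (simp add: comp.hom_minus)
  ultimately show ?thesis by metis
qed

text \<open>
  Induction on deg \<phi> + deg \<psi>, where \<phi> and \<psi> are the coordinates on X = 0.  While both are nonconstant,
  a shear of the target removes the leading term of the one of larger degree; the divisibility needed
  for that is the theorem of Abhyankar and Moh.  The polynomial P for the old coordinates is the one for
  the new coordinates composed with the shear.
\<close>

lemma exists_vertical_component:
  assumes "jac G1 G2 = [:[:c:]:] * varX ^ g" "c \<noteq> 0"
    and "comp_poly H (G1, G2) = varX ^ Suc g * S" and S: "at_zero S = [:s:]" "s \<noteq> 0"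
    and "0 < degree (at_zero G1) \<or> 0 < degree (at_zero G2)"
  shows "\<exists>P p. comp_poly P (G1, G2) = [:p:] \<and> 0 < degree p"
  using assms(1-3,6)
proof (induction "degree (at_zero G1) + degree (at_zero G2)" arbitrary: G1 G2 c H rule: less_induct)
  case less
  have swap: "\<exists>P p. comp_poly P (G1, G2) = [:p:] \<and> 0 < degree p"
    if sw: "\<exists>P p. comp_poly P (G2, G1) = [:p:] \<and> 0 < degree p" for G1 G2
  proof -
    obtain P p where "comp_poly P (G2, G1) = [:p:]" "0 < degree p" using sw by blast
    then show ?thesis
      by (intro exI[of _ "comp_poly P (varY, varX)"] exI[of _ p]) (simp add: comp_poly_comp_poly)
  qed
  have step: "\<exists>P p. comp_poly P (F1, F2) = [:p:] \<and> 0 < degree p"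
    if J: "jac F1 F2 = [:[:c:]:] * varX ^ g" and c: "c \<noteq> 0" and H: "comp_poly H (F1, F2) = varX ^ Suc g * S"
      and deg: "0 < degree (at_zero F1)" "degree (at_zero F1) \<le> degree (at_zero F2)"
      and sum: "degree (at_zero F1) + degree (at_zero F2) = degree (at_zero G1) + degree (at_zero G2)"
    for F1 F2 c H
  proof -
    define \<phi> \<psi> where "\<phi> = at_zero F1" and "\<psi> = at_zero F2"
    have "degree \<phi> dvd degree \<psi>"
      using boundary_is_integral_curve[OF J c H S] embedded_line_degrees[of _ \<phi> \<psi>] deg
      unfolding \<phi>_def \<psi>_def by blast
    then obtain k where k: "degree \<psi> = degree \<phi> * k" by blast
    define l where "l = lead_coeff \<psi> / lead_coeff \<phi> ^ k"
    define F where "F = F2 - [:[:l:]:] * F1 ^ k"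
    have nz: "\<phi> \<noteq> 0" "\<psi> \<noteq> 0" using deg by (auto simp: \<phi>_def \<psi>_def)
    have F0: "at_zero F = \<psi> - Polynomial.smult l (\<phi> ^ k)"
      by (simp add: F_def at_zero.hom_minus at_zero.hom_mult at_zero.hom_power \<phi>_def \<psi>_def del: mult_pCons_left) simp
    have "degree (at_zero F) < degree \<psi>"
    proof -
      have "l \<noteq> 0" using nz by (simp add: l_def)
      then have d: "degree (Polynomial.smult l (\<phi> ^ k)) = degree \<psi>"
        using k by (simp add: degree_power_eq nz mult.commute)
      have "lead_coeff (Polynomial.smult l (\<phi> ^ k)) = l * lead_coeff \<phi> ^ k"
        by (simp add: lead_coeff_smult lead_coeff_power)
      then have l: "coeff (Polynomial.smult l (\<phi> ^ k)) (degree \<psi>) = lead_coeff \<psi>"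
        unfolding d using nz by (simp add: l_def)
      have "degree (at_zero F) \<le> degree \<psi>" unfolding F0 using degree_diff_le_max[of \<psi> "Polynomial.smult l (\<phi> ^ k)"] d by simp
      moreover have "coeff (at_zero F) (degree \<psi>) = 0" unfolding F0 coeff_diff l by simp
      moreover have "0 < degree \<psi>" using deg by (simp add: \<psi>_def)
      ultimately show ?thesis
        by (metis degree_0 leading_coeff_0_iff order_le_less)
    qed
    then have less': "degree (at_zero F1) + degree (at_zero F) < degree (at_zero G1) + degree (at_zero G2)"
      using sum by (simp add: \<psi>_def)
    have "comp_poly (comp_poly H (varX, varY + [:[:l:]:] * varX ^ k)) (F1, F) = varX ^ Suc g * S"
      using H by (simp add: comp_poly_comp_poly comp.hom_add comp.hom_mult comp.hom_power F_def del: mult_pCons_left)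
    moreover have "jac F1 F = [:[:c:]:] * varX ^ g" unfolding F_def jac_shear by (rule J)
    ultimately obtain P p where P: "comp_poly P (F1, F) = [:p:]" "0 < degree p"
      using less.hyps[OF less' _ c] deg by blast
    have "comp_poly (comp_poly P (varX, varY - [:[:l:]:] * varX ^ k)) (F1, F2) = [:p:]"
      using P by (simp add: comp_poly_comp_poly comp.hom_minus comp.hom_mult comp.hom_power F_def del: mult_pCons_left)
    then show ?thesis using P(2) by blast
  qed
  have m: "([:[:- c:]:] :: bipoly) = - [:[:c:]:]" by simp
  have J': "jac G2 G1 = [:[:- c:]:] * varX ^ g" "- c \<noteq> 0"
    unfolding jac_swap[of G2 G1] less.prems(1) m minus_mult_left using less.prems(2) by simp_all
  have H': "comp_poly (comp_poly H (varY, varX)) (G2, G1) = varX ^ Suc g * S"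
    using less.prems(3) by (simp add: comp_poly_comp_poly)
  consider "degree (at_zero G1) = 0" | "degree (at_zero G2) = 0"
    | "0 < degree (at_zero G1)" "degree (at_zero G1) \<le> degree (at_zero G2)"
    | "0 < degree (at_zero G2)" "degree (at_zero G2) \<le> degree (at_zero G1)" by linarith
  then show ?case
  proof cases
    case 1
    then show ?thesis using vertical_component_if_const[OF less.prems(1,2)] less.prems(4) by simp
  next
    case 2
    then show ?thesis using vertical_component_if_const[OF J'] less.prems(4) swap[of G2 G1] by simp
  next
    case 3
    then show ?thesis using step[OF less.prems(1-3)] by simp
  next
    case 4
    then show ?thesis using step[OF J' H'] swap[of G2 G1] by (simp add: add.commute)
  qed
qed

section \<open>Values of rational maps\<close>

lemma comm_ring_hom_eval_poly: "comm_ring_hom (\<lambda>P. Defs.eval_poly P z)"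
  unfolding Defs.eval_poly_def by (rule comm_ring_hom_subst2) (unfold_locales, auto)

interpretation eval: comm_ring_hom "\<lambda>P. Defs.eval_poly P z" for z by (rule comm_ring_hom_eval_poly)

lemma eval_poly_simps [simp]:
  "Defs.eval_poly [:[:c:]:] z = c" "Defs.eval_poly varX z = fst z" "Defs.eval_poly varY z = snd z"
  by (simp_all add: Defs.eval_poly_def subst2_const subst2_varX subst2_varY)

lemma map_poly_id: "map_poly (\<lambda>c. c) p = p"
  by (rule poly_eqI) (simp add: coeff_map_poly)

lemma eval_poly_eq: "Defs.eval_poly P z = poly (map_poly (\<lambda>c. poly c (fst z)) P) (snd z)"
  by (simp add: Defs.eval_poly_def subst2_def map_poly_id)

lemma eval_poly_of_X: "Defs.eval_poly [:p:] z = poly p (fst z)"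
  by (cases "p = 0") (simp_all add: eval_poly_eq map_poly_pCons)

lemma eval_poly_zero: "Defs.eval_poly P (0, y) = poly (at_zero P) y"
  by (simp add: eval_poly_eq at_zero_def)

lemma eval_comp_poly: "Defs.eval_poly (comp_poly P G) z = Defs.eval_poly P (eval_map G z)"
proof -
  have "comm_ring_hom (\<lambda>c :: complex. c)" by unfold_locales auto
  from subst2_comp_poly[OF this, of P "fst G" "snd G" z] show ?thesis
    by (simp add: Defs.eval_poly_def eval_map_def)
qed

lemma bipoly_eq_0I:
  assumes "\<And>x y. x \<noteq> 0 \<Longrightarrow> Defs.eval_poly P (x, y) = 0"
  shows "P = 0"
proof (rule poly_eqI)
  fix j
  have "poly (coeff P j) x = 0" if "x \<noteq> 0" for x
  proof -
    have "map_poly (\<lambda>c. poly c x) P = 0"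
      using assms[OF that] by (subst poly_eq_poly_eq_iff[symmetric]) (simp add: eval_poly_eq fun_eq_iff)
    then have "coeff (map_poly (\<lambda>c. poly c x) P) j = 0" by simp
    then show ?thesis by (simp add: coeff_map_poly)
  qed
  then have "- {0} \<subseteq> {x. poly (coeff P j) x = 0}" by auto
  moreover have "infinite (- {0 :: complex})"
    by (simp add: infinite_UNIV_char_0 Compl_eq_Diff_UNIV)
  ultimately have "infinite {x. poly (coeff P j) x = 0}" by (meson finite_subset)
  then show "coeff P j = coeff 0 j" using poly_roots_finite by force
qed

text \<open>
  The value at z of a rational function with some representation whose denominator does not vanish at z;
  a relation, because the representation need not be reduced.
\<close>

definition has_value :: "complex \<times> complex \<Rightarrow> bipoly fract \<Rightarrow> complex \<Rightarrow> bool" where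
  "has_value z U u \<longleftrightarrow> (\<exists>a b. U * to_fract b = to_fract a \<and> Defs.eval_poly b z \<noteq> 0 \<and> u * Defs.eval_poly b z = Defs.eval_poly a z)"

lemma has_value_to_fract: "has_value z (to_fract p) (Defs.eval_poly p z)"
  unfolding has_value_def by (intro exI[of _ p] exI[of _ 1]) simp

lemma has_value_const: "has_value z (const_fract c) c"
  using has_value_to_fract[of z "[:[:c:]:]"] by (simp add: const_fract_def)

lemma has_value_add:
  assumes "has_value z U u" "has_value z V v"
  shows "has_value z (U + V) (u + v)"
proof -
  obtain a b where 1: "U * to_fract b = to_fract a" "Defs.eval_poly b z \<noteq> 0" "u * Defs.eval_poly b z = Defs.eval_poly a z"
    using assms(1) by (auto simp: has_value_def)
  obtain a' b' where 2: "V * to_fract b' = to_fract a'" "Defs.eval_poly b' z \<noteq> 0" "v * Defs.eval_poly b' z = Defs.eval_poly a' z"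
    using assms(2) by (auto simp: has_value_def)
  have "(U + V) * to_fract (b * b') = U * to_fract b * to_fract b' + V * to_fract b' * to_fract b"
    by (simp add: to_fract_mult algebra_simps)
  then have "(U + V) * to_fract (b * b') = to_fract (a * b' + a' * b)"
    unfolding 1 2 by (simp add: to_fract_mult to_fract_add)
  moreover have "(u + v) * Defs.eval_poly (b * b') z = Defs.eval_poly (a * b' + a' * b) z"
    by (simp add: eval.hom_mult eval.hom_add 1(3)[symmetric] 2(3)[symmetric] algebra_simps)
  moreover have "Defs.eval_poly (b * b') z \<noteq> 0" using 1 2 by (simp add: eval.hom_mult)
  ultimately show ?thesis unfolding has_value_def by blast
qed

lemma has_value_mult:
  assumes "has_value z U u" "has_value z V v"
  shows "has_value z (U * V) (u * v)"
proof -
  obtain a b where 1: "U * to_fract b = to_fract a" "Defs.eval_poly b z \<noteq> 0" "u * Defs.eval_poly b z = Defs.eval_poly a z"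
    using assms(1) by (auto simp: has_value_def)
  obtain a' b' where 2: "V * to_fract b' = to_fract a'" "Defs.eval_poly b' z \<noteq> 0" "v * Defs.eval_poly b' z = Defs.eval_poly a' z"
    using assms(2) by (auto simp: has_value_def)
  have "(U * V) * to_fract (b * b') = (U * to_fract b) * (V * to_fract b')"
    by (simp add: to_fract_mult ac_simps)
  then have "(U * V) * to_fract (b * b') = to_fract (a * a')"
    unfolding 1 2 by (simp add: to_fract_mult)
  moreover have "(u * v) * Defs.eval_poly (b * b') z = Defs.eval_poly (a * a') z"
    by (simp add: eval.hom_mult 1(3)[symmetric] 2(3)[symmetric] ac_simps)
  moreover have "Defs.eval_poly (b * b') z \<noteq> 0" using 1 2 by (simp add: eval.hom_mult)
  ultimately show ?thesis unfolding has_value_def by blast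
qed

lemma has_value_inverse:
  assumes "has_value z U u" "u \<noteq> 0"
  shows "has_value z (inverse U) (inverse u)"
proof -
  obtain a b where 1: "U * to_fract b = to_fract a" "Defs.eval_poly b z \<noteq> 0" "u * Defs.eval_poly b z = Defs.eval_poly a z"
    using assms(1) by (auto simp: has_value_def)
  have az: "Defs.eval_poly a z \<noteq> 0" using 1 assms(2) by (metis mult_eq_0_iff)
  then have "U \<noteq> 0" using 1(1) by auto
  then have "inverse U * to_fract a = to_fract b" using 1(1)[symmetric] by simp
  moreover have "inverse u * Defs.eval_poly a z = Defs.eval_poly b z" using 1(3)[symmetric] assms(2) by simp
  ultimately show ?thesis unfolding has_value_def using az by blast
qed

lemma has_value_power: "has_value z U u \<Longrightarrow> has_value z (U ^ k) (u ^ k)"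
  using has_value_const[of z 1]
  by (induction k) (auto simp: const_fract_def one_pCons[symmetric] intro: has_value_mult)

lemma has_value_to_fract_unique: "has_value z (to_fract p) u \<Longrightarrow> u = Defs.eval_poly p z"
proof -
  assume "has_value z (to_fract p) u"
  then obtain a b where 1: "to_fract p * to_fract b = to_fract a" "Defs.eval_poly b z \<noteq> 0" "u * Defs.eval_poly b z = Defs.eval_poly a z"
    by (auto simp: has_value_def)
  then have "p * b = a" by (metis to_fract_eq_iff to_fract_mult)
  then have "Defs.eval_poly a z = Defs.eval_poly p z * Defs.eval_poly b z" by (metis eval.hom_mult)
  then have "u * Defs.eval_poly b z = Defs.eval_poly p z * Defs.eval_poly b z" using 1(3) by simp
  then show ?thesis using 1(2) by simp
qed

lemma comm_ring_hom_const_fract: "comm_ring_hom const_fract"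
  by unfold_locales (auto simp: const_fract_def one_pCons[symmetric] simp flip: to_fract_add to_fract_mult)

lemma has_value_subst2:
  assumes "has_value z U u" "has_value z V v"
  shows "has_value z (subst2 const_fract P (U, V)) (Defs.eval_poly P (u, v))"
proof -
  interpret c: comm_ring_hom const_fract by (rule comm_ring_hom_const_fract)
  interpret s: comm_ring_hom "\<lambda>P. subst2 const_fract P (U, V)"
    by (rule comm_ring_hom_subst2[OF comm_ring_hom_const_fract])
  show ?thesis
    by (induction P rule: bipoly_induct)
      (simp_all add: subst2_const subst2_varX subst2_varY has_value_const assms s.hom_add s.hom_mult
        eval.hom_add eval.hom_mult has_value_add has_value_mult)
qed

abbreviation entry :: "complex^2^2 \<Rightarrow> 2 \<Rightarrow> 2 \<Rightarrow> complex" where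
  "entry L i j \<equiv> vec_nth (vec_nth L i) j"

text \<open>
  The value of the basis map at a point with x \<noteq> 0.
\<close>

definition basis_point :: "complex^2^2 \<Rightarrow> nat \<Rightarrow> nat \<Rightarrow> complex poly \<Rightarrow> complex \<Rightarrow> complex \<Rightarrow> complex \<times> complex" where
  "basis_point L \<alpha> \<beta> \<Phi> x y =
     (let u = inverse (x ^ \<alpha>); v = x ^ \<beta> * y + inverse (x ^ \<alpha>) * poly \<Phi> x
      in (entry L 1 1 * u + entry L 1 2 * v, entry L 2 1 * u + entry L 2 2 * v))"

text \<open>
  Off X = 0 the identity G = F(R) of rational functions is an identity of values.
\<close>

lemma eval_dual:
  assumes dual: "is_dual F (basis_map L \<alpha> \<beta> \<Phi>) G" and x: "x \<noteq> 0"
  shows "eval_map G (x, y) = eval_map F (basis_point L \<alpha> \<beta> \<Phi> x y)"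
proof -
  let ?z = "(x, y)"
  define U where "U = inverse (to_fract varX ^ \<alpha>)"
  define V where "V = to_fract varX ^ \<beta> * to_fract varY + U * to_fract [:\<Phi>:]"
  define u where "u = inverse (x ^ \<alpha>)"
  define v where "v = x ^ \<beta> * y + u * poly \<Phi> x"
  have X: "has_value ?z (to_fract varX) x" and Y: "has_value ?z (to_fract varY) y"
    using has_value_to_fract[of ?z varX] has_value_to_fract[of ?z varY] by simp_all
  have Ph: "has_value ?z (to_fract [:\<Phi>:]) (poly \<Phi> x)"
    using has_value_to_fract[of ?z "[:\<Phi>:]"] by (simp add: eval_poly_of_X)
  have U: "has_value ?z U u" unfolding U_def u_def
    by (intro has_value_inverse has_value_power X) (use x in simp)
  have V: "has_value ?z V v" unfolding V_def v_def
    by (intro has_value_add has_value_mult has_value_power X Y U Ph)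
  define R1 R2 where "R1 = const_fract (entry L 1 1) * U + const_fract (entry L 1 2) * V"
    and "R2 = const_fract (entry L 2 1) * U + const_fract (entry L 2 2) * V"
  define r1 r2 where "r1 = entry L 1 1 * u + entry L 1 2 * v" and "r2 = entry L 2 1 * u + entry L 2 2 * v"
  have R: "has_value ?z R1 r1" "has_value ?z R2 r2"
    unfolding R1_def R2_def r1_def r2_def
    by (intro has_value_add has_value_mult has_value_const U V)+
  have B: "basis_map L \<alpha> \<beta> \<Phi> = (R1, R2)"
    by (simp add: basis_map_def R1_def R2_def U_def V_def Let_def)
  have b: "basis_point L \<alpha> \<beta> \<Phi> x y = (r1, r2)"
    by (simp add: basis_point_def r1_def r2_def u_def v_def Let_def)
  have "subst2 const_fract (fst F) (R1, R2) = to_fract (fst G)" "subst2 const_fract (snd F) (R1, R2) = to_fract (snd G)"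
    using dual unfolding is_dual_def B comp_rat_def rat_of_polymap_def by simp_all
  then have "Defs.eval_poly (fst F) (r1, r2) = Defs.eval_poly (fst G) ?z" "Defs.eval_poly (snd F) (r1, r2) = Defs.eval_poly (snd G) ?z"
    using has_value_subst2[OF R] has_value_to_fract_unique by metis+
  then show ?thesis unfolding b by (simp add: eval_map_def)
qed

lemma dual_eqI:
  assumes "is_dual F R G" shows "dual F R = G"
  unfolding dual_def
  by (rule the_equality) (use assms in \<open>auto simp: is_dual_def rat_of_polymap_def prod_eq_iff\<close>)

lemma has_field_derivative_eval_poly:
  assumes "(a has_field_derivative a') (at t)" "(b has_field_derivative b') (at t)"
  shows "((\<lambda>t. Defs.eval_poly P (a t, b t)) has_field_derivative
     Defs.eval_poly (partialX P) (a t, b t) * a' + Defs.eval_poly (partialY P) (a t, b t) * b') (at t)"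
proof (induction P rule: bipoly_induct)
  case (add p q)
  from DERIV_add[OF add] show ?case
    by (simp add: eval.hom_add partialX.add partialY.add algebra_simps)
next
  case (mult p q)
  from DERIV_mult[OF mult] show ?case
    by (simp add: eval.hom_add eval.hom_mult partialX.mult partialY.mult algebra_simps)
qed (use assms in simp_all)

section \<open>The phantom curve meets the singular line\<close>

lemma keller_jac: "keller F \<Longrightarrow> \<exists>c. c \<noteq> 0 \<and> jac (fst F) (snd F) = [:[:c:]:]"
  by (auto simp: keller_def jac_def jacobian_matrix_def det_2 vector_2)

text \<open>
  At points with x \<noteq> 0 the chain rule for G = F(R) gives the product of the determinants of F, of L and
  of (x^(-\<alpha>), x^\<beta> y + x^(-\<alpha>) \<Phi>(x)); the last one is -\<alpha> x^(\<beta>-\<alpha>-1), because the first entry does not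
  involve y.  As the left hand side is a polynomial, \<beta> \<ge> \<alpha> + 1.
\<close>

lemma jac_dual:
  assumes kel: "keller F" and L: "invertible L" and \<alpha>: "0 < \<alpha>"
    and dual: "is_dual F (basis_map L \<alpha> \<beta> \<Phi>) G"
  shows "\<exists>k e. k \<noteq> 0 \<and> jac (fst G) (snd G) = [:[:k:]:] * varX ^ e"
proof -
  obtain c where c: "c \<noteq> 0" "jac (fst F) (snd F) = [:[:c:]:]" using keller_jac[OF kel] by blast
  define \<Delta> where "\<Delta> = entry L 1 1 * entry L 2 2 - entry L 1 2 * entry L 2 1"
  have "\<Delta> \<noteq> 0" using L by (simp add: invertible_det_nz det_2 \<Delta>_def)
  define k where "k = - c * \<Delta> * of_nat \<alpha>"
  have k: "k \<noteq> 0" using c \<open>\<Delta> \<noteq> 0\<close> \<alpha> by (simp add: k_def)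
  have main: "x ^ Suc \<alpha> * Defs.eval_poly (jac (fst G) (snd G)) (x, y) = k * x ^ \<beta>" if x: "x \<noteq> 0" for x y
  proof -
    define u where "u x = inverse (x ^ \<alpha>)" for x :: complex
    define v where "v x y = x ^ \<beta> * y + u x * poly \<Phi> x" for x y
    define r1 r2 where "r1 x y = entry L 1 1 * u x + entry L 1 2 * v x y"
      and "r2 x y = entry L 2 1 * u x + entry L 2 2 * v x y" for x y
    have G: "Defs.eval_poly (fst G) (x, y) = Defs.eval_poly (fst F) (r1 x y, r2 x y)"
      "Defs.eval_poly (snd G) (x, y) = Defs.eval_poly (snd F) (r1 x y, r2 x y)" if "x \<noteq> 0" for x y
      using eval_dual[OF dual that, of y]
      by (simp_all add: eval_map_def basis_point_def Let_def r1_def r2_def u_def v_def)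
    define u' where "u' = - (inverse (x ^ \<alpha>) * (of_nat \<alpha> * x ^ (\<alpha> - 1)) * inverse (x ^ \<alpha>))"
    have pw: "((\<lambda>x. x ^ k) has_field_derivative of_nat k * x ^ (k - 1)) (at x)" for k
      using DERIV_power[OF DERIV_ident, of k x] by simp
    have du: "(u has_field_derivative u') (at x)"
      unfolding u_def[abs_def] u'_def by (rule DERIV_inverse'[OF pw]) (use x in simp)
    have u'x: "x ^ Suc \<alpha> * u' = - of_nat \<alpha>"
    proof -
      have "x ^ \<alpha> = x * x ^ (\<alpha> - 1)" using \<alpha> by (metis power_eq_if not_gr_zero)
      then show ?thesis using x by (simp add: u'_def field_simps)
    qed
    obtain v' where dv: "((\<lambda>x. v x y) has_field_derivative v') (at x)"
    proof -
      have "((\<lambda>x. x ^ \<beta> * y) has_field_derivative (of_nat \<beta> * x ^ (\<beta> - 1)) * y) (at x)"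
        by (rule DERIV_cmult_right[OF pw])
      from DERIV_add[OF this DERIV_mult[OF du poly_DERIV[of \<Phi> x]]]
      show ?thesis using that unfolding v_def by blast
    qed
    define r1x r2x where "r1x = entry L 1 1 * u' + entry L 1 2 * v'" and "r2x = entry L 2 1 * u' + entry L 2 2 * v'"
    have dx: "((\<lambda>x. r1 x y) has_field_derivative r1x) (at x)" "((\<lambda>x. r2 x y) has_field_derivative r2x) (at x)"
      unfolding r1_def r2_def r1x_def r2x_def by (intro DERIV_add DERIV_cmult du dv)+
    have dvy: "(v x has_field_derivative x ^ \<beta>) (at y)"
    proof -
      have "((\<lambda>y. x ^ \<beta> * y + u x * poly \<Phi> x) has_field_derivative x ^ \<beta> * 1 + 0) (at y)"
        by (intro DERIV_add DERIV_cmult DERIV_const DERIV_ident)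
      then show ?thesis unfolding v_def[abs_def] by simp
    qed
    have dy: "(r1 x has_field_derivative (0 + entry L 1 2 * x ^ \<beta>)) (at y)" "(r2 x has_field_derivative (0 + entry L 2 2 * x ^ \<beta>)) (at y)"
      unfolding r1_def[abs_def] r2_def[abs_def] by (intro DERIV_add DERIV_cmult DERIV_const dvy)+
    let ?z = "(x, y)" and ?w = "(r1 x y, r2 x y)"
    have GX: "Defs.eval_poly (partialX P) ?z = Defs.eval_poly (partialX Q) ?w * r1x + Defs.eval_poly (partialY Q) ?w * r2x"
      if PQ: "\<And>x y. x \<noteq> 0 \<Longrightarrow> Defs.eval_poly P (x, y) = Defs.eval_poly Q (r1 x y, r2 x y)" for P Q
    proof (rule DERIV_unique)
      show "((\<lambda>t. Defs.eval_poly P (t, y)) has_field_derivative Defs.eval_poly (partialX P) ?z) (at x)"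
        using has_field_derivative_eval_poly[OF DERIV_ident DERIV_const, of P y x] by simp
      show "((\<lambda>t. Defs.eval_poly P (t, y)) has_field_derivative
          Defs.eval_poly (partialX Q) ?w * r1x + Defs.eval_poly (partialY Q) ?w * r2x) (at x)"
        by (rule has_field_derivative_transform_within_open[OF has_field_derivative_eval_poly[OF dx], of "- {0}"])
          (use x PQ in auto)
    qed
    have GY: "Defs.eval_poly (partialY P) ?z = Defs.eval_poly (partialX Q) ?w * (entry L 1 2 * x ^ \<beta>) + Defs.eval_poly (partialY Q) ?w * (entry L 2 2 * x ^ \<beta>)"
      if PQ: "\<And>x y. x \<noteq> 0 \<Longrightarrow> Defs.eval_poly P (x, y) = Defs.eval_poly Q (r1 x y, r2 x y)" for P Q
    proof (rule DERIV_unique)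
      show "((\<lambda>t. Defs.eval_poly P (x, t)) has_field_derivative Defs.eval_poly (partialY P) ?z) (at y)"
        using has_field_derivative_eval_poly[OF DERIV_const DERIV_ident, of P x y] by simp
      show "((\<lambda>t. Defs.eval_poly P (x, t)) has_field_derivative
          Defs.eval_poly (partialX Q) ?w * (entry L 1 2 * x ^ \<beta>) + Defs.eval_poly (partialY Q) ?w * (entry L 2 2 * x ^ \<beta>)) (at y)"
        using has_field_derivative_eval_poly[OF dy, of Q] by (simp add: PQ[OF x])
    qed
    have cF: "Defs.eval_poly (partialX (fst F)) ?w * Defs.eval_poly (partialY (snd F)) ?w
       - Defs.eval_poly (partialY (fst F)) ?w * Defs.eval_poly (partialX (snd F)) ?w = c"
      using arg_cong[OF c(2), of "\<lambda>P. Defs.eval_poly P ?w"] by (simp add: jac_def eval.hom_minus eval.hom_mult)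
    have det: "r1x * (entry L 2 2 * x ^ \<beta>) - r2x * (entry L 1 2 * x ^ \<beta>) = \<Delta> * u' * x ^ \<beta>"
      by (simp add: r1x_def r2x_def \<Delta>_def algebra_simps)
    define p q p' q' where "p = Defs.eval_poly (partialX (fst F)) ?w" and "q = Defs.eval_poly (partialY (fst F)) ?w"
      and "p' = Defs.eval_poly (partialX (snd F)) ?w" and "q' = Defs.eval_poly (partialY (snd F)) ?w"
    have "Defs.eval_poly (partialX (fst G)) ?z = p * r1x + q * r2x"
      "Defs.eval_poly (partialX (snd G)) ?z = p' * r1x + q' * r2x"
      unfolding p_def q_def p'_def q'_def by (rule GX, rule G, assumption)+
    moreover have "Defs.eval_poly (partialY (fst G)) ?z = p * (entry L 1 2 * x ^ \<beta>) + q * (entry L 2 2 * x ^ \<beta>)"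
      "Defs.eval_poly (partialY (snd G)) ?z = p' * (entry L 1 2 * x ^ \<beta>) + q' * (entry L 2 2 * x ^ \<beta>)"
      unfolding p_def q_def p'_def q'_def by (rule GY, rule G, assumption)+
    ultimately have "Defs.eval_poly (jac (fst G) (snd G)) ?z =
      (p * q' - q * p') * (r1x * (entry L 2 2 * x ^ \<beta>) - r2x * (entry L 1 2 * x ^ \<beta>))"
      by (simp add: jac_def eval.hom_minus eval.hom_mult algebra_simps)
    moreover have "p * q' - q * p' = c" using cF by (simp only: p_def q_def p'_def q'_def)
    ultimately have "Defs.eval_poly (jac (fst G) (snd G)) ?z = c * (\<Delta> * u' * x ^ \<beta>)"
      by (simp only: det)
    then have "x ^ Suc \<alpha> * Defs.eval_poly (jac (fst G) (snd G)) ?z = c * \<Delta> * x ^ \<beta> * (x ^ Suc \<alpha> * u')"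
      by (simp only: mult_ac)
    then show ?thesis unfolding u'x by (simp add: k_def)
  qed
  have "varX ^ Suc \<alpha> * jac (fst G) (snd G) - varX ^ \<beta> * [:[:k:]:] = 0"
    by (rule bipoly_eq_0I)
      (use main in \<open>simp add: eval.hom_minus eval.hom_mult eval.hom_power mult.commute del: power_Suc mult_pCons_left mult_pCons_right\<close>)
  then have eq: "varX ^ Suc \<alpha> * jac (fst G) (snd G) = varX ^ \<beta> * [:[:k:]:]" by simp
  have "Suc \<alpha> \<le> \<beta>" by (rule varX_power_compare[OF eq[symmetric]]) (use k in simp)
  then have "varX ^ \<beta> = varX ^ Suc \<alpha> * varX ^ (\<beta> - Suc \<alpha>)" by (metis le_add_diff_inverse power_add)
  then have "varX ^ Suc \<alpha> * jac (fst G) (snd G) = varX ^ Suc \<alpha> * ([:[:k:]:] * varX ^ (\<beta> - Suc \<alpha>))"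
    using eq by (simp only: mult_ac)
  then have "jac (fst G) (snd G) = [:[:k:]:] * varX ^ (\<beta> - Suc \<alpha>)"
    by (metis mult_left_cancel power_not_zero varX_nz)
  then show ?thesis using k by blast
qed

text \<open>
  Over an algebraically closed field the zero set of a nonconstant polynomial in two variables is
  infinite; two points suffice to exclude that the R-component is a point.
\<close>

lemma irreducible_zero_set:
  assumes "irreducible H"
  shows "\<not> zero_set H \<subseteq> {w}"
proof -
  have H: "H \<noteq> 0" "\<not> is_unit H" using assms by (auto simp: irreducible_def)
  have "\<exists>z z'. z \<in> zero_set H \<and> z' \<in> zero_set H \<and> z \<noteq> z'"
  proof (cases "degree H = 0")
    case True
    then obtain h where h: "H = [:h:]" by (metis degree_eq_zeroE)
    have "degree h \<noteq> 0"
    proof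
      assume "degree h = 0"
      then obtain c where "h = [:c:]" by (metis degree_eq_zeroE)
      then have "H * [:[:inverse c:]:] = 1" using h H(1) by (simp add: one_pCons)
      then show False using H(2) by (metis dvd_triv_left)
    qed
    then obtain x where "poly h x = 0" using fundamental_theorem_of_algebra[of h] by (auto simp: constant_degree)
    then show ?thesis unfolding zero_set_def h
      by (intro exI[of _ "(x, 0)"] exI[of _ "(x, 1)"]) (simp add: eval_poly_of_X)
  next
    case False
    define l where "l = lead_coeff H"
    have "l \<noteq> 0" using H by (simp add: l_def)
    then have inf: "infinite (- {x. poly l x = 0})"
      using poly_roots_finite infinite_UNIV_char_0 by (metis finite_compl)
    have ex: "\<exists>y. (x, y) \<in> zero_set H" if "x \<in> - {x. poly l x = 0}" for x
    proof -
      have "coeff (map_poly (\<lambda>c. poly c x) H) (degree H) \<noteq> 0" using that by (simp add: coeff_map_poly l_def)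
      then have "degree (map_poly (\<lambda>c. poly c x) H) \<noteq> 0" using False by (metis le_degree le_zero_eq)
      then obtain y where "poly (map_poly (\<lambda>c. poly c x) H) y = 0"
        using fundamental_theorem_of_algebra by (metis constant_degree)
      then show ?thesis by (auto simp: zero_set_def eval_poly_eq)
    qed
    obtain x1 where x1: "x1 \<in> - {x. poly l x = 0}" using inf by (metis ex_in_conv finite.emptyI)
    obtain x2 where x2: "x2 \<in> - {x. poly l x = 0}" "x2 \<noteq> x1"
      using inf infinite_remove[of "- {x. poly l x = 0}" x1] by (metis DiffE ex_in_conv finite.emptyI singletonI)
    show ?thesis using ex[OF x1] ex[OF x2(1)] x2(2) by blast
  qed
  then show ?thesis by blast
qed

lemma curve_const_coeff:
  "subst2 (\<lambda>c. [:c:]) [:h:] (\<phi>, \<psi>) = pcompose h \<phi>"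
  by (cases "h = 0") (simp_all add: subst2_def map_poly_pCons pcompose_altdef)

text \<open>
  If \<phi> is not constant, a relation B of least degree in v divides every relation up to a factor in
  C[u]; being prime, H divides B, so H has least degree as well and its v-derivative is not a relation.
  If \<phi> is a constant a, then H is a multiple of u - a.
\<close>

lemma irreducible_relation_smooth:
  fixes \<phi> \<psi> :: "complex poly"
  assumes irr: "irreducible H" and H: "subst2 (\<lambda>c. [:c:]) H (\<phi>, \<psi>) = 0"
    and nonconst: "0 < degree \<phi> \<or> 0 < degree \<psi>"
  shows "subst2 (\<lambda>c. [:c:]) (partialX H) (\<phi>, \<psi>) \<noteq> 0 \<or> subst2 (\<lambda>c. [:c:]) (partialY H) (\<phi>, \<psi>) \<noteq> 0"
proof (cases "0 < degree \<phi>")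
  case True
  interpret C: comm_ring_hom "\<lambda>P. subst2 (\<lambda>c. [:c:]) P (\<phi>, \<psi>)" by (rule comm_ring_hom_curve)
  have H0: "H \<noteq> 0" using irr by auto
  have const: "h = 0" if "subst2 (\<lambda>c. [:c:]) [:h:] (\<phi>, \<psi>) = 0" for h
    using that pcompose_eq_0[of h \<phi>] True by (simp add: curve_const_coeff)
  define rel where "rel B \<longleftrightarrow> B \<noteq> 0 \<and> subst2 (\<lambda>c. [:c:]) B (\<phi>, \<psi>) = 0" for B
  have "rel H" using H H0 by (simp add: rel_def)
  then obtain B where B: "rel B" and least: "\<And>P. rel P \<Longrightarrow> degree B \<le> degree P"
    by (metis ex_has_least_nat)
  have BnZ: "B \<noteq> 0" using B by (simp add: rel_def)
  define l Q R where "l = coeff B (degree B) ^ (Suc (degree H) - degree B)"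
    and "Q = fst (pseudo_divmod H B)" and "R = snd (pseudo_divmod H B)"
  have lH: "Polynomial.smult l H = B * Q + R" and R: "R = 0 \<or> degree R < degree B"
    using pseudo_divmod[OF BnZ, of H Q R] by (simp_all add: l_def Q_def R_def)
  have l0: "l \<noteq> 0" using BnZ by (simp add: l_def)
  have "[:l:] * H = B * Q + R" using lH by simp
  then have "subst2 (\<lambda>c. [:c:]) ([:l:] * H) (\<phi>, \<psi>) = subst2 (\<lambda>c. [:c:]) (B * Q + R) (\<phi>, \<psi>)" by (rule arg_cong)
  then have "subst2 (\<lambda>c. [:c:]) R (\<phi>, \<psi>) = 0"
    unfolding C.hom_add C.hom_mult using H B by (simp add: rel_def)
  then have relR: "rel R" if "R \<noteq> 0" using that by (simp add: rel_def)
  have "R = 0"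
  proof (rule ccontr)
    assume "R \<noteq> 0"
    then show False using R least[OF relR] by simp
  qed
  then have lHB: "[:l:] * H = B * Q" using lH by simp
  have "prime_elem H" using irr by (rule irreducible_imp_prime_elem)
  moreover have "H dvd B * Q" by (metis lHB dvd_triv_right)
  ultimately have "H dvd B \<or> H dvd Q" by (metis prime_elem_dvd_mult_iff)
  moreover have "\<not> H dvd Q"
  proof
    assume "H dvd Q"
    then obtain Q' where "Q = H * Q'" by blast
    then have "H * [:l:] = H * (B * Q')" using lHB by (simp only: mult_ac)
    then have "[:l:] = B * Q'" by (rule iffD1[OF mult_left_cancel[OF H0]])
    then have "degree B = 0"
      using l0 BnZ by (metis add_is_0 degree_mult_eq degree_pCons_0 mult_zero_right pCons_eq_0_iff)
    then obtain b where "B = [:b:]" by (metis degree_eq_zeroE)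
    then show False using B const by (auto simp: rel_def)
  qed
  ultimately have "degree H \<le> degree B" using BnZ by (blast intro: dvd_imp_degree_le)
  then have leastH: "degree H \<le> degree P" if "rel P" for P using least[OF that] by simp
  have "0 < degree H"
  proof (rule ccontr)
    assume "\<not> ?thesis"
    then obtain h where "H = [:h:]" by (metis degree_eq_zeroE gr0I)
    then show False using H const H0 by auto
  qed
  then have "pderiv H \<noteq> 0" "degree (pderiv H) < degree H"
    by (auto simp: pderiv_eq_0_iff degree_pderiv)
  then have "\<not> rel (pderiv H)" using leastH by force
  then show ?thesis using \<open>pderiv H \<noteq> 0\<close> by (simp add: rel_def partialY_def)
next
  case False
  then obtain a where a: "\<phi> = [:a:]" by (metis degree_eq_zeroE gr0I)
  have d\<psi>: "0 < degree \<psi>" using nonconst False by simp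
  define p where "p = map_poly (\<lambda>c. poly c a) H"
  have "subst2 (\<lambda>c. [:c:]) H (\<phi>, \<psi>) = pcompose p \<psi>"
  proof -
    have "poly (map_poly (\<lambda>x. [:x:]) c) [:a:] = [:poly c a:]" for c :: "complex poly"
      by (induction c) (auto simp: map_poly_pCons)
    then have "subst2 (\<lambda>c. [:c:]) H (\<phi>, \<psi>) = poly (map_poly (\<lambda>c. [:poly c a:]) H) \<psi>"
      by (simp add: subst2_def a)
    also have "map_poly (\<lambda>c. [:poly c a:]) H = map_poly (\<lambda>x. [:x:]) p"
      by (rule poly_eqI) (simp add: p_def coeff_map_poly)
    finally show ?thesis by (simp add: pcompose_altdef)
  qed
  then have "p = 0" using H pcompose_eq_0[of p \<psi>] d\<psi> by simp
  then have "poly (coeff H j) a = 0" for j by (metis coeff_0 coeff_map_poly p_def poly_0)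
  then have dv: "[:- a, 1:] dvd coeff H j" for j by (simp add: poly_eq_0_iff_dvd)
  then have "[:[:- a, 1:]:] dvd H" by (simp add: const_poly_dvd_iff)
  then obtain Q where Q: "H = [:[:- a, 1:]:] * Q" by blast
  have "\<not> is_unit [:[:- a, 1:] :: complex poly:]"
    by (simp add: is_unit_const_poly_iff is_unit_pCons_iff)
  then have "is_unit Q" using irr Q irreducibleD by blast
  then obtain q where q: "Q = [:[:q:]:]" "q \<noteq> 0"
    by (metis is_unit_poly_iff pCons_0_0 not_is_unit_0)
  have "H = (varX - [:[:a:]:]) * [:[:q:]:]" using Q q by (simp add: varX_def)
  then have "partialX H = [:[:q:]:]"
    by (simp add: partialX.mult partialX.minus del: mult_pCons_left mult_pCons_right)
  then have "subst2 (\<lambda>c. [:c:]) (partialX H) (\<phi>, \<psi>) = [:q:]" by (simp add: subst2_const)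
  then show ?thesis using q by simp
qed

text \<open>
  For every x \<noteq> 0 there is y such that the second entry of R, before L is applied, is 0.  There
  p(x) = P(F(L(x^(-\<alpha>), 0))), which stays bounded when x tends to infinity.
\<close>

lemma dual_vertical_impossible:
  assumes dual: "is_dual F (basis_map L \<alpha> \<beta> \<Phi>) G" and \<alpha>: "0 < \<alpha>"
    and P: "comp_poly P G = [:p:]"
  shows "degree p = 0"
proof (rule ccontr)
  assume "degree p \<noteq> 0"
  then obtain a q where pq: "p = pCons a q" "q \<noteq> 0" by (metis degree_pCons_0 pCons_cases)
  define \<Theta> where "\<Theta> t = Defs.eval_poly P (eval_map F (entry L 1 1 * t, entry L 2 1 * t))" for t
  have val: "poly p x = \<Theta> (inverse (x ^ \<alpha>))" if x: "x \<noteq> 0" for x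
  proof -
    define y where "y = - (inverse (x ^ \<alpha>) * poly \<Phi> x) / x ^ \<beta>"
    have "x ^ \<beta> * y + inverse (x ^ \<alpha>) * poly \<Phi> x = 0" using x by (simp add: y_def)
    then have "basis_point L \<alpha> \<beta> \<Phi> x y = (entry L 1 1 * inverse (x ^ \<alpha>), entry L 2 1 * inverse (x ^ \<alpha>))"
      by (simp add: basis_point_def Let_def)
    then have "eval_map G (x, y) = eval_map F (entry L 1 1 * inverse (x ^ \<alpha>), entry L 2 1 * inverse (x ^ \<alpha>))"
      using eval_dual[OF dual x] by simp
    moreover have "Defs.eval_poly (comp_poly P G) (x, y) = poly p x" by (simp add: P eval_poly_of_X)
    ultimately show ?thesis unfolding \<Theta>_def eval_comp_poly by simp
  qed
  have lin: "((\<lambda>t. m * t) has_field_derivative m * 1) (at t)" for m t :: complex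
    by (intro DERIV_cmult DERIV_ident)
  have "isCont \<Theta> 0"
    unfolding \<Theta>_def eval_map_def
    by (rule DERIV_isCont, rule has_field_derivative_eval_poly; rule has_field_derivative_eval_poly; rule lin)
  then have "\<exists>d>0. \<forall>t. dist t 0 < d \<longrightarrow> dist (\<Theta> t) (\<Theta> 0) < 1"
    unfolding continuous_at_eps_delta by simp
  then obtain d where d: "0 < d" "\<And>t. norm t < d \<Longrightarrow> norm (\<Theta> t - \<Theta> 0) < 1"
    by (auto simp: dist_norm)
  obtain r where r: "\<And>z. r \<le> norm z \<Longrightarrow> norm (\<Theta> 0) + 1 \<le> norm (poly p z)"
    using poly_infinity[OF pq(2), of "norm (\<Theta> 0) + 1" a] pq(1) by auto
  define X where "X = max r (1 + 1 / d)"
  have X: "1 < X" "r \<le> X" "1 / d < X" using d(1) by (auto simp: X_def less_max_iff_disj)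
  define x where "x = complex_of_real X"
  have nx: "norm x = X" using X by (simp add: x_def)
  have "X \<le> X ^ \<alpha>" using X \<alpha> by (intro self_le_power) auto
  then have "1 / d < X ^ \<alpha>" using X by simp
  then have "inverse (X ^ \<alpha>) < d" using d X by (simp add: field_simps)
  then have "norm (inverse (x ^ \<alpha>)) < d" by (simp add: norm_inverse norm_power nx)
  from d(2)[OF this] have "norm (\<Theta> (inverse (x ^ \<alpha>))) < norm (\<Theta> 0) + 1"
    using norm_triangle_ineq2[of "\<Theta> (inverse (x ^ \<alpha>))" "\<Theta> 0"] by linarith
  moreover have "norm (\<Theta> 0) + 1 \<le> norm (poly p x)" by (rule r) (use nx X in simp)
  moreover have "x \<noteq> 0" using nx X by auto
  ultimately show False using val by simp
qed

text \<open>
  Let e be the exponent of the Jacobian determinant and \<gamma> = g + 1.  In the identities of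
  \<open>hamiltonian_identities\<close> the right hand sides have order exactly g in X for one of the two coordinates,
  since (\<phi>, \<psi>) is not constant, and the left hand sides have order exactly e for one of the two partial
  derivatives, since H is irreducible.  This forces e = g.
\<close>

lemma phantom_meets_sing:
  assumes kel: "keller F" and L: "invertible L" and R: "basis_form L R"
    and dual: "is_dual F R G" and H: "component_poly F R H" and S: "phantom_poly F R H S"
  shows "zero_set S \<inter> sing R \<noteq> {}"
proof
  assume empty: "zero_set S \<inter> sing R = {}"
  obtain \<alpha> \<beta> \<Phi> where R': "0 < \<alpha>" "R = basis_map L \<alpha> \<beta> \<Phi>" using R by (auto simp: basis_form_def)
  note dual' = dual[unfolded R'(2)]
  have dG: "dual F R = G" by (rule dual_eqI[OF dual])
  obtain c e where J: "c \<noteq> 0" "jac (fst G) (snd G) = [:[:c:]:] * varX ^ e"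
    using jac_dual[OF kel L R'(1) dual'] by blast
  obtain \<gamma> where \<gamma>: "0 < \<gamma>" "comp_poly H G = varX ^ \<gamma> * S" using S by (auto simp: phantom_poly_def dG)
  then obtain g where g: "\<gamma> = Suc g" by (metis gr0_implies_Suc)
  define \<phi> \<psi> where "\<phi> = at_zero (fst G)" and "\<psi> = at_zero (snd G)"
  have Z: "zero_set H = (\<lambda>y. (poly \<phi> y, poly \<psi> y)) ` UNIV"
  proof -
    have "sing R = (\<lambda>y. (0, y)) ` UNIV" by (auto simp: sing_def)
    then show ?thesis using H by (simp add: component_poly_def R_component_def dG image_image
        eval_map_def eval_poly_zero \<phi>_def \<psi>_def)
  qed
  have irr: "irreducible H" using H by (simp add: component_poly_def)
  have nonconst: "0 < degree \<phi> \<or> 0 < degree \<psi>"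
  proof (rule ccontr)
    assume "\<not> ?thesis"
    then obtain a b where "\<phi> = [:a:]" "\<psi> = [:b:]" by (metis degree_eq_zeroE gr0I)
    then have "zero_set H \<subseteq> {(a, b)}" unfolding Z by auto
    then show False using irreducible_zero_set[OF irr] by blast
  qed
  have Snz: "poly (at_zero S) y \<noteq> 0" for y
  proof
    assume "poly (at_zero S) y = 0"
    then have "(0, y) \<in> zero_set S \<inter> sing R" by (simp add: zero_set_def sing_def eval_poly_zero)
    with empty show False by blast
  qed
  then have "degree (at_zero S) = 0" using fundamental_theorem_of_algebra[of "at_zero S"] by (auto simp: constant_degree)
  then obtain s where s: "at_zero S = [:s:]" by (metis degree_eq_zeroE)
  have s0: "s \<noteq> 0" using Snz[of 0] s by simp
  have HG: "comp_poly H (fst G, snd G) = varX ^ Suc g * S" using \<gamma> g by simp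
  obtain U V where UV:
    "varX ^ e * ([:[:c:]:] * comp_poly (partialX H) (fst G, snd G)) = varX ^ g * U"
    "varX ^ e * ([:[:c:]:] * comp_poly (partialY H) (fst G, snd G)) = varX ^ g * V"
    "at_zero U = Polynomial.smult (of_nat (Suc g) * s) (pderiv \<psi>)"
    "at_zero V = - Polynomial.smult (of_nat (Suc g) * s) (pderiv \<phi>)"
    using hamiltonian_identities[OF J(2) HG s] unfolding \<phi>_def \<psi>_def by blast
  have k: "of_nat (Suc g) * s \<noteq> 0" using s0 by (simp del: of_nat_Suc)
  have "at_zero U \<noteq> 0 \<or> at_zero V \<noteq> 0"
    using nonconst k unfolding UV by (auto simp: pderiv_eq_0_iff simp del: of_nat_Suc)
  then have "e \<le> g" using varX_power_compare[OF UV(1)[symmetric]] varX_power_compare[OF UV(2)[symmetric]] by blast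
  have "at_zero (comp_poly H (fst G, snd G)) = 0" unfolding HG by (simp add: at_zero.hom_mult)
  then have "subst2 (\<lambda>c. [:c:]) H (\<phi>, \<psi>) = 0"
    unfolding \<phi>_def \<psi>_def by (simp only: at_zero_comp_poly)
  from irreducible_relation_smooth[OF irr this nonconst]
  have "at_zero ([:[:c:]:] * comp_poly (partialX H) (fst G, snd G)) \<noteq> 0
      \<or> at_zero ([:[:c:]:] * comp_poly (partialY H) (fst G, snd G)) \<noteq> 0"
    unfolding at_zero.hom_mult at_zero_comp_poly \<phi>_def \<psi>_def using J(1) by simp
  then have "g \<le> e" using varX_power_compare[OF UV(1)] varX_power_compare[OF UV(2)] by blast
  with \<open>e \<le> g\<close> have "jac (fst G) (snd G) = [:[:c:]:] * varX ^ g" using J(2) by simp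
  then obtain P p where "comp_poly P (fst G, snd G) = [:p:]" "0 < degree p"
    using exists_vertical_component[OF _ J(1) HG s s0] nonconst unfolding \<phi>_def \<psi>_def by blast
  then show False using dual_vertical_impossible[OF dual' R'(1), of P p] by simp
qed

theorem theorem4p1:
  fixes F :: polymap and R0 :: "ratmap set" and H S :: "ratmap \<Rightarrow> bipoly"
  assumes "keller F"
    and "geometric_basis F R0"
    and "\<And>R. R \<in> R0 \<Longrightarrow> component_poly F R (H R)"
    and "\<And>R. R \<in> R0 \<Longrightarrow> phantom_poly F R (H R) (S R)"
    and "\<And>R. R \<in> R0 \<Longrightarrow> zero_set (S R) \<inter> sing R = {}"
  shows "range (eval_map F) = UNIV"
proof (cases "is_automorphism F")
  case True
  then obtain G where "\<And>z. eval_map F (eval_map G z) = z" by (auto simp: is_automorphism_def)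
  then show ?thesis by (metis surj_def)
next
  case False
  with assms(2) obtain L R where "invertible L" "R \<in> R0" "basis_form L R" "\<exists>G. is_dual F R G"
    unfolding geometric_basis_def by (metis all_not_in_conv)
  then have False using phantom_meets_sing assms by metis
  then show ?thesis ..
qed

end
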